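(* Let $n\ge 2$, let $K\subseteq\mathbb{R}^n$ be an $n$-dimensional rectangular box, and let $\mu$ be any probability measure on $K$ (the distribution of the starting points). Let $X_{M,R}$ be the random bounce length obtained from $M$ random particles travelling a distance $R$ each in $K$ with starting points distributed according to $\mu$, and let $X=\operatorname{length}(\ell\cap K)$ for a random directed line $\ell$ intersecting $K$ (both as defined in the context). Then $X_{M,R}$ converges in distribution to $X$ as $R\to\infty$ followed by $M\to\infty$, and also as $M\to\infty$ followed by $R\to\infty$.
   Context: Box: $K=[0,a_1]\times\cdots\times[0,a_n]$ with side-lengths $a_1,\dots,a_n>0$. $\mathbb{S}^{n-1}=\{x\in\mathbb{R}^n:\|x\|=1\}$. Definition of $X_{M,R}$ (for an integer $M>0$ and real $R>0$): choose $p^{(1)},\dots,p^{(M)}\in K$ i.i.d. with law $\mu$, and directions $v^{(1)},\dots,v^{(M)}\in\mathbb{S}^{n-1}$ i.i.d. uniformly distributed on the sphere. The $i$-th particle starts at $p^{(i)}$ in direction $v^{(i)}$ and travels along straight lines inside $K$ at unit speed, changing direction precisely when it hits the boundary of the box, where it reflects specularly, until it has travelled total distance $R$. Let $B^{i}$ be the finite multiset of distances travelled between consecutive bounces (hits of the boundary) of the $i$-th particle, and let $B=\bigcup_{i=1}^M B^i$ be the multiset union, with multiplicities added. Then $X_{M,R}$ is an element of $B$ chosen uniformly at random, counted with multiplicity: i.e. if $1_B(x)$ denotes the multiplicity of $x$ in $B$ and $B'=\{x:1_B(x)\ge 1\}$, then $b\in B'$ is selected with probability $1_B(b)/\sum_{x\in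 B'}1_B(x)$. Definition of $X$: directed lines $\ell$ in $\mathbb{R}^n$ are parametrized by pairs $(v,q)$, where $v\in\mathbb{S}^{n-1}$ is the direction of $\ell$ and $q$ is the unique point of $\ell$ in the hyperplane $v^\perp$ through the origin orthogonal to $v$. Let $d\ell=dA(q)\,dS(v)$, where $dA$ is Lebesgue measure on $v^\perp$ and $dS$ is the surface measure on $\mathbb{S}^{n-1}$; this is the translation- and rotation-invariant measure on directed lines, unique up to a constant. Restrict $d\ell$ to the set of directed lines intersecting $K$ and normalize it to a probability measure. Then $X=\operatorname{length}(\ell\cap K)$ where $\ell$ is a random directed line with this law. "As $R\to\infty$ followed by $M\to\infty$" means the iterated limit in which first $R\to\infty$ with $M$ fixed and then $M\to\infty$; similarly for the other order. *)

theory Defs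
  imports "HOL-Probability.Probability"
begin

section \<open>Convergence in distribution along a filter\<close>

text \<open>
  The library notion \<^const>\<open>weak_conv_m\<close> covers sequences only; here the index may also be
  a real number tending to infinity.
\<close>

definition converges_in_distribution ::
    "('i \<Rightarrow> real measure) \<Rightarrow> real measure \<Rightarrow> 'i filter \<Rightarrow> bool" where
  "converges_in_distribution P L F \<longleftrightarrow>
     (\<forall>x. isCont (cdf L) x \<longrightarrow> ((\<lambda>i. cdf (P i) x) \<longlongrightarrow> cdf L x) F)"

lemma converges_in_distribution_sequentially:
  "converges_in_distribution P L sequentially \<longleftrightarrow> weak_conv_m P L"
  by (simp add: converges_in_distribution_def weak_conv_m_def weak_conv_def)


section \<open>Surface measure on the sphere\<close>

text \<open>
  The surface area of a Borel set \<open>A\<close> of unit vectors in \<open>n\<close>-dimensional space is \<open>n\<close> times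
  the volume of the cone \<open>{t x | x \<in> A, 0 < t \<le> 1}\<close> over it.
\<close>

definition surface_measure :: "(real^'n) measure" where
  "surface_measure =
     scale_measure (of_nat CARD('n))
       (distr (restrict_space lborel (cball 0 1 - {0})) (restrict_space borel (sphere 0 1))
          (\<lambda>x. x /\<^sub>R norm x))"

definition uniform_direction :: "(real^'n) measure" where
  "uniform_direction = uniform_measure surface_measure (sphere 0 1)"


section \<open>Billiard trajectories in a box\<close>

text \<open>
  The box is \<open>cbox 0 a\<close>, and a state \<open>(x, v)\<close> consists of a position in it and a unit velocity.
  Specular reflection in a face reverses the component of the velocity normal to that face.
  At a point on several faces, every component that points out of the box is reversed; for any
  starting point, the initial directions leading to such a point after time 0 form a null set.
  A particle that starts on the boundary and points out of the box bounces at time 0; one that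
  starts there pointing inwards does not.
\<close>

definition exit_time :: "real^'n \<Rightarrow> (real^'n) \<times> (real^'n) \<Rightarrow> real" where
  "exit_time a = (\<lambda>(x, v). Sup {t. 0 \<le> t \<and> x + t *\<^sub>R v \<in> cbox 0 a})"

definition reflect :: "real^'n \<Rightarrow> real^'n \<Rightarrow> real^'n \<Rightarrow> real^'n" where
  "reflect a y v =
     (\<chi> i. if (y $ i = 0 \<and> v $ i < 0) \<or> (y $ i = a $ i \<and> v $ i > 0) then - (v $ i) else v $ i)"

definition bounce :: "real^'n \<Rightarrow> (real^'n) \<times> (real^'n) \<Rightarrow> (real^'n) \<times> (real^'n)" where
  "bounce a = (\<lambda>(x, v). let y = x + exit_time a (x, v) *\<^sub>R v in (y, reflect a y v))"

text \<open>
  Bounces are numbered from 0. The flight with index 0 leads from the starting point to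
  bounce 0, and the flight with index \<open>Suc k\<close> from bounce \<open>k\<close> to bounce \<open>Suc k\<close>. The speed is 1,
  so durations are distances.
\<close>

definition flight :: "real^'n \<Rightarrow> (real^'n) \<times> (real^'n) \<Rightarrow> nat \<Rightarrow> real" where
  "flight a s k = exit_time a ((bounce a ^^ k) s)"

definition bounce_time :: "real^'n \<Rightarrow> (real^'n) \<times> (real^'n) \<Rightarrow> nat \<Rightarrow> real" where
  "bounce_time a s k = (\<Sum>j\<le>k. flight a s j)"

text \<open>
  The initial flight and the flight interrupted at distance \<open>R\<close> do not join two consecutive
  bounces, so they do not contribute.
\<close>

definition bounce_lengths :: "real^'n \<Rightarrow> real \<Rightarrow> (real^'n) \<times> (real^'n) \<Rightarrow> real multiset" where
  "bounce_lengths a R s =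
     image_mset (\<lambda>k. flight a s (Suc k)) (mset_set {k. bounce_time a s (Suc k) \<le> R})"


section \<open>The random bounce length\<close>

text \<open>
  If no particle has completed a flight between two bounces, there is nothing to choose from
  and the value is 0 by convention. This cannot happen when \<open>M > 0\<close> and \<open>R\<close> is at least twice
  the diameter of the box.
\<close>

definition pick_uniformly :: "real multiset \<Rightarrow> real measure" where
  "pick_uniformly B =
     distr (measure_pmf (if B = {#} then return_pmf 0 else pmf_of_multiset B)) borel id"

definition bounce_law ::
    "real^'n \<Rightarrow> (real^'n) measure \<Rightarrow> nat \<Rightarrow> real \<Rightarrow> real measure" where
  "bounce_law a \<mu> M R =
     bind (PiM {..<M} (\<lambda>_. \<mu> \<Otimes>\<^sub>M uniform_direction))
       (\<lambda>\<omega>. pick_uniformly (\<Sum>i<M. bounce_lengths a R (\<omega> i)))"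


section \<open>Random directed lines\<close>

text \<open>
  Lebesgue measure on the hyperplane orthogonal to \<open>v\<close>, as a measure on the ambient space: the
  image of product Lebesgue measure under the isometry given by an orthonormal basis of that
  hyperplane. It does not depend on the chosen basis.
\<close>

definition hyperplane_basis :: "real^'n \<Rightarrow> (real^'n) set" where
  "hyperplane_basis v =
     (SOME B. pairwise orthogonal B \<and> (\<forall>b\<in>B. norm b = 1) \<and> span B = {x. v \<bullet> x = 0})"

definition hyperplane_lborel :: "real^'n \<Rightarrow> (real^'n) measure" where
  "hyperplane_lborel v =
     distr (PiM (hyperplane_basis v) (\<lambda>_. lborel)) borel
       (\<lambda>c. \<Sum>b\<in>hyperplane_basis v. c b *\<^sub>R b)"

definition directed_lines :: "((real^'n) \<times> (real^'n)) set" where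
  "directed_lines = {(v, q). norm v = 1 \<and> v \<bullet> q = 0}"

definition points_of_line :: "(real^'n) \<times> (real^'n) \<Rightarrow> (real^'n) set" where
  "points_of_line = (\<lambda>(v, q). range (\<lambda>t. q + t *\<^sub>R v))"

definition line_measure :: "((real^'n) \<times> (real^'n)) measure" where
  "line_measure =
     measure_of directed_lines (sets (restrict_space borel directed_lines))
       (\<lambda>E. \<integral>\<^sup>+v. emeasure (hyperplane_lborel v) {q. (v, q) \<in> E} \<partial>surface_measure)"

definition random_line :: "real^'n \<Rightarrow> ((real^'n) \<times> (real^'n)) measure" where
  "random_line a =
     uniform_measure line_measure {l \<in> directed_lines. points_of_line l \<inter> cbox 0 a \<noteq> {}}"

text \<open>
  Since \<open>v\<close> is a unit vector, \<open>t \<mapsto> q + t v\<close> parametrizes the line by arc length.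
\<close>

definition chord_length :: "real^'n \<Rightarrow> (real^'n) \<times> (real^'n) \<Rightarrow> real" where
  "chord_length a = (\<lambda>(v, q). measure lborel {t. q + t *\<^sub>R v \<in> cbox 0 a})"

definition chord_law :: "real^'n \<Rightarrow> real measure" where
  "chord_law a = distr (random_line a) borel (chord_length a)"

end

theory Submission
  imports Defs "HOL-Real_Asymp.Real_Asymp"
begin

text \<open>
  Reflecting the box instead of the particle turns a trajectory with direction \<open>v\<close> into a straight
  line, and the wall pair orthogonal to the \<open>i\<close>-th axis is then hit periodically, \<open>\<beta>\<^sub>i = \<bar>v\<^sub>i\<bar> / a\<^sub>i\<close>
  times per unit of length. So the flights of one particle are the gaps in a superposition of \<open>n\<close>
  arithmetic progressions (\<open>periodic_clocks\<close>), and the sign changes of the velocity need not be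
  followed at all.

  The theorem holds because, for almost every fixed \<open>v\<close>, two quantities agree for each threshold \<open>x\<close>:
  the number of flights longer than \<open>x\<close> per unit of distance travelled, and \<open>1/V\<close> times the measure
  of the lines of direction \<open>v\<close> whose chord in the box is longer than \<open>x\<close>, where \<open>V = a\<^sub>1 \<cdot> \<dots> \<cdot> a\<^sub>n\<close>. Neither
  is computed directly. Both are nonincreasing functions of \<open>x\<close>, and their integrals over \<open>{x..}\<close> are
  easy to find:

    \<^item> The sum of \<open>max 0 (g - x)\<close> over the flights \<open>g\<close> is the measure of the times that are followed by
      a stretch of length \<open>x\<close> without a bounce. The time until the next hit of wall \<open>i\<close> is a function
      of the \<open>i\<close>-th phase of a linear flow on a torus. By Weyl's theorem
      (\<open>equidistribution_linear_flow\<close>) these phases become independent and uniform if the \<open>\<beta>\<^sub>i\<close> are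
      rationally independent, so such times have density \<open>G x = (\<Prod>i. max 0 (1 - x \<beta>\<^sub>i))\<close>.

    \<^item> By Fubini's theorem along lines of direction \<open>v\<close>, the integral of \<open>max 0 (chord - x)\<close> over these
      lines is the volume of the points \<open>p\<close> such that \<open>p\<close> and \<open>p + x v\<close> both lie in the box, which is
      \<open>V \<cdot> G x\<close>.

  A monotone function is determined by its integral wherever the latter is differentiable, also in the
  limit. This is \<open>flight_rate_limit\<close>: both quantities are \<open>- G' x\<close>, which is \<open>flight_rate\<close>. It
  is applied once with \<open>R \<rightarrow> \<infinity>\<close> (\<open>long_flights_rate\<close>) and once to a constant family
  (\<open>long_chords_rate\<close>). The set of directions excluded, given by rational dependence, a vanishing
  coordinate, or \<open>x \<beta>\<^sub>i = 1\<close> for some \<open>i\<close>, is null for the surface measure of the sphere.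

  Averaging over \<open>v\<close>, the probability that the random chord is longer than \<open>x\<close> is the quotient of the
  mean flight rate at \<open>x\<close> and the mean flight rate below 0, which counts all flights
  (\<open>cdf_chord_law\<close>). On the billiard side, the probability of picking a flight longer than \<open>x\<close> is the
  expectation of a quotient of two sums over the \<open>M\<close> particles. If \<open>R \<rightarrow> \<infinity>\<close> first, each summand divided
  by \<open>R\<close> tends to its flight rate, and \<open>M \<rightarrow> \<infinity>\<close> replaces sums by means. If \<open>M \<rightarrow> \<infinity>\<close> first, the
  sums are replaced by the mean counts for distance \<open>R\<close>, and these divided by \<open>R\<close> tend to the mean
  flight rates by dominated convergence. Both times the passage to means is the weak law of large
  numbers for quotients (\<open>law_of_large_numbers_ratio\<close>). The starting points disappear because the flight
  rate depends on the direction only.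
\<close>

section \<open>Equidistribution of linear flows on the torus\<close>

text \<open>
  Measurability and boundedness are part of the definition, so that the integrals behind the means
  always exist and products can be handled without further assumptions.
\<close>

definition has_time_mean :: "(real \<Rightarrow> complex) \<Rightarrow> complex \<Rightarrow> bool" where
  "has_time_mean f L \<longleftrightarrow> f \<in> borel_measurable borel \<and> (\<exists>B. \<forall>t. norm (f t) \<le> B) \<and>
     ((\<lambda>R. (LINT t:{0..R}|lborel. f t) / of_real R) \<longlongrightarrow> L) at_top"

lemma set_integrable_bounded:
  fixes f :: "real \<Rightarrow> 'b::{banach, second_countable_topology}"
  assumes [measurable]: "f \<in> borel_measurable borel" and "\<And>t. norm (f t) \<le> B"
  shows "set_integrable lborel {a..b::real} f"
proof -
  have "set_integrable lborel {a..b} (\<lambda>t. B)"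
    unfolding set_integrable_def by (cases "a \<le> b") auto
  then show ?thesis
    by (rule set_integrable_bound) (use assms(2) in \<open>auto simp: set_borel_measurable_def intro: order_trans[OF assms(2)] abs_ge_self\<close>)
qed

lemma set_nn_integral_eq_set_integral:
  fixes f :: "'a \<Rightarrow> real"
  assumes "set_integrable M A f" "\<And>x. 0 \<le> f x"
  shows "(\<integral>\<^sup>+x\<in>A. ennreal (f x) \<partial>M) = ennreal (LINT x:A|M. f x)"
proof -
  have "(\<integral>\<^sup>+x\<in>A. ennreal (f x) \<partial>M) = (\<integral>\<^sup>+x. ennreal (indicator A x *\<^sub>R f x) \<partial>M)"
    by (intro nn_integral_cong) (auto split: split_indicator)
  also have "\<dots> = ennreal (LINT x:A|M. f x)"
    using assms unfolding set_lebesgue_integral_def set_integrable_def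
    by (intro nn_integral_eq_integral) auto
  finally show ?thesis .
qed

lemma has_time_mean_integrable:
  "has_time_mean f L \<Longrightarrow> set_integrable lborel {a..b} f"
  unfolding has_time_mean_def by (meson set_integrable_bounded)

lemma has_time_mean_add:
  assumes "has_time_mean f L" "has_time_mean g L'"
  shows "has_time_mean (\<lambda>t. f t + g t) (L + L')"
proof -
  obtain B B' where "\<forall>t. norm (f t) \<le> B" "\<forall>t. norm (g t) \<le> B'"
    using assms unfolding has_time_mean_def by blast
  then have "\<forall>t. norm (f t + g t) \<le> B + B'"
    by (metis norm_triangle_mono)
  moreover have "((\<lambda>R. (LINT t:{0..R}|lborel. f t) / of_real R + (LINT t:{0..R}|lborel. g t) / of_real R)
      \<longlongrightarrow> L + L') at_top"
    using assms unfolding has_time_mean_def by (intro tendsto_add) auto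
  moreover have "(LINT t:{0..R}|lborel. f t + g t) = (LINT t:{0..R}|lborel. f t) + (LINT t:{0..R}|lborel. g t)" for R
    using assms[THEN has_time_mean_integrable] by (rule set_integral_add(2))
  ultimately show ?thesis
    using assms unfolding has_time_mean_def by (auto simp: add_divide_distrib)
qed

lemma has_time_mean_cmult:
  assumes "has_time_mean f L"
  shows "has_time_mean (\<lambda>t. c * f t) (c * L)"
proof -
  obtain B where "\<forall>t. norm (f t) \<le> B"
    using assms unfolding has_time_mean_def by blast
  then have "\<forall>t. norm (c * f t) \<le> norm c * B"
    by (auto simp: norm_mult intro: mult_left_mono)
  moreover have "((\<lambda>R. c * ((LINT t:{0..R}|lborel. f t) / of_real R)) \<longlongrightarrow> c * L) at_top"
    using assms unfolding has_time_mean_def by (intro tendsto_mult_left) auto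
  ultimately show ?thesis
    using assms unfolding has_time_mean_def by auto
qed

lemma borel_measurable_frac: "(\<lambda>u::real. frac u) \<in> borel_measurable borel"
  unfolding frac_def by measurable

lemma has_vector_derivative_cis_linear:
  assumes "w \<noteq> 0"
  shows "((\<lambda>t. cis (w * t + \<theta>) / (\<i> * of_real w)) has_vector_derivative cis (w * t + \<theta>)) (at t within X)"
proof -
  have "((\<lambda>z. exp (\<i> * (of_real w * z + of_real \<theta>)) / (\<i> * of_real w)) has_field_derivative
      exp (\<i> * (of_real w * of_real t + of_real \<theta>))) (at (of_real t))"
    using assms by (auto intro!: derivative_eq_intros simp: mult.left_commute[of \<i>])
  from has_vector_derivative_real_field[OF this, of X] show ?thesis
    by (simp add: cis_conv_exp)
qed

text \<open>
  An oscillating character has a bounded primitive, which disappears after division by \<open>R\<close>.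
\<close>

lemma has_time_mean_cis:
  "has_time_mean (\<lambda>t. cis (w * t + \<theta>)) (if w = 0 then cis \<theta> else 0)"
proof (cases "w = 0")
  case True
  have "\<forall>\<^sub>F R in at_top. cis \<theta> = (LINT t:{0..R}|lborel. cis \<theta>) / of_real R"
    using eventually_gt_at_top[of "0::real"]
  proof eventually_elim
    case (elim R)
    then show ?case by (simp add: set_lebesgue_integral_def scaleR_conv_of_real)
  qed
  then show ?thesis
    using True by (auto simp: has_time_mean_def intro: tendsto_eventually exI[of _ 1] elim!: eventually_mono)
next
  case False
  define F where "F = (\<lambda>t. cis (w * t + \<theta>) / (\<i> * of_real w))"
  have D: "(F has_vector_derivative cis (w * t + \<theta>)) (at t within X)" for t X
    unfolding F_def using has_vector_derivative_cis_linear[OF False] .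
  have I: "(LINT t:{0..R}|lborel. cis (w * t + \<theta>)) = F R - F 0" if "0 \<le> R" for R
    unfolding set_lebesgue_integral_def
    by (intro integral_FTC_Icc D that) (auto intro!: continuous_intros)
  have "norm (F t) \<le> 1 / \<bar>w\<bar>" for t
    by (simp add: F_def norm_divide norm_mult)
  then have N: "norm (F R - F 0) \<le> 2 / \<bar>w\<bar>" for R
    by (intro order_trans[OF norm_triangle_ineq4]) (smt (verit) add_divide_distrib)
  have "((\<lambda>R. (LINT t:{0..R}|lborel. cis (w * t + \<theta>)) / of_real R) \<longlongrightarrow> 0) at_top"
  proof (rule Lim_null_comparison)
    show "\<forall>\<^sub>F R in at_top. norm ((LINT t:{0..R}|lborel. cis (w * t + \<theta>)) / of_real R) \<le> 2 / \<bar>w\<bar> / R"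
      using eventually_gt_at_top[of "0::real"]
    proof eventually_elim
      case (elim R)
      then show ?case using divide_right_mono[OF N, of R R] by (simp add: I norm_divide)
    qed
    show "((\<lambda>R. 2 / \<bar>w\<bar> / R) \<longlongrightarrow> 0) at_top"
      by real_asymp
  qed
  then show ?thesis
    using False by (auto simp: has_time_mean_def cis_conv_exp intro: exI[of _ 1])
qed

text \<open>
  Functions with a mean are closed under approximation in the seminorm given by the upper time mean
  of the absolute value. A discontinuous function is admissible here, where uniform approximation by
  trigonometric polynomials would be impossible.
\<close>

lemma has_time_mean_approx:
  assumes f: "f \<in> borel_measurable borel" "\<And>t. norm (f t) \<le> B"
    and approx: "\<And>e. e > 0 \<Longrightarrow> \<exists>h M. has_time_mean h M \<and> norm (M - L) \<le> e \<and>
      (\<forall>\<^sub>F R in at_top. (LINT t:{0..R}|lborel. norm (f t - h t)) \<le> e * R)"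
  shows "has_time_mean f L"
proof -
  have "((\<lambda>R. (LINT t:{0..R}|lborel. f t) / of_real R) \<longlongrightarrow> L) at_top"
  proof (rule tendstoI)
    fix e :: real assume "e > 0"
    then obtain h M where h: "has_time_mean h M" "norm (M - L) \<le> e/4"
      and close: "\<forall>\<^sub>F R in at_top. (LINT t:{0..R}|lborel. norm (f t - h t)) \<le> e/4 * R"
      using approx[of "e/4"] by auto
    have "\<forall>\<^sub>F R in at_top. dist ((LINT t:{0..R}|lborel. h t) / of_real R) M < e/4"
      using h \<open>e > 0\<close> unfolding has_time_mean_def by (intro tendstoD) auto
    with close eventually_gt_at_top[of "0::real"]
    show "\<forall>\<^sub>F R in at_top. dist ((LINT t:{0..R}|lborel. f t) / of_real R) L < e"
    proof eventually_elim
      case (elim R)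
      have int: "set_integrable lborel {0..R} f" "set_integrable lborel {0..R} h"
        using set_integrable_bounded[OF f] has_time_mean_integrable[OF h(1)] by auto
      have "norm ((LINT t:{0..R}|lborel. f t) - (LINT t:{0..R}|lborel. h t))
          = norm (LINT t:{0..R}|lborel. f t - h t)"
        using int by (simp add: set_integral_diff)
      also have "\<dots> \<le> (LINT t:{0..R}|lborel. norm (f t - h t))"
        using int by (intro set_integral_norm_bound) auto
      also have "\<dots> \<le> e/4 * R" using elim by simp
      finally have "norm ((LINT t:{0..R}|lborel. f t) / of_real R - (LINT t:{0..R}|lborel. h t) / of_real R) \<le> e/4"
        using elim by (simp add: diff_divide_distrib[symmetric] norm_divide field_simps)
      then have "dist ((LINT t:{0..R}|lborel. f t) / of_real R) ((LINT t:{0..R}|lborel. h t) / of_real R) \<le> e/4"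
        by (simp add: dist_norm)
      moreover have "dist M L \<le> e/4" using h by (simp add: dist_norm)
      ultimately show ?case
        using elim \<open>e > 0\<close> dist_triangle[of "(LINT t:{0..R}|lborel. f t) / of_real R" L "(LINT t:{0..R}|lborel. h t) / of_real R"]
         dist_triangle[of "(LINT t:{0..R}|lborel. h t) / of_real R" L M] by linarith
    qed
  qed
  then show ?thesis using f unfolding has_time_mean_def by blast
qed

inductive trig_poly :: "(real \<Rightarrow> complex) \<Rightarrow> bool" where
  char: "trig_poly (\<lambda>u. cis (2 * pi * of_int k * u))"
| add: "trig_poly f \<Longrightarrow> trig_poly g \<Longrightarrow> trig_poly (\<lambda>u. f u + g u)"
| scale: "trig_poly f \<Longrightarrow> trig_poly (\<lambda>u. c * f u)"

lemma trig_poly_continuous: "trig_poly f \<Longrightarrow> continuous_on UNIV f"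
  by (induction rule: trig_poly.induct) (auto intro!: continuous_intros)

lemma trig_poly_periodic: "trig_poly f \<Longrightarrow> f (u + of_int j) = f u"
proof (induction rule: trig_poly.induct)
  case (char k)
  have "cis (2 * pi * of_int k * of_int j) = 1"
    using cis_multiple_2pi[of "of_int (k * j)"] by (simp add: mult_ac)
  then show ?case by (simp add: distrib_left flip: cis_mult)
qed auto

lemma trig_poly_mult:
  assumes "trig_poly f" "trig_poly g"
  shows "trig_poly (\<lambda>u. f u * g u)"
  using assms
proof (induction rule: trig_poly.induct)
  case (char k)
  from char(1) show ?case
  proof (induction rule: trig_poly.induct)
    case (char l)
    have "(\<lambda>u. cis (2 * pi * of_int k * u) * cis (2 * pi * of_int l * u)) =
        (\<lambda>u. cis (2 * pi * of_int (k + l) * u))"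
      by (simp add: cis_mult algebra_simps)
    then show ?case using trig_poly.char[of "k + l"] by simp
  next
    case (add f g) then show ?case using trig_poly.add[OF add.IH] by (simp add: distrib_left)
  next
    case (scale f c) then show ?case using trig_poly.scale[OF scale.IH, of c] by (simp add: mult_ac)
  qed
next
  case (add f1 f2)
  from trig_poly.add[OF add.IH[OF add.prems]] show ?case by (simp add: distrib_right)
next
  case (scale f c)
  from trig_poly.scale[OF scale.IH[OF scale.prems], of c] show ?case by (simp add: mult_ac)
qed

lemma trig_poly_const: "trig_poly (\<lambda>u. c)"
  using trig_poly.scale[OF trig_poly.char[of 0], of c] by simp

text \<open>
  This connects the Stone-Weierstrass theorem, which provides real polynomials on the unit circle in
  the complex plane, with trigonometric polynomials on the line.
\<close>

lemma trig_poly_of_real_polynomial: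
  assumes "real_polynomial_function (p :: complex \<Rightarrow> real)"
  shows "trig_poly (\<lambda>u. of_real (p (cis (2 * pi * u))))"
  using assms
proof (induction rule: real_polynomial_function.induct)
  case (linear f)
  interpret bounded_linear f by fact
  have f: "f z = Re z * f 1 + Im z * f \<i>" for z
  proof -
    have "f z = f (Re z *\<^sub>R 1 + Im z *\<^sub>R \<i>)"
      by (intro arg_cong[where f=f]) (simp add: complex_eq_iff)
    also have "\<dots> = Re z * f 1 + Im z * f \<i>"
      by (simp add: add scaleR)
    finally show ?thesis .
  qed
  have *: "complex_of_real (f (cis (2 * pi * u))) =
     of_real (f 1) / 2 * (cis (2 * pi * of_int 1 * u) + cis (2 * pi * of_int (-1) * u)) +
     of_real (f \<i>) / (2 * \<i>) * (cis (2 * pi * of_int 1 * u) + (-1) * cis (2 * pi * of_int (-1) * u))" for u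
    by (subst f) (simp add: complex_eq_iff)
  show ?case unfolding *
    by (intro trig_poly.add trig_poly.scale trig_poly.char)
next
  case (const c) show ?case by (rule trig_poly_const)
next
  case (add f g) from trig_poly.add[OF add.IH] show ?case by simp
next
  case (mult f g) from trig_poly_mult[OF mult.IH] show ?case by simp
qed

text \<open>
  The set \<open>{0..<c}\<close> corresponds to an arc of the unit circle. Its indicator is approximated in the mean
  by continuous tent functions over the arc, and these uniformly by polynomials.
\<close>

lemma trig_poly_approx_initial_segment:
  assumes c: "0 \<le> c" "c \<le> 1" and "e > 0"
  shows "\<exists>h. trig_poly h \<and> (LINT u:{0..1}|lborel. norm (h u - of_bool (frac u < c))) < e"
proof -
  define arc where "arc = (\<lambda>u. cis (2 * pi * u)) ` {0..c}"
  have "compact arc" unfolding arc_def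
    by (intro compact_continuous_image continuous_intros) auto
  have "arc \<noteq> {}" using c by (auto simp: arc_def)
  have arc_iff: "cis (2 * pi * u) \<in> arc \<longleftrightarrow> frac u < c" if "u \<in> {0<..<1}" "u \<noteq> c" for u
  proof
    assume "cis (2 * pi * u) \<in> arc"
    then obtain w where w: "w \<in> {0..c}" "cis (2 * pi * u) = cis (2 * pi * w)" by (auto simp: arc_def)
    then obtain j where "2 * pi * u = 2 * pi * w + 2 * pi * of_int j"
      using sin_cos_eq_iff[of "2 * pi * u" "2 * pi * w"] by (auto simp: complex_eq_iff)
    then have "2 * pi * u = 2 * pi * (w + of_int j)" by (simp add: algebra_simps)
    then have u: "u = w + of_int j" by simp
    have "of_int j < (1::real)" "of_int j > (-1::real)" using u w that c by auto
    then have "j = 0" by linarith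
    with u that w have "u < c" by auto
    moreover have "frac u = u" using that by (simp add: frac_eq)
    ultimately show "frac u < c" by simp
  next
    assume "frac u < c"
    moreover have "frac u = u" using that by (simp add: frac_eq)
    ultimately have "u \<in> {0..c}" using that by simp
    then show "cis (2 * pi * u) \<in> arc" by (auto simp: arc_def)
  qed
  \<comment> \<open>Each tent is continuous and equals 1 on the arc; outside of it the tents decrease to 0.\<close>
  define tent where "tent = (\<lambda>(n::nat) z. max 0 (1 - real n * infdist z arc))"
  have tent_cont: "continuous_on X (tent n)" for X n
    unfolding tent_def by (intro continuous_intros)
  have tent_lim: "(\<lambda>n. tent n z) \<longlonglongrightarrow> of_bool (z \<in> arc)" for z
  proof (cases "z \<in> arc")
    case True
    then show ?thesis by (simp add: tent_def)
  next
    case False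
    then have pos: "infdist z arc > 0"
      using \<open>compact arc\<close> \<open>arc \<noteq> {}\<close> by (simp add: compact_imp_closed infdist_pos_not_in_closed)
    obtain N where N: "real N * infdist z arc > 1"
      using reals_Archimedean3[OF pos] by blast
    have "\<forall>\<^sub>F n in sequentially. tent n z = 0"
      using eventually_ge_at_top[of N]
    proof eventually_elim
      case (elim n)
      then have "real N * infdist z arc \<le> real n * infdist z arc"
        using pos by (intro mult_right_mono) auto
      with N show ?case by (simp add: tent_def)
    qed
    then show ?thesis using False by (simp add: tendsto_eventually)
  qed
  have m[measurable]: "tent n \<in> borel_measurable borel" for n
    using tent_cont[of UNIV n] by (rule borel_measurable_continuous_onI)
  note borel_measurable_frac[measurable]
  have [measurable]: "(\<lambda>z::real. cis (2 * pi * z)) \<in> borel_measurable borel"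
    by (intro borel_measurable_continuous_onI continuous_intros)
  have "(\<lambda>n. LINT u:{0..1}|lborel. \<bar>tent n (cis (2 * pi * u)) - of_bool (frac u < c)\<bar>)
      \<longlonglongrightarrow> (LINT u:{0..1::real}|lborel. (0::real))"
    unfolding set_lebesgue_integral_def
  proof (rule integral_dominated_convergence[where w="indicat_real {0..1::real}"
      and s="\<lambda>n u. indicat_real {0..1} u *\<^sub>R \<bar>tent n (cis (2 * pi * u)) - of_bool (frac u < c)\<bar>"
      and f="\<lambda>u. indicat_real {0..1} u *\<^sub>R (0::real)"])
    have "AE u in lborel. u \<noteq> c \<and> u \<noteq> 0 \<and> u \<noteq> (1::real)"
      using AE_lborel_singleton[of c] AE_lborel_singleton[of 0] AE_lborel_singleton[of 1] by eventually_elim auto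
    then show "AE u in lborel. (\<lambda>n. indicat_real {0..1} u *\<^sub>R \<bar>tent n (cis (2 * pi * u)) - of_bool (frac u < c)\<bar>)
        \<longlonglongrightarrow> indicator {0..1} u *\<^sub>R 0"
    proof eventually_elim
      case (elim u)
      show ?case
      proof (cases "u \<in> {0<..<1}")
        case True
        have "(\<lambda>n. indicat_real {0..1} u *\<^sub>R \<bar>tent n (cis (2 * pi * u)) - of_bool (frac u < c)\<bar>)
            \<longlonglongrightarrow> indicat_real {0..1} u *\<^sub>R \<bar>of_bool (cis (2 * pi * u) \<in> arc) - of_bool (frac u < c)\<bar>"
          by (intro tendsto_intros tent_lim)
        then show ?thesis using arc_iff[OF True] elim by simp
      qed (use elim in \<open>auto simp: indicator_def\<close>)
    qed
    have "\<bar>tent n z - of_bool b\<bar> \<le> 1" for n z b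
    proof -
      have "0 \<le> real n * infdist z arc" by (simp add: infdist_nonneg)
      then show ?thesis by (auto simp: tent_def max_def)
    qed
    then show "AE u in lborel. norm (indicat_real {0..1} u *\<^sub>R \<bar>tent n (cis (2 * pi * u)) - of_bool (frac u < c)\<bar>) \<le> indicator {0..1} u" for n
      by (auto simp: indicator_def)
  qed (auto simp: of_bool_def)
  then have "(\<lambda>n. LINT u:{0..1}|lborel. \<bar>tent n (cis (2 * pi * u)) - of_bool (frac u < c)\<bar>) \<longlonglongrightarrow> 0"
    by simp
  from order_tendstoD(2)[OF this, of "e/2"] \<open>e > 0\<close>
  obtain n where n: "(LINT u:{0..1}|lborel. \<bar>tent n (cis (2 * pi * u)) - of_bool (frac u < c)\<bar>) < e/2"
    by (auto simp: eventually_sequentially)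
  obtain p where p: "real_polynomial_function p" "\<And>z. z \<in> sphere 0 1 \<Longrightarrow> \<bar>tent n z - p z\<bar> < e/2"
    using Stone_Weierstrass_real_polynomial_function[OF _ tent_cont[of "sphere 0 1" n], of "e/2"] \<open>e > 0\<close>
    by (auto simp: compact_sphere)
  define h where "h = (\<lambda>u. complex_of_real (p (cis (2 * pi * u))))"
  have h: "trig_poly h" unfolding h_def by (rule trig_poly_of_real_polynomial[OF p(1)])
  have hm[measurable]: "h \<in> borel_measurable borel"
    using trig_poly_continuous[OF h] by (rule borel_measurable_continuous_onI)
  have tb: "norm (\<bar>tent n (cis (2 * pi * u)) - of_bool (frac u < c)\<bar> + e/2) \<le> 1 + e/2" for u
  proof -
    have "0 \<le> real n * infdist (cis (2*pi*u)) arc" by (simp add: infdist_nonneg)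
    then show ?thesis using \<open>e > 0\<close> by (auto simp: tent_def max_def)
  qed
  have le: "norm (h u - of_bool (frac u < c)) \<le> \<bar>tent n (cis (2 * pi * u)) - of_bool (frac u < c)\<bar> + e/2" for u
  proof -
    have eq: "h u - of_bool (frac u < c) = of_real (p (cis (2 * pi * u)) - of_bool (frac u < c))"
      by (simp add: h_def)
    show ?thesis
      unfolding eq norm_of_real using p(2)[of "cis (2 * pi * u)", unfolded mem_sphere_0 norm_cis, OF refl]
      by linarith
  qed
  have "(LINT u:{0..1}|lborel. norm (h u - of_bool (frac u < c)))
      \<le> (LINT u:{0..1}|lborel. \<bar>tent n (cis (2 * pi * u)) - of_bool (frac u < c)\<bar> + e/2)"
  proof (rule set_integral_mono)
    show "set_integrable lborel {0..1} (\<lambda>u. norm (h u - of_bool (frac u < c)))"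
    proof (rule set_integrable_bounded[where B="1+e/2"])
      show "norm (norm (h u - of_bool (frac u < c))) \<le> 1 + e/2" for u
        using le[of u] tb[of u] by simp
    qed (simp add: of_bool_def)
    show "set_integrable lborel {0..1} (\<lambda>u. \<bar>tent n (cis (2 * pi * u)) - of_bool (frac u < c)\<bar> + e/2)"
      by (rule set_integrable_bounded[OF _ tb]) (auto simp: of_bool_def)
  qed (use le in auto)
  also have "\<dots> = (LINT u:{0..1}|lborel. \<bar>tent n (cis (2 * pi * u)) - of_bool (frac u < c)\<bar>) + (LINT u:{0..1::real}|lborel. e/2)"
  proof (rule set_integral_add)
    show "set_integrable lborel {0..1} (\<lambda>u. \<bar>tent n (cis (2 * pi * u)) - of_bool (frac u < c)\<bar>)"
    proof (rule set_integrable_bounded[where B="1+e/2"])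
      show "norm \<bar>tent n (cis (2 * pi * u)) - of_bool (frac u < c)\<bar> \<le> 1 + e/2" for u
        using tb[of u] \<open>e > 0\<close> by simp
    qed (simp add: of_bool_def)
  qed (auto simp: set_integrable_def)
  also have "(LINT u:{0..1::real}|lborel. e/2) = e/2"
    by (simp add: set_lebesgue_integral_def)
  finally show ?thesis using n h by (intro exI[of _ h]) auto
qed

text \<open>
  The image of \<open>{0..R}\<close> under the affine map is covered by at most \<open>\<beta> R + 2\<close> unit intervals with
  integer ends, and each contributes the integral over one period. So upper time means of a periodic
  function are bounded by its mean over one period.
\<close>

lemma periodic_integral_le:
  fixes k :: "real \<Rightarrow> real"
  assumes [measurable]: "k \<in> borel_measurable borel" and k: "\<And>u. 0 \<le> k u" "\<And>u. k u \<le> B"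
    and per: "\<And>u j::int. k (u + of_int j) = k u"
    and pos: "\<beta> > 0" "R \<ge> 0"
  shows "(LINT t:{0..R}|lborel. k (\<beta> * t + \<theta>)) \<le> (\<beta> * R + 2) / \<beta> * (LINT u:{0..1}|lborel. k u)"
proof -
  define I where "I = (\<integral>\<^sup>+u. ennreal (k u) * indicator {0..1} u \<partial>lborel)"
  define m where "m = nat \<lceil>\<beta> * R\<rceil> + 1"
  have m: "real m \<le> \<beta> * R + 2" "\<beta> * R + 1 \<le> real m" using pos by (auto simp: m_def) linarith+
  have bB: "0 \<le> B" using k[of 0] by linarith
  have int1: "set_integrable lborel {a..b} k" for a b
    by (rule set_integrable_bounded[where B=B]) (use k in auto)
  have I_eq: "I = ennreal (LINT u:{0..1}|lborel. k u)"
    unfolding I_def using int1[of 0 1] k by (intro set_nn_integral_eq_set_integral) auto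
  have shift: "(\<integral>\<^sup>+u. ennreal (k u) * indicator {of_int j..of_int j + 1} u \<partial>lborel) = I" for j :: int
    unfolding I_def
    by (subst nn_integral_real_affine[where c=1 and t="of_int j"])
       (auto intro!: nn_integral_cong simp: per add.commute split: split_indicator)
  have cover: "\<exists>i<m. u \<in> {of_int (\<lfloor>\<theta>\<rfloor> + int i)..of_int (\<lfloor>\<theta>\<rfloor> + int i) + 1}" if "u \<in> {\<theta>..\<theta> + \<beta> * R}" for u
  proof (intro exI conjI)
    have "\<lfloor>\<theta>\<rfloor> \<le> \<lfloor>u\<rfloor>" using that by (intro floor_mono) auto
    then have i: "int (nat (\<lfloor>u\<rfloor> - \<lfloor>\<theta>\<rfloor>)) = \<lfloor>u\<rfloor> - \<lfloor>\<theta>\<rfloor>" by simp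
    have "real_of_int (\<lfloor>u\<rfloor> - \<lfloor>\<theta>\<rfloor>) < real m"
      using that m(2) by (simp, linarith?)
    with i show "nat (\<lfloor>u\<rfloor> - \<lfloor>\<theta>\<rfloor>) < m" by linarith
    show "u \<in> {of_int (\<lfloor>\<theta>\<rfloor> + int (nat (\<lfloor>u\<rfloor> - \<lfloor>\<theta>\<rfloor>)))..of_int (\<lfloor>\<theta>\<rfloor> + int (nat (\<lfloor>u\<rfloor> - \<lfloor>\<theta>\<rfloor>))) + 1}"
      unfolding i by (simp, linarith?)
  qed
  have "(\<integral>\<^sup>+t. ennreal (k (\<beta> * t + \<theta>)) * indicator {0..R} t \<partial>lborel)
      = ennreal (1/\<beta>) * (\<integral>\<^sup>+u. ennreal (k u) * indicator {\<theta>..\<theta> + \<beta> * R} u \<partial>lborel)"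
    using pos
    by (subst (2) nn_integral_real_affine[where c=\<beta> and t=\<theta>])
       (auto simp: mult.assoc[symmetric] ennreal_mult[symmetric] add.commute zero_le_mult_iff
         intro!: nn_integral_cong split: split_indicator)
  moreover have "(\<integral>\<^sup>+u. ennreal (k u) * indicator {\<theta>..\<theta> + \<beta> * R} u \<partial>lborel) \<le> of_nat m * I"
  proof -
    have "(\<integral>\<^sup>+u. ennreal (k u) * indicator {\<theta>..\<theta> + \<beta> * R} u \<partial>lborel)
        \<le> (\<integral>\<^sup>+u. (\<Sum>i<m. ennreal (k u) * indicator {of_int (\<lfloor>\<theta>\<rfloor> + int i)..of_int (\<lfloor>\<theta>\<rfloor> + int i) + 1} u) \<partial>lborel)"
    proof (intro nn_integral_mono)
      fix u
      show "ennreal (k u) * indicator {\<theta>..\<theta> + \<beta> * R} u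
        \<le> (\<Sum>i<m. ennreal (k u) * indicator {of_int (\<lfloor>\<theta>\<rfloor> + int i)..of_int (\<lfloor>\<theta>\<rfloor> + int i) + 1} u)"
      proof (cases "u \<in> {\<theta>..\<theta> + \<beta> * R}")
        case True
        with cover obtain i where i: "i < m" "u \<in> {of_int (\<lfloor>\<theta>\<rfloor> + int i)..of_int (\<lfloor>\<theta>\<rfloor> + int i) + 1}" by blast
        have "ennreal (k u) * indicator {\<theta>..\<theta> + \<beta> * R} u
            = ennreal (k u) * indicator {of_int (\<lfloor>\<theta>\<rfloor> + int i)..of_int (\<lfloor>\<theta>\<rfloor> + int i) + 1} u"
          using i True by simp
        also have "\<dots> \<le> (\<Sum>i<m. ennreal (k u) * indicator {of_int (\<lfloor>\<theta>\<rfloor> + int i)..of_int (\<lfloor>\<theta>\<rfloor> + int i) + 1} u)"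
          using i by (intro member_le_sum) auto
        finally show ?thesis .
      qed simp
    qed
    also have "\<dots> = (\<Sum>i<m. \<integral>\<^sup>+u. ennreal (k u) * indicator {of_int (\<lfloor>\<theta>\<rfloor> + int i)..of_int (\<lfloor>\<theta>\<rfloor> + int i) + 1} u \<partial>lborel)"
      by (rule nn_integral_sum) measurable
    also have "\<dots> = of_nat m * I"
      by (simp only: shift sum_constant card_lessThan)
    finally show ?thesis .
  qed
  ultimately have "(\<integral>\<^sup>+t. ennreal (k (\<beta> * t + \<theta>)) * indicator {0..R} t \<partial>lborel) \<le> ennreal (1/\<beta>) * (of_nat m * I)"
    by (simp add: mult_left_mono)
  also have "\<dots> \<le> ennreal (1/\<beta>) * (ennreal (\<beta> * R + 2) * I)"
    using m by (intro mult_left_mono mult_right_mono) (auto simp: ennreal_of_nat_eq_real_of_nat intro!: ennreal_leI)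
  finally have le: "(\<integral>\<^sup>+t. ennreal (k (\<beta> * t + \<theta>)) * indicator {0..R} t \<partial>lborel) \<le> ennreal (1/\<beta>) * (ennreal (\<beta> * R + 2) * I)" .
  have *: "(\<integral>\<^sup>+t. ennreal (k (\<beta> * t + \<theta>)) * indicator {0..R} t \<partial>lborel) \<le> ennreal ((\<beta> * R + 2) / \<beta> * (LINT u:{0..1}|lborel. k u))"
  proof -
    have "0 \<le> (LINT u:{0..1}|lborel. k u)"
      using k by (auto simp: set_lebesgue_integral_def intro!: integral_nonneg_AE)
    then have "ennreal (1/\<beta>) * (ennreal (\<beta> * R + 2) * I) = ennreal (1/\<beta> * ((\<beta> * R + 2) * (LINT u:{0..1}|lborel. k u)))"
      using pos by (simp add: I_eq ennreal_mult[symmetric] mult.assoc del: ennreal_plus)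
    with le show ?thesis by (simp add: mult.assoc)
  qed
  have int2: "set_integrable lborel {0..R} (\<lambda>t. k (\<beta> * t + \<theta>))"
    by (rule set_integrable_bounded[where B=B]) (use k in auto)
  have "(\<integral>\<^sup>+t. ennreal (k (\<beta> * t + \<theta>)) * indicator {0..R} t \<partial>lborel) = ennreal (LINT t:{0..R}|lborel. k (\<beta> * t + \<theta>))"
    using int2 k by (intro set_nn_integral_eq_set_integral) auto
  with * have "ennreal (LINT t:{0..R}|lborel. k (\<beta> * t + \<theta>)) \<le> ennreal ((\<beta> * R + 2) / \<beta> * (LINT u:{0..1}|lborel. k u))"
    by simp
  moreover have "0 \<le> (\<beta> * R + 2) / \<beta> * (LINT u:{0..1}|lborel. k u)"
    using pos k by (auto simp: set_lebesgue_integral_def intro!: mult_nonneg_nonneg integral_nonneg_AE)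
  ultimately show ?thesis by (simp only: ennreal_le_iff)
qed

text \<open>
  One factor of a product is passed from characters to the indicator of a segment while the other
  factors, collected in \<open>g\<close>, stay fixed. By linearity the means for characters give those for all
  trigonometric polynomials, and since \<open>g\<close> is bounded by 1 an approximation of the one factor in the
  mean is enough.
\<close>

lemma has_time_mean_segment_mult:
  assumes g: "g \<in> borel_measurable borel" "\<And>t. norm (g t) \<le> 1" and L: "norm L \<le> 1"
    and char: "\<And>k::int. has_time_mean (\<lambda>t. cis (2 * pi * of_int k * (\<beta> * t + \<theta>)) * g t) (if k = 0 then L else 0)"
    and c: "0 \<le> c" "c \<le> 1" and "\<beta> > 0"
  shows "has_time_mean (\<lambda>t. of_bool (frac (\<beta> * t + \<theta>) < c) * g t) (of_real c * L)"
proof (rule has_time_mean_approx[where B=1])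
  show "(\<lambda>t. of_bool (frac (\<beta> * t + \<theta>) < c) * g t) \<in> borel_measurable borel"
  proof -
    note borel_measurable_frac[measurable]
    show ?thesis using g(1) unfolding of_bool_def by measurable
  qed
  show "norm (of_bool (frac (\<beta> * t + \<theta>) < c) * g t) \<le> 1" for t
    using g(2)[of t] by (auto simp: norm_mult)
  fix e :: real assume "e > 0"
  obtain h where h: "trig_poly h" "(LINT u:{0..1}|lborel. norm (h u - of_bool (frac u < c))) < e/2"
    using trig_poly_approx_initial_segment[OF c, of "e/2"] \<open>e > 0\<close> by auto
  have mean: "has_time_mean (\<lambda>t. h (\<beta> * t + \<theta>) * g t) ((LINT u:{0..1}|lborel. h u) * L)"
    using h(1)
  proof (induction rule: trig_poly.induct)
    case (char k)
    have "(LINT u:{0..1}|lborel. cis (2 * pi * of_int k * u)) = (if k = 0 then 1 else 0)"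
    proof (cases "k = 0")
      case False
      define F where "F = (\<lambda>t. cis (2 * pi * of_int k * t) / (\<i> * of_real (2 * pi * of_int k)))"
      have D: "(F has_vector_derivative cis (2 * pi * of_int k * t)) (at t within X)" for t X
        unfolding F_def using False has_vector_derivative_cis_linear[of "2 * pi * of_int k" 0] by simp
      have "(LINT u:{0..1}|lborel. cis (2 * pi * of_int k * u)) = F 1 - F 0"
        unfolding set_lebesgue_integral_def
        by (intro integral_FTC_Icc D) (auto intro!: continuous_intros)
      also have "F 1 = F 0"
        using cis_multiple_2pi[of "of_int k"] by (simp add: F_def)
      finally show ?thesis using False by simp
    qed (simp add: set_lebesgue_integral_def)
    with assms(4)[of k] show ?case by (auto split: if_splits)
  next
    case (add f1 f2)
    have "set_integrable lborel {0..1} f1" "set_integrable lborel {0..1} f2"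
      unfolding set_integrable_def
      using add(1,2)[THEN trig_poly_continuous] by (auto intro!: borel_integrable_compact intro: continuous_on_subset)
    then show ?case
      using has_time_mean_add[OF add.IH] by (simp add: set_integral_add distrib_right)
  next
    case (scale f c)
    then show ?case using has_time_mean_cmult[OF scale.IH, of c] by (simp add: mult_ac)
  qed
  define k where "k = (\<lambda>u. norm (h u - of_bool (frac u < c)))"
  note borel_measurable_frac[measurable]
  have [measurable]: "h \<in> borel_measurable borel"
    using trig_poly_continuous[OF h(1)] by (rule borel_measurable_continuous_onI)
  have km[measurable]: "k \<in> borel_measurable borel"
    unfolding k_def of_bool_def using borel_measurable_frac by measurable
  obtain B where B: "\<And>u. norm (h u) \<le> B"
  proof -
    have "compact (h ` {0..1})"
      using trig_poly_continuous[OF h(1)] by (intro compact_continuous_image) (auto intro: continuous_on_subset)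
    then obtain B where B: "\<And>u. u \<in> {0..1} \<Longrightarrow> norm (h u) \<le> B"
      by (meson bounded_iff compact_imp_bounded imageI)
    have "norm (h u) \<le> B" for u
    proof -
      have "h u = h (frac u)"
        using trig_poly_periodic[OF h(1), of "frac u" "\<lfloor>u\<rfloor>"] by (simp add: frac_def)
      then show ?thesis using B[of "frac u"] frac_ge_0[of u] frac_lt_1[of u] by auto
    qed
    then show ?thesis using that by blast
  qed
  have kb: "k u \<le> B + 1" for u
    unfolding k_def using norm_triangle_ineq4[of "h u" "of_bool (frac u < c)"] B[of u]
    by (cases "frac u < c") auto
  have kper: "k (u + of_int j) = k u" for u j
    unfolding k_def using trig_poly_periodic[OF h(1), of u j] by (simp add: frac_def)
  have tm: "norm ((LINT u:{0..1}|lborel. h u) * L - of_real c * L) \<le> e"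
  proof -
    have ih: "set_integrable lborel {0..1} h" by (rule set_integrable_bounded[OF _ B]) simp
    have ii: "set_integrable lborel {0..1} (\<lambda>u. of_bool (frac u < c) :: complex)"
      by (rule set_integrable_bounded[where B=1])
         (use borel_measurable_frac in \<open>auto simp: of_bool_def\<close>)
    have "(LINT u:{0..1}|lborel. of_bool (frac u < c) :: complex) = of_real c"
    proof -
      have "(LINT u:{0..1}|lborel. of_bool (frac u < c) :: complex) = (LINT u|lborel. indicator {0..<c} u *\<^sub>R 1)"
        unfolding set_lebesgue_integral_def
      proof (rule integral_cong_AE)
        show "AE u in lborel. indicat_real {0..1} u *\<^sub>R of_bool (frac u < c) = (indicator {0..<c} u *\<^sub>R 1 :: complex)"
          using AE_lborel_singleton[of 1]
        proof eventually_elim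
          case (elim u)
          show ?case
          proof (cases "0 \<le> u \<and> u < 1")
            case True
            then have "frac u = u" by (simp add: frac_eq)
            with True c show ?thesis by (simp add: indicator_def)
          next
            case False
            with elim have "u \<notin> {0..1}" by auto
            with False c show ?thesis by (auto simp: indicator_def)
          qed
        qed
      qed (auto simp: of_bool_def)
      also have "\<dots> = of_real c" using c by (simp add: scaleR_conv_of_real)
      finally show ?thesis .
    qed
    then have "norm ((LINT u:{0..1}|lborel. h u) - of_real c) = norm (LINT u:{0..1}|lborel. h u - of_bool (frac u < c))"
      using ih ii by (simp add: set_integral_diff)
    also have "\<dots> \<le> (LINT u:{0..1}|lborel. norm (h u - of_bool (frac u < c)))"
      using ih ii by (intro set_integral_norm_bound) auto
    finally have "norm ((LINT u:{0..1}|lborel. h u) - of_real c) \<le> e/2" using h by simp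
    then have "norm (((LINT u:{0..1}|lborel. h u) - of_real c) * L) \<le> e/2 * 1"
      using L \<open>e > 0\<close> unfolding norm_mult by (intro mult_mono) auto
    then show ?thesis using \<open>e > 0\<close> by (simp add: left_diff_distrib)
  qed
  have ev: "\<forall>\<^sub>F R in at_top. (LINT t:{0..R}|lborel. norm (of_bool (frac (\<beta> * t + \<theta>) < c) * g t - h (\<beta> * t + \<theta>) * g t)) \<le> e * R"
  proof -
    define I where "I = (LINT u:{0..1}|lborel. k u)"
    have I: "I < e/2" using h by (simp add: I_def k_def)
    have "((\<lambda>R. (\<beta> * R + 2) / \<beta> * I / R) \<longlongrightarrow> I) at_top"
    proof -
      have "((\<lambda>R. (\<beta> * R + 2) / (\<beta> * R) * I) \<longlongrightarrow> 1 * I) at_top"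
        using \<open>\<beta> > 0\<close> by (intro tendsto_mult tendsto_const) real_asymp
      then show ?thesis by simp
    qed
    then have "\<forall>\<^sub>F R in at_top. (\<beta> * R + 2) / \<beta> * I / R < e"
      using I \<open>e > 0\<close> by (elim order_tendstoD(2)) auto
    with eventually_gt_at_top[of "0::real"] show ?thesis
    proof eventually_elim
      case (elim R)
      have "(LINT t:{0..R}|lborel. norm (of_bool (frac (\<beta> * t + \<theta>) < c) * g t - h (\<beta> * t + \<theta>) * g t))
        \<le> (LINT t:{0..R}|lborel. k (\<beta> * t + \<theta>))"
      proof (rule set_integral_mono)
        show i1: "set_integrable lborel {0..R} (\<lambda>t. k (\<beta> * t + \<theta>))"
          by (rule set_integrable_bounded[where B="B+1"]) (use kb in \<open>auto simp: k_def\<close>)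
        show le: "norm (of_bool (frac (\<beta> * t + \<theta>) < c) * g t - h (\<beta> * t + \<theta>) * g t) \<le> k (\<beta> * t + \<theta>)" for t
        proof -
          have "norm (of_bool (frac (\<beta> * t + \<theta>) < c) * g t - h (\<beta> * t + \<theta>) * g t)
            = k (\<beta> * t + \<theta>) * norm (g t)"
            unfolding k_def norm_mult[symmetric] left_diff_distrib by (rule norm_minus_commute)
          also have "\<dots> \<le> k (\<beta> * t + \<theta>) * 1"
            using g(2) by (intro mult_left_mono) (auto simp: k_def)
          finally show ?thesis by simp
        qed
        show "set_integrable lborel {0..R} (\<lambda>t. norm (of_bool (frac (\<beta> * t + \<theta>) < c) * g t - h (\<beta> * t + \<theta>) * g t))"
          by (rule set_integrable_bounded[where B="B+1"])
             (use g(1) in \<open>simp add: of_bool_def\<close>, use order_trans[OF le kb] in simp)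
      qed
      also have "\<dots> \<le> (\<beta> * R + 2) / \<beta> * I"
        unfolding I_def by (rule periodic_integral_le[where B="B+1"]) (use kb kper \<open>\<beta> > 0\<close> elim in \<open>auto simp: k_def\<close>)
      also have "\<dots> \<le> e * R"
        using elim by (metis less_eq_real_def pos_divide_le_eq)
      finally show ?case .
    qed
  qed
  show "\<exists>h M. has_time_mean h M \<and> norm (M - of_real c * L) \<le> e \<and>
     (\<forall>\<^sub>F R in at_top. (LINT t:{0..R}|lborel. norm (of_bool (frac (\<beta> * t + \<theta>) < c) * g t - h t)) \<le> e * R)"
    using mean tm ev by blast
qed

text \<open>
  Factors indexed by \<open>S\<close> are indicators, the others are characters. For \<open>S = {}\<close> the product is a single
  character, whose frequency vanishes only if all \<open>m i\<close> do, by rational independence. The other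
  cases follow by replacing one factor at a time, which is why \<open>m\<close> has to stay arbitrary.
\<close>

lemma has_time_mean_segments:
  fixes \<beta> \<theta> c :: "'n::finite \<Rightarrow> real"
  assumes pos: "\<And>i. \<beta> i > 0" and c: "\<And>i. 0 \<le> c i" "\<And>i. c i \<le> 1"
    and indep: "\<And>m::'n \<Rightarrow> int. (\<Sum>i\<in>UNIV. of_int (m i) * \<beta> i) = 0 \<Longrightarrow> m = (\<lambda>_. 0)"
  shows "has_time_mean (\<lambda>t. (\<Prod>i\<in>S. of_bool (frac (\<beta> i * t + \<theta> i) < c i)) *
      (\<Prod>i\<in>-S. cis (2 * pi * of_int (m i) * (\<beta> i * t + \<theta> i))))
    ((\<Prod>i\<in>S. of_real (c i)) * of_bool (\<forall>i\<in>-S. m i = 0))"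
proof -
  have "finite S" by simp
  then show ?thesis
  proof (induction S arbitrary: m rule: finite_induct)
    case empty
    have eq: "(\<Prod>i\<in>UNIV. cis (2 * pi * of_int (m i) * (\<beta> i * t + \<theta> i))) =
        cis ((2 * pi * (\<Sum>i\<in>UNIV. of_int (m i) * \<beta> i)) * t + (2 * pi * (\<Sum>i\<in>UNIV. of_int (m i) * \<theta> i)))" for t
    proof -
      have "(\<Prod>i\<in>UNIV. cis (2 * pi * of_int (m i) * (\<beta> i * t + \<theta> i))) = cis (\<Sum>i\<in>UNIV. 2 * pi * of_int (m i) * (\<beta> i * t + \<theta> i))"
        by (induction rule: infinite_finite_induct) (auto simp: cis_mult)
      also have "(\<Sum>i\<in>UNIV. 2 * pi * of_int (m i) * (\<beta> i * t + \<theta> i)) =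
        (2 * pi * (\<Sum>i\<in>UNIV. of_int (m i) * \<beta> i)) * t + (2 * pi * (\<Sum>i\<in>UNIV. of_int (m i) * \<theta> i))"
        by (simp add: sum_distrib_left sum_distrib_right sum.distrib distrib_left mult_ac)
      finally show ?thesis .
    qed
    have lim: "(if 2 * pi * (\<Sum>i\<in>UNIV. of_int (m i) * \<beta> i) = 0 then cis (2 * pi * (\<Sum>i\<in>UNIV. of_int (m i) * \<theta> i)) else 0)
       = of_bool (\<forall>i. m i = 0)"
    proof (cases "\<forall>i. m i = 0")
      case False
      then have "(\<Sum>i\<in>UNIV. of_int (m i) * \<beta> i) \<noteq> 0" using indep[of m] by (metis)
      with False show ?thesis by auto
    qed simp
    show ?case
      using has_time_mean_cis[of "2 * pi * (\<Sum>i\<in>UNIV. of_int (m i) * \<beta> i)" "2 * pi * (\<Sum>i\<in>UNIV. of_int (m i) * \<theta> i)"]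
      unfolding lim by (simp add: eq)
  next
    case (insert j S)
    define g where "g = (\<lambda>t. (\<Prod>i\<in>S. of_bool (frac (\<beta> i * t + \<theta> i) < c i)) *
      (\<Prod>i\<in>-insert j S. cis (2 * pi * of_int (m i) * (\<beta> i * t + \<theta> i))))"
    define L where "L = (\<Prod>i\<in>S. complex_of_real (c i)) * of_bool (\<forall>i\<in>-insert j S. m i = 0)"
    have comp: "- S = insert j (- insert j S)" using insert by auto
    have char: "has_time_mean (\<lambda>t. cis (2 * pi * of_int k * (\<beta> j * t + \<theta> j)) * g t) (if k = 0 then L else 0)" for k
    proof -
      have e1: "(\<Prod>i\<in>S. of_bool (frac (\<beta> i * t + \<theta> i) < c i)) * (\<Prod>i\<in>-S. cis (2 * pi * of_int ((m(j := k)) i) * (\<beta> i * t + \<theta> i)))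
        = cis (2 * pi * of_int k * (\<beta> j * t + \<theta> j)) * g t" for t
      proof -
        have "(\<Prod>i\<in>-S. cis (2 * pi * of_int ((m(j := k)) i) * (\<beta> i * t + \<theta> i))) =
          cis (2 * pi * of_int k * (\<beta> j * t + \<theta> j)) * (\<Prod>i\<in>-insert j S. cis (2 * pi * of_int ((m(j := k)) i) * (\<beta> i * t + \<theta> i)))"
          by (subst comp, subst prod.insert) auto
        also have "(\<Prod>i\<in>-insert j S. cis (2 * pi * of_int ((m(j := k)) i) * (\<beta> i * t + \<theta> i))) =
          (\<Prod>i\<in>-insert j S. cis (2 * pi * of_int (m i) * (\<beta> i * t + \<theta> i)))"
          by (rule prod.cong) auto
        finally show ?thesis by (simp add: g_def mult_ac)
      qed
      have e2: "(\<Prod>i\<in>S. complex_of_real (c i)) * of_bool (\<forall>i\<in>-S. (m(j := k)) i = 0) = (if k = 0 then L else 0)"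
        unfolding L_def by (subst comp) auto
      show ?thesis using insert.IH[of "m(j := k)"] by (simp only: e1 e2)
    qed
    have "has_time_mean (\<lambda>t. of_bool (frac (\<beta> j * t + \<theta> j) < c j) * g t) (of_real (c j) * L)"
    proof (rule has_time_mean_segment_mult[OF _ _ _ char])
      show "g \<in> borel_measurable borel"
        using char[of 0] by (simp add: has_time_mean_def)
      show "norm (g t) \<le> 1" for t
        unfolding g_def norm_mult prod_norm[symmetric]
        by (intro mult_le_one prod_le_1 prod_nonneg) (auto simp: of_bool_def)
      show "norm L \<le> 1"
        unfolding L_def norm_mult prod_norm[symmetric]
        using c by (intro mult_le_one prod_le_1 prod_nonneg) (auto simp: of_bool_def)
    qed (use c pos in auto)
    then show ?case
      using insert unfolding g_def L_def by (simp add: mult_ac)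
  qed
qed

text \<open>
  Weyl's equidistribution theorem in continuous time, for the boxes \<open>\<Prod>\<^sub>i [0, c\<^sub>i)\<close> in the torus.
\<close>

theorem equidistribution_linear_flow:
  fixes \<beta> \<theta> c :: "'n::finite \<Rightarrow> real"
  assumes pos: "\<And>i. \<beta> i > 0" and c: "\<And>i. 0 \<le> c i" "\<And>i. c i \<le> 1"
    and indep: "\<And>m::'n \<Rightarrow> int. (\<Sum>i\<in>UNIV. of_int (m i) * \<beta> i) = 0 \<Longrightarrow> m = (\<lambda>_. 0)"
  shows "((\<lambda>R. measure lborel {t\<in>{0..R}. \<forall>i. frac (\<beta> i * t + \<theta> i) < c i} / R) \<longlongrightarrow> (\<Prod>i\<in>UNIV. c i)) at_top"
proof -
  have "has_time_mean (\<lambda>t. (\<Prod>i\<in>UNIV. of_bool (frac (\<beta> i * t + \<theta> i) < c i))) (\<Prod>i\<in>UNIV. of_real (c i))"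
    using has_time_mean_segments[of \<beta> c \<theta> UNIV "\<lambda>_. 0", OF pos c indep] by simp
  then have "((\<lambda>R. (LINT t:{0..R}|lborel. (\<Prod>i\<in>UNIV. of_bool (frac (\<beta> i * t + \<theta> i) < c i) :: complex)) / of_real R)
      \<longlongrightarrow> of_real (\<Prod>i\<in>UNIV. c i)) at_top"
    by (simp add: has_time_mean_def)
  then have lim: "((\<lambda>R. Re ((LINT t:{0..R}|lborel. (\<Prod>i\<in>UNIV. of_bool (frac (\<beta> i * t + \<theta> i) < c i) :: complex)) / of_real R))
      \<longlongrightarrow> (\<Prod>i\<in>UNIV. c i)) at_top"
    by (auto dest!: tendsto_Re simp only: Re_complex_of_real)
  have "Re ((LINT t:{0..R}|lborel. (\<Prod>i\<in>UNIV. of_bool (frac (\<beta> i * t + \<theta> i) < c i) :: complex)) / of_real R)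
      = measure lborel {t\<in>{0..R}. \<forall>i. frac (\<beta> i * t + \<theta> i) < c i} / R" for R
  proof -
    have "(\<Prod>i\<in>UNIV. of_bool (frac (\<beta> i * t + \<theta> i) < c i) :: complex) = of_bool (\<forall>i. frac (\<beta> i * t + \<theta> i) < c i)" for t
      by auto
    then have "(LINT t:{0..R}|lborel. (\<Prod>i\<in>UNIV. of_bool (frac (\<beta> i * t + \<theta> i) < c i) :: complex))
      = (LINT t|lborel. of_real (indicator {t\<in>{0..R}. \<forall>i. frac (\<beta> i * t + \<theta> i) < c i} t))"
      unfolding set_lebesgue_integral_def
      by (intro Bochner_Integration.integral_cong) (auto simp: indicator_def)
    also have "\<dots> = of_real (measure lborel {t\<in>{0..R}. \<forall>i. frac (\<beta> i * t + \<theta> i) < c i})"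
      by (subst integral_complex_of_real) (use borel_measurable_frac in simp)
    finally show ?thesis by simp
  qed
  with lim show ?thesis by (simp only:)
qed

section \<open>Superposition of periodic clocks\<close>

text \<open>
  Clock \<open>i\<close> rings periodically with period \<open>\<tau> i\<close>. After \<open>k\<close> rings, simultaneous ones counted once,
  \<open>d k i\<close> is the time until clock \<open>i\<close> rings again and \<open>e k\<close> the time until any clock does. Initially a
  clock may be due at once; after a ring it is due a full period later. In a box the clocks are the pairs
  of opposite walls.
\<close>

locale periodic_clocks =
  fixes \<tau> :: "'n::finite \<Rightarrow> real" and d :: "nat \<Rightarrow> 'n \<Rightarrow> real" and e :: "nat \<Rightarrow> real"
  assumes period_pos: "\<And>i. 0 < \<tau> i"
    and d0: "\<And>i. 0 \<le> d 0 i" "\<And>i. d 0 i \<le> \<tau> i"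
    and e_le: "\<And>k i. e k \<le> d k i"
    and e_attained: "\<And>k. \<exists>i. d k i = e k"
    and d_Suc: "\<And>k i. d (Suc k) i = (if d k i = e k then \<tau> i else d k i - e k)"
begin

definition ring_time :: "nat \<Rightarrow> real" where
  "ring_time k = (\<Sum>j\<le>k. e j)"

text \<open>
  The fraction of the current period of clock \<open>i\<close> that has elapsed at time \<open>t\<close>.
\<close>

definition phase :: "'n \<Rightarrow> real \<Rightarrow> real" where
  "phase i t = frac (t / \<tau> i + (1 - d 0 i / \<tau> i))"

lemma d_nonneg_le: "0 \<le> d k i \<and> d k i \<le> \<tau> i"
proof (induction k arbitrary: i)
  case (Suc k)
  have "0 \<le> e k" using e_attained[of k] Suc by metis
  with Suc[of i] e_le[of k i] period_pos[of i] show ?case by (auto simp: d_Suc)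
qed (simp add: d0)

lemma e_nonneg: "0 \<le> e k"
  using e_attained[of k] d_nonneg_le by metis

lemma e_Suc_pos: "0 < e (Suc k)"
proof -
  obtain i where i: "d (Suc k) i = e (Suc k)" using e_attained by blast
  have "0 < d (Suc k) i" using e_le[of k i] period_pos[of i] by (auto simp: d_Suc)
  with i show ?thesis by simp
qed

lemma ring_time_Suc: "ring_time (Suc k) = ring_time k + e (Suc k)"
  by (simp add: ring_time_def)

lemma strict_mono_ring_time: "strict_mono ring_time"
  by (rule strict_monoI_Suc) (use e_Suc_pos in \<open>simp add: ring_time_Suc\<close>)

lemma ring_time_nonneg: "0 \<le> ring_time k"
  by (simp add: ring_time_def sum_nonneg e_nonneg)

text \<open>
  Here \<open>m i\<close> numbers the next ring of clock \<open>i\<close>, so that the times of its rings form one arithmetic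
  progression. The numbers start at 1, and each ring of the system advances at least one of them. This
  gives the lower bound on their sum, and hence a bound on the number of rings before a given time.
\<close>

lemma ring_numbers:
  "\<exists>m::'n \<Rightarrow> int. (\<forall>i. d (Suc k) i = \<tau> i * of_int (m i) - (\<tau> i - d 0 i) - ring_time k)
     \<and> int k + 1 + int CARD('n) \<le> (\<Sum>i\<in>UNIV. m i)"
proof (induction k)
  case 0
  obtain j where j: "d 0 j = e 0" using e_attained by blast
  define m :: "'n \<Rightarrow> int" where "m = (\<lambda>i. 1 + of_bool (d 0 i = e 0))"
  have "(\<Sum>i\<in>UNIV. m i) \<ge> (\<Sum>i\<in>UNIV. 1 + of_bool (i = j))"
    using j by (intro sum_mono) (auto simp: m_def)
  then have "(\<Sum>i\<in>UNIV. m i) \<ge> 1 + int CARD('n)"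
    by (simp add: sum.distrib)
  then show ?case
    by (intro exI[of _ m]) (auto simp: m_def d_Suc ring_time_def)
next
  case (Suc k)
  then obtain m :: "'n \<Rightarrow> int" where m: "\<And>i. d (Suc k) i = \<tau> i * of_int (m i) - (\<tau> i - d 0 i) - ring_time k"
    and ms: "int k + 1 + int CARD('n) \<le> (\<Sum>i\<in>UNIV. m i)" by blast
  obtain j where j: "d (Suc k) j = e (Suc k)" using e_attained by blast
  define m' where "m' = (\<lambda>i. m i + of_bool (d (Suc k) i = e (Suc k)))"
  have "(\<Sum>i\<in>UNIV. m' i) \<ge> (\<Sum>i\<in>UNIV. m i + of_bool (i = j))"
    using j by (intro sum_mono) (auto simp: m'_def)
  then have "(\<Sum>i\<in>UNIV. m' i) \<ge> int (Suc k) + 1 + int CARD('n)"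
    using ms by (simp add: sum.distrib)
  moreover have "d (Suc (Suc k)) i = \<tau> i * of_int (m' i) - (\<tau> i - d 0 i) - ring_time (Suc k)" for i
    using m[of i] by (subst d_Suc) (auto simp: m'_def ring_time_Suc distrib_left)
  ultimately show ?case by blast
qed

lemma ring_count_le: "real k + 1 \<le> ring_time k * (\<Sum>i\<in>UNIV. 1 / \<tau> i) + CARD('n)"
proof -
  obtain m :: "'n \<Rightarrow> int" where m: "\<And>i. d (Suc k) i = \<tau> i * of_int (m i) - (\<tau> i - d 0 i) - ring_time k"
    and ms: "int k + 1 + int CARD('n) \<le> (\<Sum>i\<in>UNIV. m i)" using ring_numbers by blast
  have "real_of_int (m i) \<le> ring_time k * (1 / \<tau> i) + 2" for i
  proof -
    have "\<tau> i * of_int (m i) \<le> 2 * \<tau> i + ring_time k"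
      using m[of i] d_nonneg_le[of "Suc k" i] d0[of i] by linarith
    then show ?thesis using period_pos[of i] by (simp add: field_simps)
  qed
  then have "(\<Sum>i\<in>UNIV. real_of_int (m i)) \<le> (\<Sum>i\<in>UNIV. ring_time k * (1 / \<tau> i) + 2)"
    by (intro sum_mono) auto
  also have "\<dots> = ring_time k * (\<Sum>i\<in>UNIV. 1 / \<tau> i) + 2 * CARD('n)"
    by (simp add: sum.distrib sum_distrib_left)
  finally have "(\<Sum>i\<in>UNIV. real_of_int (m i)) \<le> ring_time k * (\<Sum>i\<in>UNIV. 1 / \<tau> i) + 2 * CARD('n)" .
  moreover have "real_of_int (int k + 1 + int CARD('n)) \<le> real_of_int (\<Sum>i\<in>UNIV. m i)"
    using ms by (intro of_int_le_iff[THEN iffD2])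
  ultimately show ?thesis by simp
qed

lemma phase_eq:
  assumes "ring_time k \<le> t" "t < ring_time (Suc k)"
  shows "phase i t = 1 - (d (Suc k) i - (t - ring_time k)) / \<tau> i"
proof -
  obtain m :: "'n \<Rightarrow> int" where m: "\<And>i. d (Suc k) i = \<tau> i * of_int (m i) - (\<tau> i - d 0 i) - ring_time k"
    using ring_numbers by blast
  have pos: "0 < \<tau> i" by (rule period_pos)
  have eq: "t / \<tau> i + (1 - d 0 i / \<tau> i) - (1 - (d (Suc k) i - (t - ring_time k)) / \<tau> i) = of_int (m i - 1)"
  proof -
    have "t / \<tau> i + (1 - d 0 i / \<tau> i) - (1 - (d (Suc k) i - (t - ring_time k)) / \<tau> i)
        = (d (Suc k) i + ring_time k - d 0 i) / \<tau> i"
      by (simp add: diff_divide_distrib add_divide_distrib)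
    also have "d (Suc k) i + ring_time k - d 0 i = \<tau> i * of_int (m i - 1)"
      using m[of i] by (simp add: right_diff_distrib)
    finally show ?thesis using pos by simp
  qed
  have "0 < d (Suc k) i - (t - ring_time k)"
    using assms e_le[of "Suc k" i] by (simp add: ring_time_Suc)
  moreover have "d (Suc k) i - (t - ring_time k) \<le> \<tau> i"
    using assms d_nonneg_le[of "Suc k" i] by simp
  ultimately show ?thesis
    using pos unfolding phase_def frac_unique_iff eq by (auto simp: field_simps)
qed

text \<open>
  A phase below \<open>1 - x / \<tau> i\<close> says that clock \<open>i\<close> stays silent for longer than \<open>x\<close>. All clocks do so at
  time \<open>t\<close> exactly if the ring of the system that follows \<open>t\<close> is more than \<open>x\<close> away.
\<close>

lemma phases_below_iff:
  assumes "ring_time k \<le> t" "t < ring_time (Suc k)"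
  shows "(\<forall>i. phase i t < 1 - x / \<tau> i) \<longleftrightarrow> t < ring_time (Suc k) - x"
proof -
  have "phase i t < 1 - x / \<tau> i \<longleftrightarrow> x < d (Suc k) i - (t - ring_time k)" for i
    using period_pos[of i] by (simp add: phase_eq[OF assms] divide_less_cancel)
  then have "(\<forall>i. phase i t < 1 - x / \<tau> i) \<longleftrightarrow> (\<forall>i. x + (t - ring_time k) < d (Suc k) i)"
    by (auto simp: algebra_simps)
  also have "\<dots> \<longleftrightarrow> x + (t - ring_time k) < e (Suc k)"
    using e_le[of "Suc k"] e_attained[of "Suc k"] by (metis less_le_trans)
  finally show ?thesis by (auto simp: ring_time_Suc)
qed

lemma ring_set_eq: "{k. ring_time (Suc k) \<le> R} = {..<card {k. ring_time (Suc k) \<le> R}}"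
  and finite_ring_set: "finite {k. ring_time (Suc k) \<le> R}"
  and card_ring_set_le: "0 \<le> R \<Longrightarrow> real (card {k. ring_time (Suc k) \<le> R}) \<le> R * (\<Sum>i\<in>UNIV. 1 / \<tau> i) + CARD('n)"
proof -
  let ?A = "{k. ring_time (Suc k) \<le> R}"
  define f where "f = (\<Sum>i\<in>UNIV. 1 / \<tau> i)"
  have f: "0 \<le> f" using period_pos by (auto simp: f_def less_imp_le intro!: sum_nonneg)
  have bound: "real k + 1 \<le> R * f + CARD('n)" if "k \<in> ?A" for k
  proof -
    have "ring_time (Suc k) * f \<le> R * f" using that f by (intro mult_right_mono) auto
    with ring_count_le[of "Suc k"] show ?thesis by (simp add: f_def)
  qed
  have "?A \<subseteq> {..nat \<lceil>R * f + CARD('n)\<rceil>}"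
  proof
    fix k assume "k \<in> ?A"
    from bound[OF this] show "k \<in> {..nat \<lceil>R * f + CARD('n)\<rceil>}" by simp linarith
  qed
  then show fin: "finite ?A" by (rule finite_subset) auto
  have down: "j \<in> ?A" if "k \<in> ?A" "j \<le> k" for j k
    using that strict_mono_ring_time by (auto simp: strict_mono_less_eq intro: order_trans[of _ "ring_time (Suc k)"])
  show eq: "?A = {..<card ?A}"
  proof (cases "?A = {}")
    case False
    define K where "K = Max ?A"
    have "?A = {..K}"
      using Max_in[OF fin False] Max_ge[OF fin] down unfolding K_def by blast
    then show ?thesis by (metis card_atMost lessThan_Suc_atMost)
  qed simp
  assume "0 \<le> R"
  show "real (card ?A) \<le> R * f + CARD('n)"
  proof (cases "card ?A")
    case 0
    then show ?thesis using f \<open>0 \<le> R\<close> by simp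
  next
    case (Suc k)
    then have "k \<in> ?A" using eq by (metis lessI lessThan_iff)
    from bound[OF this] Suc show ?thesis by simp
  qed
qed

lemma phase_measurable[measurable]: "phase i \<in> borel_measurable borel"
  unfolding phase_def using borel_measurable_frac by measurable

text \<open>
  Within one gap \<open>g\<close> between rings, the times followed by more than \<open>x\<close> units of silence form an initial
  piece of length \<open>max 0 (g - x)\<close>.
\<close>

lemma measure_free_time_eq:
  assumes "0 \<le> x"
  shows "measure lborel ({t. \<forall>i. phase i t < 1 - x / \<tau> i} \<inter> {ring_time 0..<ring_time N})
    = (\<Sum>k<N. max 0 (e (Suc k) - x))"
proof (induction N)
  case (Suc N)
  let ?A = "{t. \<forall>i. phase i t < 1 - x / \<tau> i}"
  have le: "ring_time N \<le> ring_time (Suc N)" "ring_time 0 \<le> ring_time N"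
    using strict_mono_ring_time by (auto simp: strict_mono_less_eq)
  have piece: "?A \<inter> {ring_time N..<ring_time (Suc N)} = {ring_time N..<ring_time (Suc N) - x}"
  proof (intro set_eqI)
    fix t
    show "t \<in> ?A \<inter> {ring_time N..<ring_time (Suc N)} \<longleftrightarrow> t \<in> {ring_time N..<ring_time (Suc N) - x}"
      using phases_below_iff[of N t x] assms
      by (cases "ring_time N \<le> t \<and> t < ring_time (Suc N)") auto
  qed
  have "?A \<inter> {ring_time 0..<ring_time (Suc N)}
      = (?A \<inter> {ring_time 0..<ring_time N}) \<union> {ring_time N..<ring_time (Suc N) - x}"
    using le by (subst piece[symmetric]) auto
  moreover have "measure lborel \<dots> = measure lborel (?A \<inter> {ring_time 0..<ring_time N})
      + measure lborel {ring_time N..<ring_time (Suc N) - x}"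
  proof (rule measure_Union)
    show "emeasure lborel (?A \<inter> {ring_time 0..<ring_time N}) \<noteq> \<infinity>"
    proof -
      have "emeasure lborel (?A \<inter> {ring_time 0..<ring_time N}) \<le> emeasure lborel {ring_time 0..<ring_time N}"
        by (intro emeasure_mono) auto
      also have "\<dots> < \<infinity>" using le by simp
      finally show ?thesis by simp
    qed
    show "emeasure lborel {ring_time N..<ring_time (Suc N) - x} \<noteq> \<infinity>"
      by (cases "ring_time N \<le> ring_time (Suc N) - x") auto
    show "?A \<inter> {ring_time 0..<ring_time N} \<in> sets lborel"
      by measurable
  qed auto
  moreover have "measure lborel {ring_time N..<ring_time (Suc N) - x} = max 0 (e (Suc N) - x)"
    by (cases "ring_time N \<le> ring_time (Suc N) - x") (auto simp: ring_time_Suc max_def)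
  ultimately show ?case using Suc by simp
qed simp

lemma measure_free_time_approx:
  assumes "0 \<le> x" "0 \<le> R" and C: "\<And>i. \<tau> i \<le> C"
  defines "S \<equiv> (\<Sum>k | ring_time (Suc k) \<le> R. max 0 (e (Suc k) - x))"
  shows "S \<le> measure lborel {t\<in>{0..R}. \<forall>i. phase i t < 1 - x / \<tau> i}"
    and "measure lborel {t\<in>{0..R}. \<forall>i. phase i t < 1 - x / \<tau> i} \<le> S + 2 * C"
proof -
  let ?A = "{t. \<forall>i. phase i t < 1 - x / \<tau> i}"
  define N where "N = card {k. ring_time (Suc k) \<le> R}"
  have N: "{k. ring_time (Suc k) \<le> R} = {..<N}" unfolding N_def by (rule ring_set_eq)
  have eC: "e k \<le> C" for k
    using e_attained[of k] d_nonneg_le[of k] C by (metis order_trans)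
  have S: "S = measure lborel (?A \<inter> {ring_time 0..<ring_time N})"
    unfolding S_def N by (rule measure_free_time_eq[OF \<open>0 \<le> x\<close>, symmetric])
  have A: "?A \<in> sets lborel" by measurable
  have fm: "?A \<inter> {a..b} \<in> fmeasurable lborel" "?A \<inter> {a..<b} \<in> fmeasurable lborel" for a b
    by (rule fmeasurable_Int_fmeasurable[OF _ A, unfolded Int_commute[of _ ?A]];
        cases "a \<le> b"; simp add: fmeasurable_def)+
  have Icc: "{a..b} \<in> fmeasurable lborel" for a b :: real
    by (cases "a \<le> b") (auto simp: fmeasurable_def)
  have eq: "{t\<in>{0..R}. \<forall>i. phase i t < 1 - x / \<tau> i} = ?A \<inter> {0..R}" by auto
  have "?A \<inter> {ring_time 0..<ring_time N} \<subseteq> ?A \<inter> {0..R}"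
  proof (cases N)
    case (Suc k)
    then have "ring_time N \<le> R" using N by (metis lessI lessThan_iff mem_Collect_eq)
    then show ?thesis using ring_time_nonneg[of 0] by auto
  qed simp
  then show "S \<le> measure lborel {t\<in>{0..R}. \<forall>i. phase i t < 1 - x / \<tau> i}"
    unfolding S eq by (rule measure_mono_fmeasurable) (use fm in auto)
  \<comment> \<open>At most two gaps are not accounted for: the time before ring 0, and the gap interrupted at R.\<close>
  have "R < ring_time (Suc N)" using N by (metis lessThan_iff less_irrefl mem_Collect_eq not_le)
  then have "?A \<inter> {0..R} \<subseteq> ({0..ring_time 0} \<union> (?A \<inter> {ring_time 0..<ring_time N})) \<union> {ring_time N..ring_time (Suc N)}"
    by auto
  then have "measure lborel (?A \<inter> {0..R}) \<le> measure lborel (({0..ring_time 0} \<union> (?A \<inter> {ring_time 0..<ring_time N})) \<union> {ring_time N..ring_time (Suc N)})"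
    by (rule measure_mono_fmeasurable) (use fm Icc in \<open>auto intro!: fmeasurable.Un\<close>)
  also have "\<dots> \<le> measure lborel ({0..ring_time 0} \<union> (?A \<inter> {ring_time 0..<ring_time N})) + measure lborel {ring_time N..ring_time (Suc N)}"
    by (rule measure_Un_le) (use fm in auto)
  also have "\<dots> \<le> measure lborel {0..ring_time 0} + S + measure lborel {ring_time N..ring_time (Suc N)}"
    unfolding S by (intro add_right_mono measure_Un_le) (use fm in auto)
  also have "\<dots> \<le> S + 2 * C"
    using eC[of 0] eC[of "Suc N"] e_nonneg[of 0] e_nonneg[of "Suc N"] by (simp add: ring_time_Suc) (simp add: ring_time_def)
  finally show "measure lborel {t\<in>{0..R}. \<forall>i. phase i t < 1 - x / \<tau> i} \<le> S + 2 * C"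
    unfolding eq .
qed

end

section \<open>Unfolding the billiard in a box\<close>

text \<open>
  The box is closed and convex, so the times spent in it from the start on form a compact interval.
\<close>

lemma exit_time_ge_iff:
  fixes a :: "real^'n"
  assumes x: "x \<in> cbox 0 a" and v: "v \<noteq> 0" and c: "0 \<le> c"
  shows "c \<le> exit_time a (x, v) \<longleftrightarrow> x + c *\<^sub>R v \<in> cbox 0 a"
proof -
  define T where "T = {t. 0 \<le> t \<and> x + t *\<^sub>R v \<in> cbox 0 a}"
  have T_eq: "T = {0..} \<inter> (\<lambda>t. x + t *\<^sub>R v) -` cbox 0 a"
    by (auto simp: T_def)
  have "closed T" unfolding T_eq
    by (intro closed_Int closed_atLeast continuous_closed_vimage closed_cbox continuous_intros)
  obtain b where b: "\<And>y. y \<in> cbox 0 a \<Longrightarrow> norm y \<le> b"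
    using bounded_cbox[of 0 a] by (auto simp: bounded_iff)
  have "t \<le> 2 * b / norm v" if "t \<in> T" for t
  proof -
    have "norm (t *\<^sub>R v) = norm ((x + t *\<^sub>R v) - x)" by simp
    also have "\<dots> \<le> b + b"
      using b[OF x] b[of "x + t *\<^sub>R v"] that by (intro order_trans[OF norm_triangle_ineq4]) (auto simp: T_def)
    finally show ?thesis using v that by (simp add: T_def field_simps)
  qed
  then have bdd: "bdd_above T" by (auto simp: bdd_above_def)
  have "0 \<in> T" using x by (simp add: T_def)
  then have "Sup T \<in> T" using \<open>closed T\<close> bdd by (intro closed_contains_Sup) auto
  have E: "exit_time a (x, v) = Sup T" by (simp add: exit_time_def T_def)
  show ?thesis
  proof
    assume "c \<le> exit_time a (x, v)"
    then have c': "c \<le> Sup T" by (simp add: E)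
    show "x + c *\<^sub>R v \<in> cbox 0 a"
    proof (cases "c = 0")
      case False
      with c c' have pos: "0 < Sup T" by linarith
      have "x + c *\<^sub>R v = (1 - c / Sup T) *\<^sub>R x + (c / Sup T) *\<^sub>R (x + Sup T *\<^sub>R v)"
        using pos by (simp add: algebra_simps)
      moreover have "\<dots> \<in> cbox 0 a"
        using \<open>Sup T \<in> T\<close> pos c c' x convex_box(1)[of 0 a]
        by (intro convexD) (auto simp: T_def)
      ultimately show ?thesis by simp
    qed (use x in simp)
  next
    assume "x + c *\<^sub>R v \<in> cbox 0 a"
    with c have "c \<in> T" by (simp add: T_def)
    then show "c \<le> exit_time a (x, v)" unfolding E using bdd by (rule cSup_upper)
  qed
qed

lemma exit_time_nonneg: "x \<in> cbox 0 a \<Longrightarrow> v \<noteq> 0 \<Longrightarrow> 0 \<le> exit_time a (x, v)"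
  using exit_time_ge_iff[of x a v 0] by simp

lemma exit_point_in_box: "x \<in> cbox 0 a \<Longrightarrow> v \<noteq> 0 \<Longrightarrow> x + exit_time a (x, v) *\<^sub>R v \<in> cbox 0 a"
  using exit_time_ge_iff[of x a v "exit_time a (x, v)"] exit_time_nonneg[of x a v] by simp

text \<open>
  The time until a particle, if nothing stops it, reaches the wall ahead of it in coordinate \<open>i\<close>.
\<close>

definition wall_time :: "real^'n \<Rightarrow> (real^'n) \<times> (real^'n) \<Rightarrow> 'n \<Rightarrow> real" where
  "wall_time a = (\<lambda>(x, v) i. (if 0 < v $ i then a $ i - x $ i else x $ i) / \<bar>v $ i\<bar>)"

lemma exit_time_ge_iff_wall_time:
  fixes a :: "real^'n"
  assumes x: "x \<in> cbox 0 a" and v: "\<And>i. v $ i \<noteq> 0" and c: "0 \<le> c"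
  shows "c \<le> exit_time a (x, v) \<longleftrightarrow> (\<forall>i. c \<le> wall_time a (x, v) i)"
proof -
  have "v \<noteq> 0" using v by (metis zero_index)
  have *: "0 \<le> x $ i + c * v $ i \<and> x $ i + c * v $ i \<le> a $ i \<longleftrightarrow> c \<le> wall_time a (x, v) i" for i
  proof -
    have xi: "0 \<le> x $ i" "x $ i \<le> a $ i" using x by (auto simp: mem_box_cart)
    show ?thesis
    proof (cases "0 < v $ i")
      case True
      then have "0 \<le> c * v $ i" using c by simp
      with True xi show ?thesis by (auto simp: wall_time_def field_simps)
    next
      case False
      then have "v $ i < 0" using v[of i] by linarith
      moreover from this have "c * v $ i \<le> 0" using c by (simp add: mult_nonneg_nonpos)
      ultimately show ?thesis using xi by (auto simp: wall_time_def field_simps)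
    qed
  qed
  show ?thesis
    unfolding exit_time_ge_iff[OF x \<open>v \<noteq> 0\<close> c] mem_box_cart using * by simp
qed

lemma wall_time_nonneg: "x \<in> cbox 0 a \<Longrightarrow> 0 \<le> wall_time a (x, v) i"
  by (auto simp: wall_time_def mem_box_cart)

lemma wall_time_le: "x \<in> cbox 0 a \<Longrightarrow> wall_time a (x, v) i \<le> a $ i / \<bar>v $ i\<bar>"
  unfolding wall_time_def prod.case by (intro divide_right_mono) (auto simp: mem_box_cart)

lemma exit_time_least_wall_time:
  fixes a :: "real^'n"
  assumes x: "x \<in> cbox 0 a" and v: "\<And>i. v $ i \<noteq> 0"
  shows "exit_time a (x, v) \<le> wall_time a (x, v) i"
    and "\<exists>i. wall_time a (x, v) i = exit_time a (x, v)"
proof -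
  have "v \<noteq> 0" using v by (metis zero_index)
  note iff = exit_time_ge_iff_wall_time[OF x v]
  show le: "exit_time a (x, v) \<le> wall_time a (x, v) i" for i
    using iff[of "exit_time a (x, v)"] exit_time_nonneg[OF x \<open>v \<noteq> 0\<close>] by simp
  define m where "m = Min (range (wall_time a (x, v)))"
  have "m \<in> range (wall_time a (x, v))" unfolding m_def by (intro Min_in) auto
  then obtain j where j: "wall_time a (x, v) j = m" by auto
  have "m \<le> wall_time a (x, v) i" for i by (simp add: m_def)
  then have "m \<le> exit_time a (x, v)" using iff[of m] wall_time_nonneg[OF x, of v j] j by simp
  with le[of j] j show "\<exists>i. wall_time a (x, v) i = exit_time a (x, v)" by (intro exI[of _ j]) simp
qed

lemma bounce_stays:
  fixes a :: "real^'n"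
  assumes "x \<in> cbox 0 a" "v \<noteq> 0"
  shows "fst (bounce a (x, v)) \<in> cbox 0 a" "\<bar>snd (bounce a (x, v)) $ i\<bar> = \<bar>v $ i\<bar>"
  using exit_point_in_box[OF assms] by (auto simp: bounce_def reflect_def Let_def)

text \<open>
  A wall that is hit in the bounce is replaced by the opposite one, a full crossing of the box away; for
  the other coordinates only time passes. At an edge or corner several walls are replaced at once.
\<close>

lemma wall_time_bounce:
  fixes a :: "real^'n"
  assumes x: "x \<in> cbox 0 a" and v: "\<And>i. v $ i \<noteq> 0"
  shows "wall_time a (bounce a (x, v)) i =
    (if wall_time a (x, v) i = exit_time a (x, v) then a $ i / \<bar>v $ i\<bar>
     else wall_time a (x, v) i - exit_time a (x, v))"
proof -
  define e where "e = exit_time a (x, v)"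
  define y where "y = x + e *\<^sub>R v"
  have yi: "y $ i = x $ i + e * v $ i" by (simp add: y_def)
  have le: "e \<le> wall_time a (x, v) i" unfolding e_def by (rule exit_time_least_wall_time[OF x v])
  have b: "bounce a (x, v) = (y, reflect a y v)" by (simp add: bounce_def Let_def y_def e_def)
  show ?thesis unfolding e_def[symmetric] b
  proof (cases "0 < v $ i")
    case True
    then have "wall_time a (x, v) i = e \<longleftrightarrow> y $ i = a $ i"
      unfolding yi by (auto simp: wall_time_def field_simps)
    with True show "wall_time a (y, reflect a y v) i =
      (if wall_time a (x, v) i = e then a $ i / \<bar>v $ i\<bar> else wall_time a (x, v) i - e)"
      by (auto simp: wall_time_def reflect_def yi field_simps)
  next
    case False
    then have neg: "v $ i < 0" using v[of i] by linarith
    then have "wall_time a (x, v) i = e \<longleftrightarrow> y $ i = 0"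
      unfolding yi by (auto simp: wall_time_def field_simps)
    with neg show "wall_time a (y, reflect a y v) i =
      (if wall_time a (x, v) i = e then a $ i / \<bar>v $ i\<bar> else wall_time a (x, v) i - e)"
      by (auto simp: wall_time_def reflect_def yi field_simps)
  qed
qed

lemma funpow_bounce_stays:
  fixes a :: "real^'n"
  assumes "x \<in> cbox 0 a" "v \<noteq> 0"
  shows "fst ((bounce a ^^ k) (x, v)) \<in> cbox 0 a \<and> (\<forall>i. \<bar>snd ((bounce a ^^ k) (x, v)) $ i\<bar> = \<bar>v $ i\<bar>)"
proof (induction k)
  case (Suc k)
  obtain y w where yw: "(bounce a ^^ k) (x, v) = (y, w)" by (cases "(bounce a ^^ k) (x, v)")
  from Suc yw have y: "y \<in> cbox 0 a" and w: "\<And>i. \<bar>w $ i\<bar> = \<bar>v $ i\<bar>" by auto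
  have "w \<noteq> 0" using w assms(2) by (metis abs_zero abs_eq_0 vec_eq_iff zero_index)
  from bounce_stays[OF y this] w yw show ?case by simp
qed (use assms in simp)

lemma flight_nonneg:
  fixes a :: "real^'n"
  assumes "x \<in> cbox 0 a" "v \<noteq> 0"
  shows "0 \<le> flight a (x, v) k"
proof -
  obtain y w where yw: "(bounce a ^^ k) (x, v) = (y, w)" by (cases "(bounce a ^^ k) (x, v)")
  from funpow_bounce_stays[OF assms, of k] yw have y: "y \<in> cbox 0 a" and w: "\<And>i. \<bar>w $ i\<bar> = \<bar>v $ i\<bar>" by auto
  have "w \<noteq> 0" using w assms(2) by (metis abs_zero abs_eq_0 vec_eq_iff zero_index)
  with y yw show ?thesis by (simp add: flight_def exit_time_nonneg)
qed

lemma periodic_clocks_billiard: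
  fixes a :: "real^'n"
  assumes a: "\<And>i. 0 < a $ i" and x: "x \<in> cbox 0 a" and v: "\<And>i. v $ i \<noteq> 0"
  shows "periodic_clocks (\<lambda>i. a $ i / \<bar>v $ i\<bar>) (\<lambda>k. wall_time a ((bounce a ^^ k) (x, v))) (flight a (x, v))"
proof
  have "v \<noteq> 0" using v by (metis zero_index)
  fix k i
  obtain y w where yw: "(bounce a ^^ k) (x, v) = (y, w)" by (cases "(bounce a ^^ k) (x, v)")
  from funpow_bounce_stays[OF x \<open>v \<noteq> 0\<close>, of k] yw have y: "y \<in> cbox 0 a" and w: "\<And>i. \<bar>w $ i\<bar> = \<bar>v $ i\<bar>" by auto
  from w v have w0: "\<And>i. w $ i \<noteq> 0" by (metis abs_eq_0)
  show "flight a (x, v) k \<le> wall_time a ((bounce a ^^ k) (x, v)) i"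
    using exit_time_least_wall_time(1)[OF y w0] by (simp add: flight_def yw)
  show "\<exists>i. wall_time a ((bounce a ^^ k) (x, v)) i = flight a (x, v) k"
    using exit_time_least_wall_time(2)[OF y w0] by (simp add: flight_def yw)
  show "wall_time a ((bounce a ^^ Suc k) (x, v)) i =
      (if wall_time a ((bounce a ^^ k) (x, v)) i = flight a (x, v) k then a $ i / \<bar>v $ i\<bar>
       else wall_time a ((bounce a ^^ k) (x, v)) i - flight a (x, v) k)"
    using wall_time_bounce[OF y w0] by (simp add: flight_def yw w)
next
  fix i
  show "0 < a $ i / \<bar>v $ i\<bar>" using a v by simp
  show "0 \<le> wall_time a ((bounce a ^^ 0) (x, v)) i" using wall_time_nonneg[OF x] by simp
  show "wall_time a ((bounce a ^^ 0) (x, v)) i \<le> a $ i / \<bar>v $ i\<bar>" using wall_time_le[OF x] by simp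
qed

section \<open>The rate of long flights\<close>

text \<open>
  The asymptotic fraction of times followed by \<open>x\<close> units of length without a bounce, when wall pair \<open>i\<close>
  is hit with frequency \<open>\<beta> i\<close>.
\<close>

definition free_fraction :: "('n::finite \<Rightarrow> real) \<Rightarrow> real \<Rightarrow> real" where
  "free_fraction \<beta> x = (\<Prod>i\<in>UNIV. max 0 (1 - x * \<beta> i))"

text \<open>
  The asymptotic number of flights longer than \<open>x\<close> per unit of length. For \<open>x > 0\<close> it is minus the
  derivative of \<open>free_fraction \<beta>\<close> wherever that exists, continued so as to be continuous from the right.
  For \<open>x < 0\<close> all flights are counted, which makes \<open>flight_rate \<beta> (-1)\<close> the total rate of flights.
\<close>

definition flight_rate :: "('n::finite \<Rightarrow> real) \<Rightarrow> real \<Rightarrow> real" where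
  "flight_rate \<beta> x =
     (if x < 0 then sum \<beta> UNIV
      else if \<forall>i. x * \<beta> i < 1 then \<Sum>i\<in>UNIV. \<beta> i * (\<Prod>j\<in>UNIV - {i}. 1 - x * \<beta> j)
      else 0)"

lemma flight_rate_neg: "x < 0 \<Longrightarrow> flight_rate \<beta> x = sum \<beta> UNIV"
  by (simp add: flight_rate_def)

lemma flight_rate_0: "flight_rate \<beta> 0 = sum \<beta> UNIV"
  by (simp add: flight_rate_def)

lemma flight_rate_eq_0: "0 \<le> x \<Longrightarrow> 1 \<le> x * \<beta> i \<Longrightarrow> flight_rate \<beta> x = 0"
  by (auto simp: flight_rate_def dest: spec[of _ i])

lemma flight_rate_antimono:
  assumes \<beta>: "\<And>i. 0 \<le> \<beta> i" and "x \<le> y"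
  shows "flight_rate \<beta> y \<le> flight_rate \<beta> x"
proof -
  have *: "(\<Sum>i\<in>UNIV. \<beta> i * (\<Prod>j\<in>UNIV - {i}. 1 - y * \<beta> j)) \<le> (\<Sum>i\<in>UNIV. \<beta> i * (\<Prod>j\<in>UNIV - {i}. 1 - z * \<beta> j))"
    if "\<forall>i. y * \<beta> i < 1" "z \<le> y" for z
    using \<beta> that by (intro sum_mono mult_left_mono prod_mono) (auto simp: less_imp_le mult_right_mono)
  have below: "\<forall>i. x * \<beta> i < 1" if "\<forall>i. y * \<beta> i < 1"
    using that \<beta> assms(2) by (meson le_less_trans mult_right_mono)
  have nonneg: "0 \<le> (\<Sum>i\<in>UNIV. \<beta> i * (\<Prod>j\<in>UNIV - {i}. 1 - x * \<beta> j))" if "\<forall>i. x * \<beta> i < 1"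
    using \<beta> that by (intro sum_nonneg mult_nonneg_nonneg prod_nonneg) (auto simp: less_imp_le)
  show ?thesis
  proof (cases "\<forall>i. y * \<beta> i < 1")
    case True
    then show ?thesis using *[of x] *[of 0] below assms(2) by (auto simp: flight_rate_def)
  next
    case False
    then show ?thesis using nonneg \<beta> assms(2) by (auto simp: flight_rate_def sum_nonneg)
  qed
qed

lemma flight_rate_nonneg:
  assumes "\<And>i. 0 \<le> \<beta> i"
  shows "0 \<le> flight_rate \<beta> x"
  unfolding flight_rate_def using assms
  by (auto intro!: sum_nonneg mult_nonneg_nonneg prod_nonneg simp: less_imp_le)

lemma flight_rate_le_sum:
  assumes "\<And>i. 0 \<le> \<beta> i"
  shows "flight_rate \<beta> x \<le> sum \<beta> UNIV"
  using flight_rate_antimono[of \<beta> "min x (-1)" x] assms by (simp add: flight_rate_neg)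

lemma flight_rate_right_continuous:
  assumes \<beta>: "\<And>i. 0 \<le> \<beta> i"
  shows "(flight_rate \<beta> \<longlongrightarrow> flight_rate \<beta> x) (at_right x)"
proof -
  consider "x < 0" | "0 \<le> x" "\<forall>i. x * \<beta> i < 1" | j where "0 \<le> x" "1 \<le> x * \<beta> j"
    by (metis not_less)
  then show ?thesis
  proof cases
    case 1
    have "\<forall>\<^sub>F y in at_right x. y < 0" using 1 by (rule eventually_at_rightI[of x 0, rotated]) auto
    then have "\<forall>\<^sub>F y in at_right x. flight_rate \<beta> y = flight_rate \<beta> x"
      by eventually_elim (use 1 in \<open>simp add: flight_rate_neg\<close>)
    then show ?thesis by (rule tendsto_eventually)
  next
    case 2
    define H where "H = (\<lambda>y. \<Sum>i\<in>UNIV. \<beta> i * (\<Prod>j\<in>UNIV - {i}. 1 - y * \<beta> j))"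
    have "\<forall>\<^sub>F y in at_right x. \<forall>i. y * \<beta> i < 1"
    proof (rule eventually_all_finite)
      fix i
      have "((\<lambda>y. y * \<beta> i) \<longlongrightarrow> x * \<beta> i) (at_right x)" by (intro tendsto_intros)
      then show "\<forall>\<^sub>F y in at_right x. y * \<beta> i < 1" using 2 by (elim order_tendstoD(2)) auto
    qed
    moreover have "\<forall>\<^sub>F y in at_right x. x < y" by (rule eventually_at_right_less)
    ultimately have "\<forall>\<^sub>F y in at_right x. H y = flight_rate \<beta> y"
      by eventually_elim (use 2 in \<open>simp add: H_def flight_rate_def\<close>)
    moreover have "(H \<longlongrightarrow> H x) (at_right x)"
      unfolding H_def by (intro tendsto_intros)
    moreover have "H x = flight_rate \<beta> x" using 2 by (simp add: H_def flight_rate_def)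
    ultimately show ?thesis using Lim_transform_eventually by fastforce
  next
    case 3
    have "\<forall>\<^sub>F y in at_right x. x < y" by (rule eventually_at_right_less)
    then have "\<forall>\<^sub>F y in at_right x. flight_rate \<beta> y = flight_rate \<beta> x"
    proof eventually_elim
      case (elim y)
      then have "x * \<beta> j \<le> y * \<beta> j" using \<beta> by (intro mult_right_mono) auto
      with 3 have "1 \<le> y * \<beta> j" by linarith
      then have "flight_rate \<beta> y = 0" using 3 elim by (intro flight_rate_eq_0[of y \<beta> j]) auto
      moreover have "flight_rate \<beta> x = 0" using 3 by (intro flight_rate_eq_0[of x \<beta> j])
      ultimately show ?case by simp
    qed
    then show ?thesis by (rule tendsto_eventually)
  qed
qed

lemma DERIV_free_fraction:
  assumes \<beta>: "\<And>i. 0 \<le> \<beta> i" and "0 < x" and ne: "\<And>i. x * \<beta> i \<noteq> 1"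
  shows "(free_fraction \<beta> has_real_derivative - flight_rate \<beta> x) (at x)"
proof (cases "\<forall>i. x * \<beta> i < 1")
  case True
  have "((\<lambda>y. \<Prod>i\<in>UNIV. 1 - y * \<beta> i) has_real_derivative
      (\<Sum>i\<in>UNIV. - \<beta> i * (\<Prod>j\<in>UNIV - {i}. 1 - x * \<beta> j))) (at x)"
    by (rule has_field_derivative_prod) (auto intro!: derivative_eq_intros)
  also have "(\<Sum>i\<in>UNIV. - \<beta> i * (\<Prod>j\<in>UNIV - {i}. 1 - x * \<beta> j)) = - flight_rate \<beta> x"
    using True \<open>0 < x\<close> by (simp add: flight_rate_def sum_negf)
  finally have D: "((\<lambda>y. \<Prod>i\<in>UNIV. 1 - y * \<beta> i) has_real_derivative - flight_rate \<beta> x) (at x)" .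
  have "\<forall>\<^sub>F y in nhds x. \<forall>i. y * \<beta> i < 1"
  proof (rule eventually_all_finite)
    fix i
    have "((\<lambda>y. y * \<beta> i) \<longlongrightarrow> x * \<beta> i) (nhds x)" by (intro tendsto_intros filterlim_ident)
    then show "\<forall>\<^sub>F y in nhds x. y * \<beta> i < 1" using True by (elim order_tendstoD(2)) auto
  qed
  then have "\<forall>\<^sub>F y in nhds x. free_fraction \<beta> y = (\<Prod>i\<in>UNIV. 1 - y * \<beta> i)"
    by eventually_elim (auto simp: free_fraction_def less_imp_le max_def intro!: prod.cong)
  with D show ?thesis by (subst DERIV_cong_ev) auto
next
  case False
  then obtain j where j: "1 < x * \<beta> j" using ne by (meson not_less_iff_gr_or_eq)
  have "((\<lambda>y. y * \<beta> j) \<longlongrightarrow> x * \<beta> j) (nhds x)" by (intro tendsto_intros filterlim_ident)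
  then have "\<forall>\<^sub>F y in nhds x. 1 < y * \<beta> j" using j by (elim order_tendstoD(1)) auto
  then have "\<forall>\<^sub>F y in nhds x. free_fraction \<beta> y = 0"
  proof eventually_elim
    case (elim y)
    then have "max 0 (1 - y * \<beta> j) = 0" by simp
    then show ?case unfolding free_fraction_def by (intro prod_zero) auto
  qed
  moreover have "flight_rate \<beta> x = 0" using j \<open>0 < x\<close> by (intro flight_rate_eq_0[of _ _ j]) auto
  ultimately show ?thesis by (subst DERIV_cong_ev[where g="\<lambda>_. 0" and v=0]) auto
qed

text \<open>
  The hypotheses hold if \<open>c i\<close> is nonincreasing and \<open>\<lambda>x. - G' i x\<close> is a primitive of it. They place \<open>c i x\<close>
  between the slopes of this primitive to the left and to the right of \<open>x\<close>. Those converge to slopes of \<open>\<lambda>x. - G x\<close>, which are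
  close to \<open>D\<close> for short intervals.
\<close>

lemma tendsto_slope_squeeze:
  fixes c G' :: "'i \<Rightarrow> real \<Rightarrow> real"
  assumes up: "\<And>i x y. 0 \<le> x \<Longrightarrow> x < y \<Longrightarrow> G' i x - G' i y \<le> (y - x) * c i x"
    and low: "\<And>i x y. 0 \<le> x \<Longrightarrow> x < y \<Longrightarrow> (y - x) * c i y \<le> G' i x - G' i y"
    and lim: "\<And>x. 0 \<le> x \<Longrightarrow> ((\<lambda>i. G' i x) \<longlongrightarrow> G x) F"
    and D: "(G has_real_derivative - D) (at x)" and "0 < x"
  shows "((\<lambda>i. c i x) \<longlongrightarrow> D) F"
proof (rule order_tendstoI)
  have slope: "((\<lambda>y. (G y - G x) / (y - x)) \<longlongrightarrow> - D) (at x)"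
    using D by (simp add: has_field_derivative_iff)
  fix l assume "l < D"
  then have "\<forall>\<^sub>F y in at x. (G y - G x) / (y - x) < - l"
    using slope by (intro order_tendstoD(2)) auto
  then have "\<forall>\<^sub>F y in at_right x. (G y - G x) / (y - x) < - l"
    by (simp add: eventually_at_split)
  then have "\<forall>\<^sub>F y in at_right x. x < y \<and> (G y - G x) / (y - x) < - l"
    using eventually_at_right_less by (rule eventually_conj[rotated])
  from eventually_happens[OF this] obtain y where y: "x < y" "(G y - G x) / (y - x) < - l" by auto
  then have "l * (y - x) < G x - G y" by (simp add: field_simps)
  moreover have "((\<lambda>i. G' i x - G' i y) \<longlongrightarrow> G x - G y) F"
    using y \<open>0 < x\<close> by (intro tendsto_diff lim) auto
  ultimately have "\<forall>\<^sub>F i in F. l * (y - x) < G' i x - G' i y" by (intro order_tendstoD(1)) auto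
  then show "\<forall>\<^sub>F i in F. l < c i x"
  proof eventually_elim
    case (elim i)
    then have "l * (y - x) < c i x * (y - x)"
      using up[of x y i] y(1) \<open>0 < x\<close> mult.commute[of "c i x" "y - x"] by linarith
    then show ?case using y(1) by (simp only: mult_less_cancel_right_pos diff_gt_0_iff_gt)
  qed
next
  have slope: "((\<lambda>y. (G y - G x) / (y - x)) \<longlongrightarrow> - D) (at x)"
    using D by (simp add: has_field_derivative_iff)
  fix u assume "D < u"
  then have "\<forall>\<^sub>F y in at x. - u < (G y - G x) / (y - x)"
    using slope by (intro order_tendstoD(1)) auto
  then have "\<forall>\<^sub>F y in at_left x. - u < (G y - G x) / (y - x)"
    by (simp add: eventually_at_split)
  moreover have "\<forall>\<^sub>F y in at_left x. y < x" by (auto simp: eventually_at_filter)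
  moreover have "\<forall>\<^sub>F y in at_left x. 0 < y"
    using \<open>0 < x\<close> by (intro eventually_at_leftI[of 0]) auto
  ultimately have "\<forall>\<^sub>F y in at_left x. 0 < y \<and> y < x \<and> - u < (G y - G x) / (y - x)"
    by eventually_elim auto
  from eventually_happens[OF this] obtain y where y: "0 < y" "y < x" "- u < (G y - G x) / (y - x)" by auto
  then have "G y - G x < u * (x - y)" by (simp add: field_simps)
  moreover have "((\<lambda>i. G' i y - G' i x) \<longlongrightarrow> G y - G x) F"
    using y \<open>0 < x\<close> by (intro tendsto_diff lim) auto
  ultimately have "\<forall>\<^sub>F i in F. G' i y - G' i x < u * (x - y)" by (intro order_tendstoD(2)) auto
  then show "\<forall>\<^sub>F i in F. c i x < u"
  proof eventually_elim
    case (elim i)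
    then have "c i x * (x - y) < u * (x - y)"
      using low[of y x i] y(1,2) mult.commute[of "c i x" "x - y"] by linarith
    then show ?case using y(2) by (simp only: mult_less_cancel_right_pos diff_gt_0_iff_gt)
  qed
qed

text \<open>
  For \<open>x > 0\<close> this is the squeeze by difference quotients. At 0 only quotients on the right are
  available, and they show just that no rate is lost; the upper bound \<open>u\<close> for the total \<open>n\<close> shows that
  none is gained by arbitrarily short flights.
\<close>

theorem flight_rate_limit:
  fixes c G' :: "'i \<Rightarrow> real \<Rightarrow> real" and n u :: "'i \<Rightarrow> real" and \<beta> :: "'n::finite \<Rightarrow> real"
  assumes \<beta>: "\<And>i. 0 < \<beta> i"
    and up: "\<And>i x y. 0 \<le> x \<Longrightarrow> x < y \<Longrightarrow> G' i x - G' i y \<le> (y - x) * c i x"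
    and low: "\<And>i x y. 0 \<le> x \<Longrightarrow> x < y \<Longrightarrow> (y - x) * c i y \<le> G' i x - G' i y"
    and lim: "\<And>x. 0 \<le> x \<Longrightarrow> ((\<lambda>i. G' i x) \<longlongrightarrow> free_fraction \<beta> x) F"
    and anti: "\<And>i x y. x \<le> y \<Longrightarrow> c i y \<le> c i x"
    and total: "\<And>i x. c i x \<le> n i" "\<And>i x. x < 0 \<Longrightarrow> c i x = n i"
    and total_le: "\<forall>\<^sub>F i in F. n i \<le> u i" "(u \<longlongrightarrow> sum \<beta> UNIV) F"
    and ne: "\<And>i. x * \<beta> i \<noteq> 1"
  shows "((\<lambda>i. c i x) \<longlongrightarrow> flight_rate \<beta> x) F"
proof -
  have pos: "((\<lambda>i. c i y) \<longlongrightarrow> flight_rate \<beta> y) F" if "0 < y" "\<And>i. y * \<beta> i \<noteq> 1" for y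
    by (rule tendsto_slope_squeeze[OF up low lim DERIV_free_fraction[of \<beta> y] that(1)])
       (use \<beta> that in \<open>auto intro: less_imp_le\<close>)
  have zero: "((\<lambda>i. c i 0) \<longlongrightarrow> sum \<beta> UNIV) F"
  proof (rule order_tendstoI)
    fix l assume "l < sum \<beta> UNIV"
    moreover have "(flight_rate \<beta> \<longlongrightarrow> sum \<beta> UNIV) (at_right 0)"
      using flight_rate_right_continuous[of \<beta> 0] \<beta> by (simp add: flight_rate_0 less_imp_le)
    ultimately have "\<forall>\<^sub>F y in at_right 0. l < flight_rate \<beta> y" by (elim order_tendstoD)
    moreover have "\<forall>\<^sub>F y in at_right (0::real). \<forall>i. y * \<beta> i < 1"
    proof (rule eventually_all_finite)
      fix i
      have "((\<lambda>y. y * \<beta> i) \<longlongrightarrow> 0 * \<beta> i) (at_right 0)" by (intro tendsto_intros)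
      then show "\<forall>\<^sub>F y in at_right 0. y * \<beta> i < 1" by (elim order_tendstoD(2)) auto
    qed
    moreover have "\<forall>\<^sub>F y in at_right (0::real). 0 < y" by (rule eventually_at_right_less)
    ultimately have "\<forall>\<^sub>F y in at_right 0. 0 < y \<and> l < flight_rate \<beta> y \<and> (\<forall>i. y * \<beta> i < 1)"
      by eventually_elim auto
    from eventually_happens[OF this] obtain y where y: "0 < y" "l < flight_rate \<beta> y" "\<And>i. y * \<beta> i < 1" by auto
    have "((\<lambda>i. c i y) \<longlongrightarrow> flight_rate \<beta> y) F"
      using y(1) by (rule pos) (use y(3) in \<open>metis less_irrefl\<close>)
    then have "\<forall>\<^sub>F i in F. l < c i y" using y(2) by (elim order_tendstoD)
    then show "\<forall>\<^sub>F i in F. l < c i 0"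
      by eventually_elim (use anti[of 0 y] y(1) in \<open>auto intro: less_le_trans\<close>)
  next
    fix r assume "sum \<beta> UNIV < r"
    with total_le(2) have "\<forall>\<^sub>F i in F. u i < r" by (elim order_tendstoD)
    with total_le(1) show "\<forall>\<^sub>F i in F. c i 0 < r"
      by eventually_elim (use total(1)[of _ 0] in \<open>auto intro: le_less_trans\<close>)
  qed
  consider "0 < x" | "x = 0" | "x < 0" by linarith
  then show ?thesis
  proof cases
    case 1 then show ?thesis by (rule pos) (rule ne)
  next
    case 2 then show ?thesis using zero by (simp add: flight_rate_0)
  next
    case 3
    have "(n \<longlongrightarrow> sum \<beta> UNIV) F"
      by (rule tendsto_sandwich[OF _ total_le(1) zero total_le(2)]) (use total(1) in auto)
    with 3 total(2)[OF 3] show ?thesis by (simp add: flight_rate_neg)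
  qed
qed

definition long_flights :: "real^'n \<Rightarrow> real \<Rightarrow> real \<Rightarrow> (real^'n) \<times> (real^'n) \<Rightarrow> nat" where
  "long_flights a R x s = size (filter_mset (\<lambda>g. x < g) (bounce_lengths a R s))"

text \<open>
  The squeeze applied to counts per unit of distance. The primitive of the counts is the sum of the excess
  lengths \<open>max 0 (g - y)\<close>, which up to a bounded error is the measure of a set of times described by the
  phases, and the total count is bounded by the number of rings.
\<close>

theorem long_flights_rate:
  fixes a v :: "real^'n"
  assumes a: "\<And>i. 0 < a $ i" and p: "p \<in> cbox 0 a" and v: "\<And>i. v $ i \<noteq> 0"
    and indep: "\<And>m::'n \<Rightarrow> int. (\<Sum>i\<in>UNIV. of_int (m i) * (\<bar>v $ i\<bar> / a $ i)) = 0 \<Longrightarrow> m = (\<lambda>_. 0)"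
    and ne: "\<And>i. x * (\<bar>v $ i\<bar> / a $ i) \<noteq> 1"
  shows "((\<lambda>R. real (long_flights a R x (p, v)) / R) \<longlongrightarrow> flight_rate (\<lambda>i. \<bar>v $ i\<bar> / a $ i) x) at_top"
proof -
  define \<beta> where "\<beta> = (\<lambda>i. \<bar>v $ i\<bar> / a $ i)"
  define e where "e = flight a (p, v)"
  have pc: "periodic_clocks (\<lambda>i. a $ i / \<bar>v $ i\<bar>) (\<lambda>k. wall_time a ((bounce a ^^ k) (p, v))) e"
    unfolding e_def by (rule periodic_clocks_billiard[OF a p v])
  interpret periodic_clocks "\<lambda>i. a $ i / \<bar>v $ i\<bar>" "\<lambda>k. wall_time a ((bounce a ^^ k) (p, v))" e
    by (rule pc)
  have \<beta>: "0 < \<beta> i" for i using a v by (simp add: \<beta>_def)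
  define A where "A R = {k. ring_time (Suc k) \<le> R}" for R
  have finA: "finite (A R)" for R unfolding A_def by (rule finite_ring_set)
  have bl: "bounce_lengths a R (p, v) = image_mset (\<lambda>k. e (Suc k)) (mset_set (A R))" for R
    by (simp add: bounce_lengths_def A_def ring_time_def bounce_time_def flip: e_def)
  have lf: "long_flights a R y (p, v) = card {k\<in>A R. y < e (Suc k)}" for R y
    using finA[of R] by (simp add: long_flights_def bl filter_mset_image_mset)
  define C where "C = (\<Sum>i\<in>UNIV. a $ i / \<bar>v $ i\<bar>)"
  have C: "a $ i / \<bar>v $ i\<bar> \<le> C" for i
    unfolding C_def using a by (intro member_le_sum) (auto simp: less_imp_le)
  define S where "S R y = (\<Sum>k\<in>A R. max 0 (e (Suc k) - y))" for R y
  define \<theta> where "\<theta> = (\<lambda>i. 1 - wall_time a ((bounce a ^^ 0) (p, v)) i / (a $ i / \<bar>v $ i\<bar>))"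
  have ph: "phase i t = frac (\<beta> i * t + \<theta> i)" for i t
    unfolding phase_def \<beta>_def \<theta>_def by (simp add: mult.commute)
  have S_lim: "((\<lambda>R. S R y / R) \<longlongrightarrow> free_fraction \<beta> y) at_top" if "0 \<le> y" for y
  proof -
    define m where "m R = measure lborel {t\<in>{0..R}. \<forall>i. phase i t < 1 - y / (a $ i / \<bar>v $ i\<bar>)}" for R
    have "((\<lambda>R. measure lborel {t\<in>{0..R}. \<forall>i. frac (\<beta> i * t + \<theta> i) < max 0 (1 - y * \<beta> i)} / R)
        \<longlongrightarrow> free_fraction \<beta> y) at_top"
      unfolding free_fraction_def
    proof (rule equidistribution_linear_flow)
      show "0 < \<beta> i" for i by (rule \<beta>)
      show "max 0 (1 - y * \<beta> i) \<le> 1" for i using that \<beta>[of i] by simp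
      show "m = (\<lambda>_. 0)" if "(\<Sum>i\<in>UNIV. of_int (m i) * \<beta> i) = 0" for m
        using indep[of m] that by (simp add: \<beta>_def)
    qed auto
    also have "(\<lambda>R. measure lborel {t\<in>{0..R}. \<forall>i. frac (\<beta> i * t + \<theta> i) < max 0 (1 - y * \<beta> i)} / R) = (\<lambda>R. m R / R)"
    proof -
      have "frac u < max 0 w \<longleftrightarrow> frac u < w" for u w :: real
        using frac_ge_0[of u] by (simp add: less_max_iff_disj not_less[THEN iffD2])
      then show ?thesis unfolding m_def ph by (simp add: \<beta>_def)
    qed
    finally have m: "((\<lambda>R. m R / R) \<longlongrightarrow> free_fraction \<beta> y) at_top" .
    have "((\<lambda>R. 2 * C / R) \<longlongrightarrow> 0) at_top" by real_asymp
    from tendsto_diff[OF m this] have m': "((\<lambda>R. m R / R - 2 * C / R) \<longlongrightarrow> free_fraction \<beta> y) at_top" by simp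
    have "\<forall>\<^sub>F R in at_top. m R / R - 2 * C / R \<le> S R y / R \<and> S R y / R \<le> m R / R"
      using eventually_gt_at_top[of "0::real"]
    proof eventually_elim
      case (elim R)
      then show ?case
        using measure_free_time_approx[OF that _ C, of R]
        by (auto simp: m_def S_def A_def diff_divide_distrib[symmetric] intro!: divide_right_mono)
    qed
    then show ?thesis
      by (intro tendsto_sandwich[OF _ _ m' m]) (auto elim: eventually_mono)
  qed
  have card_sum: "real (card {k\<in>A R. y < e (Suc k)}) = (\<Sum>k\<in>A R. of_bool (y < e (Suc k)))" for R y
    using finA[of R] by (simp add: of_bool_def sum.If_cases Int_def conj_commute)
  \<comment> \<open>The denominator \<open>max 1 R\<close> keeps the inequalities below true for all R, including those that are not positive.\<close>
  define c where "c R y = real (long_flights a R y (p, v)) / max 1 R" for R y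
  have maxpos: "0 < max 1 R" for R :: real by simp
  have "((\<lambda>R. c R x) \<longlongrightarrow> flight_rate \<beta> x) at_top"
  proof (rule flight_rate_limit[where G'="\<lambda>R y. S R y / max 1 R" and n="\<lambda>R. real (card (A R)) / max 1 R"
        and u="\<lambda>R. sum \<beta> UNIV + CARD('n) / R"])
    fix R y z :: real assume yz: "0 \<le> y" "y < z"
    have "S R y - S R z = (\<Sum>k\<in>A R. max 0 (e (Suc k) - y) - max 0 (e (Suc k) - z))"
      by (simp add: S_def sum_subtractf)
    also have "\<dots> \<le> (\<Sum>k\<in>A R. (z - y) * of_bool (y < e (Suc k)))"
      using yz by (intro sum_mono) (auto simp: max_def)
    finally have "S R y - S R z \<le> (z - y) * real (long_flights a R y (p, v))"
      by (simp add: lf card_sum sum_distrib_left)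
    then show "S R y / max 1 R - S R z / max 1 R \<le> (z - y) * c R y"
      using maxpos[of R] by (simp add: c_def diff_divide_distrib[symmetric] divide_right_mono)
    have "(\<Sum>k\<in>A R. (z - y) * of_bool (z < e (Suc k))) \<le> (\<Sum>k\<in>A R. max 0 (e (Suc k) - y) - max 0 (e (Suc k) - z))"
      using yz by (intro sum_mono) (auto simp: max_def)
    also have "\<dots> = S R y - S R z"
      by (simp add: S_def sum_subtractf)
    finally have "(z - y) * real (long_flights a R z (p, v)) \<le> S R y - S R z"
      by (simp add: lf card_sum sum_distrib_left)
    then show "(z - y) * c R z \<le> S R y / max 1 R - S R z / max 1 R"
      using maxpos[of R] by (simp add: c_def diff_divide_distrib[symmetric] divide_right_mono)
  next
    fix y :: real assume "0 \<le> y"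
    have "\<forall>\<^sub>F R in at_top. S R y / R = S R y / max 1 R"
      using eventually_ge_at_top[of "1::real"] by eventually_elim (simp add: max_def)
    with S_lim[OF \<open>0 \<le> y\<close>] show "((\<lambda>R. S R y / max 1 R) \<longlongrightarrow> free_fraction \<beta> y) at_top"
      by (rule Lim_transform_eventually)
  next
    fix R y z :: real assume "y \<le> z"
    have "card {k\<in>A R. z < e (Suc k)} \<le> card {k\<in>A R. y < e (Suc k)}"
      using \<open>y \<le> z\<close> finA[of R] by (intro card_mono) auto
    then show "c R z \<le> c R y" using maxpos[of R] by (simp add: c_def lf divide_right_mono)
  next
    fix R y :: real
    have "card {k\<in>A R. y < e (Suc k)} \<le> card (A R)" using finA[of R] by (intro card_mono) auto
    then show "c R y \<le> real (card (A R)) / max 1 R" using maxpos[of R] by (simp add: c_def lf divide_right_mono)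
    assume "y < 0"
    then have "{k\<in>A R. y < e (Suc k)} = A R" using e_nonneg by (auto intro: less_le_trans)
    then show "c R y = real (card (A R)) / max 1 R" by (simp add: c_def lf)
  next
    show "\<forall>\<^sub>F R in at_top. real (card (A R)) / max 1 R \<le> sum \<beta> UNIV + CARD('n) / R"
      using eventually_ge_at_top[of "1::real"]
    proof eventually_elim
      case (elim R)
      then have "real (card (A R)) \<le> R * sum \<beta> UNIV + CARD('n)"
        using card_ring_set_le[of R] by (simp add: A_def \<beta>_def)
      then have "real (card (A R)) / R \<le> (R * sum \<beta> UNIV + CARD('n)) / R"
        using elim by (intro divide_right_mono) auto
      with elim show ?case by (simp add: add_divide_distrib max_def)
    qed
    have "((\<lambda>R. sum \<beta> UNIV + CARD('n) / R) \<longlongrightarrow> sum \<beta> UNIV + 0) at_top"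
      by (intro tendsto_add tendsto_const) real_asymp
    then show "((\<lambda>R. sum \<beta> UNIV + CARD('n) / R) \<longlongrightarrow> sum \<beta> UNIV) at_top" by simp
    show "x * \<beta> i \<noteq> 1" for i using ne by (simp add: \<beta>_def)
  qed (use \<beta> in auto)
  moreover have "\<forall>\<^sub>F R in at_top. c R x = real (long_flights a R x (p, v)) / R"
    using eventually_ge_at_top[of "1::real"] by eventually_elim (simp add: c_def max_def)
  ultimately show ?thesis unfolding \<beta>_def[symmetric] by (rule Lim_transform_eventually)
qed

lemma size_bounce_lengths_le:
  fixes a v :: "real^'n"
  assumes a: "\<And>i. 0 < a $ i" and p: "p \<in> cbox 0 a" and v: "\<And>i. v $ i \<noteq> 0" and "0 \<le> R"
  shows "real (size (bounce_lengths a R (p, v))) \<le> R * (\<Sum>i\<in>UNIV. \<bar>v $ i\<bar> / a $ i) + CARD('n)"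
proof -
  interpret periodic_clocks "\<lambda>i. a $ i / \<bar>v $ i\<bar>" "\<lambda>k. wall_time a ((bounce a ^^ k) (p, v))" "flight a (p, v)"
    by (rule periodic_clocks_billiard[OF a p v])
  have "size (bounce_lengths a R (p, v)) = card {k. ring_time (Suc k) \<le> R}"
    by (simp add: bounce_lengths_def ring_time_def bounce_time_def)
  with card_ring_set_le[OF \<open>0 \<le> R\<close>] show ?thesis by simp
qed

section \<open>Lebesgue measure along parallel lines\<close>

lemma emeasure_lborel_vimage_plus:
  fixes A :: "real set"
  assumes "A \<in> sets borel"
  shows "emeasure lborel ((\<lambda>t. t + c) -` A) = emeasure lborel A"
proof -
  have "emeasure lborel A = emeasure (distr lborel borel ((+) c)) A"
    by (simp add: lborel_distr_plus)
  also have "\<dots> = emeasure lborel ((\<lambda>t. t + c) -` A)"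
  proof -
    have "(+) c = (\<lambda>t. t + c)" by (auto simp: add.commute)
    then show ?thesis using assms by (subst emeasure_distr) auto
  qed
  finally show ?thesis ..
qed

text \<open>
  A product of Lebesgue measures is determined by its values on products of sets, and translating such a
  product translates each of its factors.
\<close>

lemma distr_PiM_lborel_shift:
  fixes g :: "'i \<Rightarrow> real"
  assumes [simp]: "finite I"
  shows "distr (PiM I (\<lambda>_. lborel)) (PiM I (\<lambda>_. lborel)) (\<lambda>f. \<lambda>i\<in>I. f i + g i) = PiM I (\<lambda>_. lborel)"
proof -
  interpret product_sigma_finite "\<lambda>_::'i. lborel :: real measure" by standard
  show ?thesis
  proof (rule PiM_eqI)
    fix A :: "'i \<Rightarrow> real set" assume A: "\<And>i. i \<in> I \<Longrightarrow> A i \<in> sets lborel"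
    have vim: "(\<lambda>f. \<lambda>i\<in>I. f i + g i) -` Pi\<^sub>E I A \<inter> space (PiM I (\<lambda>_. lborel)) = Pi\<^sub>E I (\<lambda>i. (\<lambda>t. t + g i) -` A i)"
      by (auto simp: space_PiM PiE_def Pi_def)
    have meas: "(\<lambda>t. t + g i) -` A i \<in> sets lborel" if "i \<in> I" for i
      using measurable_sets[of "\<lambda>t. t + g i" borel borel "A i"] A[OF that] by simp
    have "emeasure (distr (PiM I (\<lambda>_. lborel)) (PiM I (\<lambda>_. lborel)) (\<lambda>f. \<lambda>i\<in>I. f i + g i)) (Pi\<^sub>E I A)
        = emeasure (PiM I (\<lambda>_. lborel)) (Pi\<^sub>E I (\<lambda>i. (\<lambda>t. t + g i) -` A i))"
      using A by (subst emeasure_distr) (auto intro!: sets_PiM_I_finite simp: vim)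
    also have "\<dots> = (\<Prod>i\<in>I. emeasure lborel ((\<lambda>t. t + g i) -` A i))"
      using meas by (intro emeasure_PiM) auto
    also have "\<dots> = (\<Prod>i\<in>I. emeasure lborel (A i))"
      using A by (intro prod.cong refl emeasure_lborel_vimage_plus) auto
    finally show "emeasure (distr (PiM I (\<lambda>_. lborel)) (PiM I (\<lambda>_. lborel)) (\<lambda>f. \<lambda>i\<in>I. f i + g i)) (Pi\<^sub>E I A)
        = (\<Prod>i\<in>I. emeasure lborel (A i))" .
  qed auto
qed

text \<open>
  The image of product Lebesgue measure under the coordinates given by a set \<open>C\<close> of vectors; the
  hyperplane measures are of this form.
\<close>

definition frame_lborel :: "'a::euclidean_space set \<Rightarrow> 'a measure" where
  "frame_lborel C = distr (PiM C (\<lambda>_. lborel)) borel (\<lambda>c. \<Sum>b\<in>C. c b *\<^sub>R b)"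

lemma sets_frame_lborel[measurable_cong, simp]: "sets (frame_lborel C) = sets borel"
  by (simp add: frame_lborel_def)

lemma frame_map_measurable[measurable]:
  "(\<lambda>c. \<Sum>b\<in>C. c b *\<^sub>R b) \<in> borel_measurable (PiM C (\<lambda>_. lborel :: real measure))"
  for C :: "'a::euclidean_space set"
  by (intro borel_measurable_sum borel_measurable_scaleR) auto

definition orthonormal :: "'a::euclidean_space set \<Rightarrow> bool" where
  "orthonormal C \<longleftrightarrow> pairwise orthogonal C \<and> (\<forall>b\<in>C. norm b = 1)"

lemma orthonormal_independent: "orthonormal C \<Longrightarrow> independent C"
  unfolding orthonormal_def by (intro pairwise_orthogonal_independent) auto

lemma orthonormal_finite: "orthonormal C \<Longrightarrow> finite C"
  by (rule independent_imp_finite[OF orthonormal_independent])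

lemma orthonormal_inner_sum:
  assumes C: "orthonormal C" and b: "b \<in> C"
  shows "b \<bullet> (\<Sum>c\<in>C. f c *\<^sub>R c) = f b"
proof -
  have fin: "finite C" by (rule orthonormal_finite[OF C])
  have "b \<bullet> (\<Sum>c\<in>C. f c *\<^sub>R c) = (\<Sum>c\<in>C. f c * (b \<bullet> c))" by (simp add: inner_sum_right)
  also have "\<dots> = (\<Sum>c\<in>C. if c = b then f b else 0)"
    using C b by (intro sum.cong) (auto simp: orthonormal_def pairwise_def orthogonal_def dot_square_norm)
  also have "\<dots> = f b" using fin b by simp
  finally show ?thesis .
qed

lemma orthonormal_norm_sum:
  assumes C: "orthonormal C"
  shows "norm (\<Sum>c\<in>C. f c *\<^sub>R c) = sqrt (\<Sum>c\<in>C. (f c)\<^sup>2)"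
proof -
  have "(\<Sum>c\<in>C. f c *\<^sub>R c) \<bullet> (\<Sum>c\<in>C. f c *\<^sub>R c) = (\<Sum>b\<in>C. f b * (b \<bullet> (\<Sum>c\<in>C. f c *\<^sub>R c)))"
    by (simp add: inner_sum_left)
  also have "\<dots> = (\<Sum>c\<in>C. (f c)\<^sup>2)"
    using orthonormal_inner_sum[OF C] by (intro sum.cong) (auto simp: power2_eq_square)
  finally show ?thesis by (simp add: norm_eq_sqrt_inner)
qed

lemma orthonormal_expansion:
  assumes C: "orthonormal C" and z: "z \<in> span C"
  shows "(\<Sum>b\<in>C. (b \<bullet> z) *\<^sub>R b) = z"
proof -
  obtain u where u: "z = (\<Sum>b\<in>C. u b *\<^sub>R b)"
    using z orthonormal_finite[OF C] by (auto simp: span_finite)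
  show ?thesis
    unfolding u by (intro sum.cong) (auto simp: orthonormal_inner_sum[OF C])
qed

lemma nn_integral_frame_lborel_shift:
  assumes C: "orthonormal C" "span C = UNIV" and [measurable]: "f \<in> borel_measurable borel"
  shows "(\<integral>\<^sup>+y. f (z + y) \<partial>frame_lborel C) = (\<integral>\<^sup>+y. f y \<partial>frame_lborel C)"
proof -
  have fin: "finite C" by (rule orthonormal_finite[OF C(1)])
  have sh: "(\<Sum>b\<in>C. (\<lambda>i\<in>C. c i + i \<bullet> z) b *\<^sub>R b) = z + (\<Sum>b\<in>C. c b *\<^sub>R b)" for c
    using orthonormal_expansion[OF C(1), of z] C(2) by (simp add: scaleR_add_left sum.distrib add.commute)
  have "(\<integral>\<^sup>+y. f y \<partial>frame_lborel C) = (\<integral>\<^sup>+c. f (\<Sum>b\<in>C. c b *\<^sub>R b) \<partial>PiM C (\<lambda>_. lborel))"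
    unfolding frame_lborel_def by (rule nn_integral_distr) auto
  also have "\<dots> = (\<integral>\<^sup>+c. f (\<Sum>b\<in>C. c b *\<^sub>R b)
      \<partial>distr (PiM C (\<lambda>_. lborel)) (PiM C (\<lambda>_. lborel)) (\<lambda>f. \<lambda>i\<in>C. f i + i \<bullet> z))"
    by (simp only: distr_PiM_lborel_shift[OF fin])
  also have "\<dots> = (\<integral>\<^sup>+c. f (\<Sum>b\<in>C. (\<lambda>i\<in>C. c i + i \<bullet> z) b *\<^sub>R b) \<partial>PiM C (\<lambda>_. lborel))"
    by (rule nn_integral_distr) auto
  also have "\<dots> = (\<integral>\<^sup>+c. f (z + (\<Sum>b\<in>C. c b *\<^sub>R b)) \<partial>PiM C (\<lambda>_. lborel))"
    by (simp only: sh)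
  also have "\<dots> = (\<integral>\<^sup>+y. f (z + y) \<partial>frame_lborel C)"
    unfolding frame_lborel_def by (rule nn_integral_distr[symmetric]) auto
  finally show ?thesis ..
qed

lemma emeasure_frame_lborel_cball:
  fixes C :: "'a::euclidean_space set"
  assumes C: "orthonormal C" "span C = UNIV" and r: "0 < r"
  shows "emeasure (frame_lborel C) (cball 0 r) = emeasure lborel (cball (0::'a) r)"
proof -
  have fin: "finite C" by (rule orthonormal_finite[OF C(1)])
  have card: "card C = DIM('a)"
    using dim_eq_card_independent[OF orthonormal_independent[OF C(1)]] C(2) by (metis dim_UNIV dim_span)
  have "emeasure (frame_lborel C) (cball 0 r)
      = emeasure (PiM C (\<lambda>_. lborel)) ({f. sqrt (\<Sum>i\<in>C. (f i)\<^sup>2) \<le> r} \<inter> space (PiM C (\<lambda>_. lborel)))"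
    unfolding frame_lborel_def
    by (subst emeasure_distr) (auto simp: orthonormal_norm_sum[OF C(1)] intro!: arg_cong2[where f=emeasure])
  also have "\<dots> = ennreal (unit_ball_vol (real (card C)) * r ^ card C)"
    by (rule emeasure_cball_aux[OF fin r])
  also have "\<dots> = emeasure lborel (cball (0::'a) r)"
    using r by (simp add: emeasure_cball card)
  finally show ?thesis .
qed

lemma sigma_finite_frame_lborel:
  assumes C: "orthonormal C" "span C = UNIV"
  shows "sigma_finite_measure (frame_lborel C)"
proof
  show "\<exists>A. countable A \<and> A \<subseteq> sets (frame_lborel C) \<and> \<Union> A = space (frame_lborel C) \<and> (\<forall>a\<in>A. emeasure (frame_lborel C) a \<noteq> \<infinity>)"
  proof (intro exI[of _ "range (\<lambda>n::nat. cball 0 (real (Suc n)))"] conjI ballI)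
    show "\<Union> (range (\<lambda>n::nat. cball (0::'a) (real (Suc n)))) = space (frame_lborel C)"
    proof -
      have "\<exists>n. norm x \<le> real (Suc n)" for x :: 'a
      proof -
        obtain n where "norm x \<le> real n" using real_arch_simple by blast
        then show ?thesis by (intro exI[of _ n]) simp
      qed
      then show ?thesis by (auto simp: frame_lborel_def)
    qed
    fix A assume "A \<in> range (\<lambda>n::nat. cball (0::'a) (real (Suc n)))"
    then obtain n where A: "A = cball 0 (real (Suc n))" by auto
    show "emeasure (frame_lborel C) A \<noteq> \<infinity>"
      unfolding A by (subst emeasure_frame_lborel_cball[OF C]) (auto simp: emeasure_cball)
  qed auto
qed

text \<open>
  Both measures are invariant under translations. Two such measures agree up to a factor: computing the
  double integral of \<open>indicator B x * indicator A (x + y)\<close> in both orders gives \<open>\<lambda> B \<cdot> \<nu> A = \<nu> B \<cdot> \<lambda> A\<close> for a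
  ball \<open>B\<close> around 0, which equals \<open>- B\<close>. The factor is 1 since the volume of a ball computed in
  orthonormal coordinates depends only on their number.
\<close>

theorem frame_lborel_eq_lborel:
  fixes C :: "'a::euclidean_space set"
  assumes C: "orthonormal C" "span C = UNIV"
  shows "frame_lborel C = lborel"
proof (rule measure_eqI)
  interpret C: sigma_finite_measure "frame_lborel C" by (rule sigma_finite_frame_lborel[OF C])
  interpret pair_sigma_finite "lborel :: 'a measure" "frame_lborel C" ..
  fix A assume "A \<in> sets (frame_lborel C)"
  then have A[measurable]: "A \<in> sets borel" by simp
  let ?B = "cball (0::'a) 1"
  have [measurable]: "?B \<in> sets borel" by (rule borel_closed) simp
  have sp: "sets (lborel \<Otimes>\<^sub>M frame_lborel C) = sets (borel \<Otimes>\<^sub>M (borel :: 'a measure))"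
    by (intro sets_pair_measure_cong) auto
  have "emeasure lborel ?B * emeasure (frame_lborel C) A
      = (\<integral>\<^sup>+x. indicator ?B x * (\<integral>\<^sup>+y. indicator A y \<partial>frame_lborel C) \<partial>lborel)"
  proof -
    have "(\<integral>\<^sup>+x. indicator ?B x * emeasure (frame_lborel C) A \<partial>lborel) = (\<integral>\<^sup>+x. indicator ?B x \<partial>lborel) * emeasure (frame_lborel C) A"
      by (rule nn_integral_multc) (auto intro!: borel_measurable_indicator borel_closed)
    then show ?thesis by (simp add: mult.commute)
  qed
  also have "\<dots> = (\<integral>\<^sup>+x. indicator ?B x * (\<integral>\<^sup>+y. indicator A (x + y) \<partial>frame_lborel C) \<partial>lborel)"
    by (subst nn_integral_frame_lborel_shift[OF C]) auto
  also have "\<dots> = (\<integral>\<^sup>+x. (\<integral>\<^sup>+y. indicator ?B x * indicator A (x + y) \<partial>frame_lborel C) \<partial>lborel)"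
    by (subst nn_integral_cmult) auto
  also have "\<dots> = (\<integral>\<^sup>+y. (\<integral>\<^sup>+x. indicator ?B x * indicator A (x + y) \<partial>lborel) \<partial>frame_lborel C)"
    by (rule Fubini'[symmetric]) (unfold measurable_cong_sets[OF sp refl], measurable)
  also have "\<dots> = (\<integral>\<^sup>+y. (\<integral>\<^sup>+x. indicator ?B (x - y) * indicator A x \<partial>lborel) \<partial>frame_lborel C)"
  proof (rule nn_integral_cong)
    fix y :: 'a
    have "(\<integral>\<^sup>+x. indicator ?B (x - y) * indicator A x \<partial>lborel)
        = (\<integral>\<^sup>+x. indicator ?B (x - y) * indicator A x \<partial>distr lborel borel ((+) y))"
      by (simp add: lborel_distr_plus)
    also have "\<dots> = (\<integral>\<^sup>+x. indicator ?B x * indicator A (x + y) \<partial>lborel)"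
      by (subst nn_integral_distr) (auto simp: add.commute)
    finally show "(\<integral>\<^sup>+x. indicator ?B x * indicator A (x + y) \<partial>lborel)
      = (\<integral>\<^sup>+x. indicator ?B (x - y) * indicator A x \<partial>lborel)" ..
  qed
  also have "\<dots> = (\<integral>\<^sup>+x. (\<integral>\<^sup>+y. indicator ?B (x - y) * indicator A x \<partial>frame_lborel C) \<partial>lborel)"
    by (rule Fubini') (unfold measurable_cong_sets[OF sp refl], measurable)
  also have "\<dots> = (\<integral>\<^sup>+x. emeasure (frame_lborel C) ?B * indicator A x \<partial>lborel)"
  proof (rule nn_integral_cong)
    fix x :: 'a
    have "(\<integral>\<^sup>+y. indicator ?B (x - y) \<partial>frame_lborel C) = (\<integral>\<^sup>+y. indicator ?B (- y) \<partial>frame_lborel C)"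
      using nn_integral_frame_lborel_shift[OF C, of "\<lambda>y. indicator ?B (x - y)" x] by simp
    also have "\<dots> = (\<integral>\<^sup>+y. indicator ?B y \<partial>frame_lborel C)"
      by (intro nn_integral_cong) (auto simp: indicator_def)
    also have "\<dots> = emeasure (frame_lborel C) ?B" by simp
    finally show "(\<integral>\<^sup>+y. indicator ?B (x - y) * indicator A x \<partial>frame_lborel C)
        = emeasure (frame_lborel C) ?B * indicator A x"
      by (subst nn_integral_multc) auto
  qed
  also have "\<dots> = emeasure lborel ?B * emeasure lborel A"
    by (simp add: nn_integral_cmult emeasure_frame_lborel_cball[OF C])
  finally have eq: "emeasure lborel ?B * emeasure (frame_lborel C) A = emeasure lborel ?B * emeasure lborel A" .
  have "emeasure lborel ?B \<noteq> 0" "emeasure lborel ?B \<noteq> \<infinity>"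
    by (auto simp: emeasure_cball unit_ball_vol_pos less_imp_neq[symmetric])
  with eq show "emeasure (frame_lborel C) A = emeasure lborel A"
    by (simp add: ennreal_mult_cancel_left)
qed simp

lemma hyperplane_basis:
  fixes v :: "real^'n"
  assumes v: "norm v = 1"
  shows "orthonormal (hyperplane_basis v)" "span (hyperplane_basis v) = {x. v \<bullet> x = 0}"
    "v \<notin> hyperplane_basis v" "orthonormal (insert v (hyperplane_basis v))"
    "span (insert v (hyperplane_basis v)) = UNIV"
proof -
  let ?B = "hyperplane_basis v"
  have "\<exists>B. pairwise orthogonal B \<and> (\<forall>b\<in>B. norm b = 1) \<and> span B = {x. v \<bullet> x = 0}"
    using orthonormal_basis_subspace[OF subspace_hyperplane[of v]] by metis
  from someI_ex[OF this, folded hyperplane_basis_def]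
  have B: "pairwise orthogonal ?B" "\<forall>b\<in>?B. norm b = 1" and sp: "span ?B = {x. v \<bullet> x = 0}" by auto
  show "orthonormal ?B" using B by (simp add: orthonormal_def)
  show "span ?B = {x. v \<bullet> x = 0}" by (rule sp)
  have orth: "v \<bullet> b = 0" if "b \<in> ?B" for b using span_base[OF that] sp by auto
  show "v \<notin> ?B" using orth[of v] v by (auto simp: dot_square_norm)
  show on: "orthonormal (insert v ?B)"
    using B orth v by (auto simp: orthonormal_def pairwise_insert orthogonal_def inner_commute)
  have "x \<in> span (insert v ?B)" for x
  proof -
    have "x - (v \<bullet> x) *\<^sub>R v \<in> span ?B" using v by (simp add: sp inner_diff_right dot_square_norm)
    then have "x - (v \<bullet> x) *\<^sub>R v \<in> span (insert v ?B)" using span_mono[of ?B "insert v ?B"] by auto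
    moreover have "(v \<bullet> x) *\<^sub>R v \<in> span (insert v ?B)" by (intro span_scale span_base) auto
    ultimately have "(x - (v \<bullet> x) *\<^sub>R v) + (v \<bullet> x) *\<^sub>R v \<in> span (insert v ?B)" by (rule span_add)
    then show ?thesis by simp
  qed
  then show "span (insert v ?B) = UNIV" by auto
qed

lemma sets_hyperplane_lborel[measurable_cong, simp]: "sets (hyperplane_lborel v) = sets borel"
  and space_hyperplane_lborel[simp]: "space (hyperplane_lborel v) = UNIV"
  by (simp_all add: hyperplane_lborel_def)

lemma AE_hyperplane_lborel:
  assumes "norm v = 1"
  shows "AE q in hyperplane_lborel v. v \<bullet> q = 0"
proof -
  have "v \<bullet> (\<Sum>b\<in>hyperplane_basis v. c b *\<^sub>R b) = 0" for c
  proof -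
    have "(\<Sum>b\<in>hyperplane_basis v. c b *\<^sub>R b) \<in> span (hyperplane_basis v)"
      by (intro span_sum span_scale span_base)
    then show ?thesis using hyperplane_basis(2)[OF assms] by auto
  qed
  then show ?thesis
    unfolding hyperplane_lborel_def by (subst AE_distr_iff) auto
qed

text \<open>
  A unit vector \<open>v\<close> extends the basis of the hyperplane to an orthonormal basis of the whole space, so this is
  Fubini's theorem in the coordinates of that basis.
\<close>

theorem nn_integral_lborel_along_lines:
  fixes v :: "real^'n"
  assumes v: "norm v = 1" and g[measurable]: "g \<in> borel_measurable borel"
  shows "(\<integral>\<^sup>+x. g x \<partial>lborel) = (\<integral>\<^sup>+q. (\<integral>\<^sup>+t. g (q + t *\<^sub>R v) \<partial>lborel) \<partial>hyperplane_lborel v)"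
proof -
  let ?B = "hyperplane_basis v"
  have fin: "finite ?B" by (rule orthonormal_finite[OF hyperplane_basis(1)[OF v]])
  interpret product_sigma_finite "\<lambda>_::real^'n. lborel :: real measure" by standard
  have "(\<integral>\<^sup>+x. g x \<partial>lborel) = (\<integral>\<^sup>+x. g x \<partial>frame_lborel (insert v ?B))"
    by (simp only: frame_lborel_eq_lborel[OF hyperplane_basis(4,5)[OF v]])
  also have "\<dots> = (\<integral>\<^sup>+c. g (\<Sum>b\<in>insert v ?B. c b *\<^sub>R b) \<partial>PiM (insert v ?B) (\<lambda>_. lborel))"
    unfolding frame_lborel_def by (rule nn_integral_distr) auto
  also have "\<dots> = (\<integral>\<^sup>+c. (\<integral>\<^sup>+t. g (\<Sum>b\<in>insert v ?B. (c(v := t)) b *\<^sub>R b) \<partial>lborel) \<partial>PiM ?B (\<lambda>_. lborel))"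
    by (rule product_nn_integral_insert[OF fin hyperplane_basis(3)[OF v]]) measurable
  also have "\<dots> = (\<integral>\<^sup>+c. (\<integral>\<^sup>+t. g ((\<Sum>b\<in>?B. c b *\<^sub>R b) + t *\<^sub>R v) \<partial>lborel) \<partial>PiM ?B (\<lambda>_. lborel))"
  proof -
    have "(\<Sum>b\<in>insert v ?B. (c(v := t)) b *\<^sub>R b) = (\<Sum>b\<in>?B. c b *\<^sub>R b) + t *\<^sub>R v" for c t
    proof -
      have "(\<Sum>b\<in>?B. (c(v := t)) b *\<^sub>R b) = (\<Sum>b\<in>?B. c b *\<^sub>R b)"
        using hyperplane_basis(3)[OF v] by (intro sum.cong) auto
      then show ?thesis using fin hyperplane_basis(3)[OF v] by simp
    qed
    then show ?thesis by simp
  qed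
  also have "\<dots> = (\<integral>\<^sup>+q. (\<integral>\<^sup>+t. g (q + t *\<^sub>R v) \<partial>lborel) \<partial>hyperplane_lborel v)"
    unfolding hyperplane_lborel_def by (rule nn_integral_distr[symmetric]) measurable
  finally show ?thesis .
qed

text \<open>
  The measure of a subset of the hyperplane is the volume of the cylinder of height 1 over it. The right
  side mentions no basis; in this form the measure depends on \<open>v\<close> in a measurable way, although the choice of
  a basis does not.
\<close>

lemma emeasure_hyperplane_lborel:
  fixes v :: "real^'n"
  assumes v: "norm v = 1" and A[measurable]: "A \<in> sets borel"
  shows "emeasure (hyperplane_lborel v) A
    = (\<integral>\<^sup>+x. indicator {0..1} (x \<bullet> v) * indicator A (x - (x \<bullet> v) *\<^sub>R v) \<partial>lborel)"
proof -
  have "(\<integral>\<^sup>+x. indicator {0..1} (x \<bullet> v) * indicator A (x - (x \<bullet> v) *\<^sub>R v) \<partial>lborel)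
     = (\<integral>\<^sup>+q. (\<integral>\<^sup>+t. indicator {0..1} ((q + t *\<^sub>R v) \<bullet> v)
         * indicator A ((q + t *\<^sub>R v) - ((q + t *\<^sub>R v) \<bullet> v) *\<^sub>R v) \<partial>lborel) \<partial>hyperplane_lborel v)"
    by (rule nn_integral_lborel_along_lines[OF v]) measurable
  also have "\<dots> = (\<integral>\<^sup>+q. indicator A q \<partial>hyperplane_lborel v)"
  proof (rule nn_integral_cong_AE)
    show "AE q in hyperplane_lborel v. (\<integral>\<^sup>+t. indicator {0..1} ((q + t *\<^sub>R v) \<bullet> v)
         * indicator A ((q + t *\<^sub>R v) - ((q + t *\<^sub>R v) \<bullet> v) *\<^sub>R v) \<partial>lborel) = indicator A q"
      using AE_hyperplane_lborel[OF v]
    proof eventually_elim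
      case (elim q)
      have "(q + t *\<^sub>R v) \<bullet> v = t" for t
        using elim v by (simp add: inner_add_left inner_commute[of q] dot_square_norm)
      then show ?case by (simp add: nn_integral_multc)
    qed
  qed
  also have "\<dots> = emeasure (hyperplane_lborel v) A" by simp
  finally show ?thesis ..
qed

section \<open>The measure on directed lines\<close>

lemma sets_surface_measure[simp]: "sets surface_measure = sets (restrict_space borel (sphere 0 1))"
  by (simp add: surface_measure_def)

lemma space_surface_measure[simp]: "space surface_measure = sphere 0 1"
  using sets_eq_imp_space_eq[OF sets_surface_measure] by (simp add: space_restrict_space)

lemma closed_directed_lines: "closed (directed_lines :: ((real^'n) \<times> (real^'n)) set)"
proof -
  have *: "directed_lines = {z :: (real^'n) \<times> (real^'n). norm (fst z) = 1} \<inter> {z. fst z \<bullet> snd z = 0}"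
    by (auto simp: directed_lines_def)
  show ?thesis
    unfolding * by (intro closed_Int closed_Collect_eq continuous_intros)
qed

lemma sets_directed_lines:
  "sets (restrict_space borel directed_lines) = {E \<in> sets borel. E \<subseteq> (directed_lines :: ((real^'n) \<times> (real^'n)) set)}"
proof -
  have "directed_lines \<inter> space borel \<in> sets (borel :: ((real^'n) \<times> (real^'n)) measure)"
    using borel_closed[OF closed_directed_lines] by simp
  from sets_restrict_space_iff[OF this] show ?thesis by auto
qed

lemma sets_line_measure: "sets line_measure = {E \<in> sets borel. E \<subseteq> (directed_lines :: ((real^'n) \<times> (real^'n)) set)}"
  and space_line_measure[simp]: "space line_measure = (directed_lines :: ((real^'n) \<times> (real^'n)) set)"
proof -
  have "sigma_sets directed_lines (sets (restrict_space borel directed_lines)) = sets (restrict_space borel directed_lines)"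
    using sets.sigma_sets_eq[of "restrict_space borel directed_lines"] by (simp add: space_restrict_space)
  then show "sets line_measure = {E \<in> sets borel. E \<subseteq> (directed_lines :: ((real^'n) \<times> (real^'n)) set)}"
    unfolding line_measure_def sets_directed_lines[symmetric]
    by (subst sets_measure_of) (auto simp: sets_directed_lines)
  show "space line_measure = (directed_lines :: ((real^'n) \<times> (real^'n)) set)"
    unfolding line_measure_def by (rule space_measure_of) (auto simp: sets_directed_lines)
qed

lemma line_section_measurable:
  fixes E :: "((real^'n) \<times> (real^'n)) set"
  assumes "E \<in> sets borel"
  shows "{q. (v, q) \<in> E} \<in> sets borel"
proof -
  have "E \<in> sets (borel \<Otimes>\<^sub>M borel)" unfolding borel_prod by fact
  from sets_Pair1[OF this, of v] show ?thesis by (simp add: vimage_def)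
qed

lemma measurable_emeasure_hyperplane:
  fixes E :: "((real^'n) \<times> (real^'n)) set"
  assumes E: "E \<in> sets borel"
  shows "(\<lambda>v. emeasure (hyperplane_lborel v) {q. (v, q) \<in> E}) \<in> borel_measurable surface_measure"
proof -
  have [measurable]: "E \<in> sets (borel \<Otimes>\<^sub>M borel)" unfolding borel_prod by fact
  have "(\<lambda>v. \<integral>\<^sup>+x. indicator {0..1} (x \<bullet> v) * indicator E (v, x - (x \<bullet> v) *\<^sub>R v) \<partial>lborel)
      \<in> borel_measurable (borel :: (real^'n) measure)"
    by measurable
  then have "(\<lambda>v. \<integral>\<^sup>+x. indicator {0..1} (x \<bullet> v) * indicator E (v, x - (x \<bullet> v) *\<^sub>R v) \<partial>lborel)
      \<in> borel_measurable (restrict_space borel (sphere 0 1))"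
    by (rule measurable_restrict_space1)
  also have "borel_measurable (restrict_space borel (sphere 0 1)) = (borel_measurable surface_measure :: (real^'n \<Rightarrow> ennreal) set)"
    by (rule measurable_cong_sets) auto
  finally show ?thesis
  proof (subst measurable_cong)
    fix v :: "real^'n" assume "v \<in> space surface_measure"
    then have v: "norm v = 1" by simp
    show "emeasure (hyperplane_lborel v) {q. (v, q) \<in> E} =
      (\<integral>\<^sup>+x. indicator {0..1} (x \<bullet> v) * indicator E (v, x - (x \<bullet> v) *\<^sub>R v) \<partial>lborel)"
      unfolding emeasure_hyperplane_lborel[OF v line_section_measurable[OF E]]
      by (intro nn_integral_cong) (auto simp: indicator_def)
  qed
qed

text \<open>
  The point is that the set function defining \<open>line_measure\<close> is countably additive. This needs integrands
  that are measurable in \<open>v\<close>.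
\<close>

theorem emeasure_line_measure:
  fixes E :: "((real^'n) \<times> (real^'n)) set"
  assumes E: "E \<in> sets borel" "E \<subseteq> directed_lines"
  shows "emeasure line_measure E = (\<integral>\<^sup>+v. emeasure (hyperplane_lborel v) {q. (v, q) \<in> E} \<partial>surface_measure)"
proof (rule emeasure_measure_of[OF line_measure_def])
  show "sets (restrict_space borel directed_lines) \<subseteq> Pow (directed_lines :: ((real^'n) \<times> (real^'n)) set)"
    by (auto simp: sets_directed_lines)
  show "E \<in> sets line_measure" using E by (simp add: sets_line_measure)
  show "positive (sets line_measure) (\<lambda>E::((real^'n) \<times> (real^'n)) set. \<integral>\<^sup>+v. emeasure (hyperplane_lborel v) {q. (v, q) \<in> E} \<partial>surface_measure)"
    by (simp add: positive_def)
  show "countably_additive (sets line_measure) (\<lambda>E::((real^'n) \<times> (real^'n)) set. \<integral>\<^sup>+v. emeasure (hyperplane_lborel v) {q. (v, q) \<in> E} \<partial>surface_measure)"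
  proof (rule countably_additiveI)
    fix A :: "nat \<Rightarrow> ((real^'n) \<times> (real^'n)) set"
    assume A: "range A \<subseteq> sets line_measure" "disjoint_family A"
    have Ab: "A i \<in> sets borel" for i using A(1) by (auto simp: sets_line_measure)
    have "(\<Sum>i. \<integral>\<^sup>+v. emeasure (hyperplane_lborel v) {q. (v, q) \<in> A i} \<partial>surface_measure)
       = (\<integral>\<^sup>+v. (\<Sum>i. emeasure (hyperplane_lborel v) {q. (v, q) \<in> A i}) \<partial>surface_measure)"
      by (rule nn_integral_suminf[symmetric]) (rule measurable_emeasure_hyperplane[OF Ab])
    also have "\<dots> = (\<integral>\<^sup>+v. emeasure (hyperplane_lborel v) {q. (v, q) \<in> (\<Union>i. A i)} \<partial>surface_measure)"
    proof (rule nn_integral_cong)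
      fix v :: "real^'n"
      have "(\<Sum>i. emeasure (hyperplane_lborel v) {q. (v, q) \<in> A i}) = emeasure (hyperplane_lborel v) (\<Union>i. {q. (v, q) \<in> A i})"
        using A(2) by (intro suminf_emeasure) (auto simp: disjoint_family_on_def line_section_measurable[OF Ab])
      also have "(\<Union>i. {q. (v, q) \<in> A i}) = {q. (v, q) \<in> (\<Union>i. A i)}" by auto
      finally show "(\<Sum>i. emeasure (hyperplane_lborel v) {q. (v, q) \<in> A i})
        = emeasure (hyperplane_lborel v) {q. (v, q) \<in> (\<Union>i. A i)}" .
    qed
    finally show "(\<Sum>i. \<integral>\<^sup>+v. emeasure (hyperplane_lborel v) {q. (v, q) \<in> A i} \<partial>surface_measure)
       = (\<integral>\<^sup>+v. emeasure (hyperplane_lborel v) {q. (v, q) \<in> (\<Union>i. A i)} \<partial>surface_measure)" .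
  qed
qed

section \<open>Chords of a box in a fixed direction\<close>

text \<open>
  The intersection of a box with its translate is a box again, possibly empty.
\<close>

lemma emeasure_box_inter_translate:
  fixes l u v :: "real^'n"
  assumes lu: "\<And>i. l $ i \<le> u $ i" and "0 \<le> x"
  shows "emeasure lborel {p. p \<in> cbox l u \<and> p + x *\<^sub>R v \<in> cbox l u}
    = ennreal (\<Prod>i\<in>UNIV. max 0 (u $ i - l $ i - x * \<bar>v $ i\<bar>))"
proof -
  define l' where "l' = (\<chi> i. l $ i + max 0 (- (x * v $ i)))"
  define u' where "u' = (\<chi> i. u $ i - max 0 (x * v $ i))"
  have eq: "{p. p \<in> cbox l u \<and> p + x *\<^sub>R v \<in> cbox l u} = cbox l' u'"
  proof -
    have "(l $ i \<le> p $ i \<and> p $ i \<le> u $ i) \<and> (l $ i \<le> p $ i + x * v $ i \<and> p $ i + x * v $ i \<le> u $ i)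
      \<longleftrightarrow> l' $ i \<le> p $ i \<and> p $ i \<le> u' $ i" for p :: "real^'n" and i
      unfolding l'_def u'_def vec_lambda_beta by linarith
    then show ?thesis by (auto simp: mem_box_cart) blast+
  qed
  have d: "u' $ i - l' $ i = u $ i - l $ i - x * \<bar>v $ i\<bar>" for i
  proof (cases "0 \<le> v $ i")
    case True
    then have "0 \<le> x * v $ i" using \<open>0 \<le> x\<close> by simp
    with True show ?thesis by (auto simp: l'_def u'_def max_def)
  next
    case False
    then have "x * v $ i \<le> 0" using \<open>0 \<le> x\<close> by (simp add: mult_nonneg_nonpos)
    with False show ?thesis by (auto simp: l'_def u'_def max_def)
  qed
  have "emeasure lborel (cbox l' u') = ennreal (measure lborel (cbox l' u'))"
    by (rule emeasure_eq_ennreal_measure) (use emeasure_lborel_cbox_finite[of l' u'] in auto)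
  also have "measure lborel (cbox l' u') = (\<Prod>i\<in>UNIV. max 0 (u $ i - l $ i - x * \<bar>v $ i\<bar>))"
  proof (cases "cbox l' u' = {}")
    case True
    then obtain i where "u' $ i < l' $ i" by (auto simp: interval_eq_empty_cart(2))
    with d[of i] have "max 0 (u $ i - l $ i - x * \<bar>v $ i\<bar>) = 0" by simp
    then have "(\<Prod>i\<in>UNIV. max 0 (u $ i - l $ i - x * \<bar>v $ i\<bar>)) = 0" by (intro prod_zero) auto
    with True show ?thesis by simp
  next
    case False
    then have le: "l' $ i \<le> u' $ i" for i by (auto simp: interval_eq_empty_cart(2) not_less)
    have "max 0 (u $ i - l $ i - x * \<bar>v $ i\<bar>) = u' $ i - l' $ i" for i
      using le[of i] unfolding d[of i, symmetric] by simp
    with False show ?thesis by (simp add: content_cbox_cart)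
  qed
  finally show ?thesis unfolding eq .
qed

text \<open>
  In contrast to \<open>chord_length\<close> the set is arbitrary, because boxes slightly larger than the given one
  are needed as well.
\<close>

definition chord :: "(real^'n) set \<Rightarrow> real^'n \<Rightarrow> real^'n \<Rightarrow> real" where
  "chord K v q = measure lborel {t. q + t *\<^sub>R v \<in> K}"

lemma emeasure_interval_inter_translate:
  fixes I :: "real set"
  assumes I: "compact I" "connected I" and "0 \<le> x"
  shows "emeasure lborel {t. t \<in> I \<and> t + x \<in> I} = ennreal (max 0 (measure lborel I - x))"
proof -
  obtain \<alpha> \<beta> where ab: "I = {\<alpha>..\<beta>}"
    using I by (metis connected_compact_interval_1 interval_cbox)
  have "{t. t \<in> I \<and> t + x \<in> I} = {\<alpha>..\<beta> - x}" using \<open>0 \<le> x\<close> by (auto simp: ab)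
  then show ?thesis using \<open>0 \<le> x\<close> by (auto simp: ab max_def)
qed

lemma line_inter_compact_convex:
  fixes K :: "(real^'n) set"
  assumes K: "compact K" "convex K" and v: "norm v = 1"
  shows "compact {t. q + t *\<^sub>R v \<in> K}" "connected {t. q + t *\<^sub>R v \<in> K}"
proof -
  let ?I = "{t. q + t *\<^sub>R v \<in> K}"
  have eq: "?I = (\<lambda>t. q + t *\<^sub>R v) -` K" by auto
  have "closed ?I"
    unfolding eq by (intro continuous_closed_vimage compact_imp_closed[OF K(1)] continuous_intros)
  moreover have "bounded ?I"
  proof -
    obtain b where b: "\<And>y. y \<in> K \<Longrightarrow> norm y \<le> b"
      using compact_imp_bounded[OF K(1)] by (auto simp: bounded_iff)
    have "\<bar>t\<bar> \<le> b + norm q" if "t \<in> ?I" for t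
    proof -
      have "\<bar>t\<bar> = norm ((q + t *\<^sub>R v) - q)" using v by simp
      also have "\<dots> \<le> b + norm q" using b[of "q + t *\<^sub>R v"] that by (intro order_trans[OF norm_triangle_ineq4]) auto
      finally show ?thesis .
    qed
    then show ?thesis by (auto simp: bounded_iff)
  qed
  ultimately show "compact ?I" by (simp add: compact_eq_bounded_closed)
  have "convex ?I"
  proof (rule convexI)
    fix s t a b :: real assume "s \<in> ?I" "t \<in> ?I" and ab: "0 \<le> a" "0 \<le> b" "a + b = 1"
    then have "a *\<^sub>R (q + s *\<^sub>R v) + b *\<^sub>R (q + t *\<^sub>R v) \<in> K"
      using K(2) by (intro convexD) auto
    also have "a *\<^sub>R (q + s *\<^sub>R v) + b *\<^sub>R (q + t *\<^sub>R v) = (a + b) *\<^sub>R q + (a * s + b * t) *\<^sub>R v"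
      by (simp add: algebra_simps)
    finally show "a *\<^sub>R s + b *\<^sub>R t \<in> ?I" using ab by simp
  qed
  then show "connected ?I" by (rule convex_connected)
qed

lemma chord_measurable:
  fixes K :: "(real^'n) set"
  assumes [measurable]: "K \<in> sets borel"
  shows "(\<lambda>z. chord K (fst z) (snd z)) \<in> borel_measurable borel"
proof -
  have eq: "chord K v q = enn2real (\<integral>\<^sup>+t. indicator K (q + t *\<^sub>R v) \<partial>lborel)" for v q
  proof -
    have "(\<integral>\<^sup>+t. indicator K (q + t *\<^sub>R v) \<partial>lborel) = (\<integral>\<^sup>+t. indicator {t. q + t *\<^sub>R v \<in> K} t \<partial>lborel)"
      by (rule nn_integral_cong) (auto simp: indicator_def)
    also have "\<dots> = emeasure lborel {t. q + t *\<^sub>R v \<in> K}"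
      by (rule nn_integral_indicator) measurable
    finally show ?thesis by (simp add: chord_def measure_def)
  qed
  have "(\<lambda>z. enn2real (\<integral>\<^sup>+t. indicator K (snd z + t *\<^sub>R fst z) \<partial>lborel)) \<in> borel_measurable (borel \<Otimes>\<^sub>M (borel :: (real^'n) measure))"
    by measurable
  then show ?thesis unfolding eq borel_prod .
qed

lemma chord_section_measurable:
  fixes K :: "(real^'n) set"
  assumes "K \<in> sets borel"
  shows "chord K v \<in> borel_measurable borel"
proof -
  have "(\<lambda>q. (\<lambda>z. chord K (fst z) (snd z)) (v, q)) \<in> borel_measurable borel"
    by (rule measurable_compose[OF _ chord_measurable[OF assms]]) (simp add: borel_prod[symmetric])
  then show ?thesis by simp
qed

text \<open>
  On a line meeting the box in an interval \<open>I\<close>, the parameters \<open>t\<close> with \<open>t\<close> and \<open>t + x\<close> in \<open>I\<close> form a set of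
  measure \<open>max 0 (chord - x)\<close>. Integrating over all parallel lines gives the volume of the points that
  stay in the box when translated by \<open>x v\<close>.
\<close>

lemma nn_integral_excess_chord:
  fixes l u v :: "real^'n"
  assumes v: "norm v = 1" and lu: "\<And>i. l $ i \<le> u $ i" and x: "0 \<le> x"
  shows "(\<integral>\<^sup>+q. ennreal (max 0 (chord (cbox l u) v q - x)) \<partial>hyperplane_lborel v)
    = ennreal (\<Prod>i\<in>UNIV. max 0 (u $ i - l $ i - x * \<bar>v $ i\<bar>))"
proof -
  let ?K = "cbox l u"
  have [measurable]: "?K \<in> sets borel" by simp
  have "ennreal (\<Prod>i\<in>UNIV. max 0 (u $ i - l $ i - x * \<bar>v $ i\<bar>))
      = (\<integral>\<^sup>+p. indicator {p. p \<in> ?K \<and> p + x *\<^sub>R v \<in> ?K} p \<partial>lborel)"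
    by (subst nn_integral_indicator) (simp_all add: emeasure_box_inter_translate[OF lu x])
  also have "\<dots> = (\<integral>\<^sup>+q. (\<integral>\<^sup>+t. indicator {p. p \<in> ?K \<and> p + x *\<^sub>R v \<in> ?K} (q + t *\<^sub>R v) \<partial>lborel) \<partial>hyperplane_lborel v)"
    by (rule nn_integral_lborel_along_lines[OF v]) measurable
  also have "\<dots> = (\<integral>\<^sup>+q. ennreal (max 0 (chord ?K v q - x)) \<partial>hyperplane_lborel v)"
  proof (rule nn_integral_cong)
    fix q :: "real^'n"
    let ?I = "{t. q + t *\<^sub>R v \<in> ?K}"
    have I: "compact ?I" "connected ?I"
      by (rule line_inter_compact_convex[OF compact_cbox convex_box(1) v])+
    have "(\<integral>\<^sup>+t. indicator {p. p \<in> ?K \<and> p + x *\<^sub>R v \<in> ?K} (q + t *\<^sub>R v) \<partial>lborel)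
        = (\<integral>\<^sup>+t. indicator {t. t \<in> ?I \<and> t + x \<in> ?I} t \<partial>lborel)"
      by (rule nn_integral_cong) (auto simp: indicator_def algebra_simps)
    also have "\<dots> = emeasure lborel {t. t \<in> ?I \<and> t + x \<in> ?I}"
      by (rule nn_integral_indicator) measurable
    also have "\<dots> = ennreal (max 0 (chord ?K v q - x))"
      unfolding chord_def by (rule emeasure_interval_inter_translate[OF I x])
    finally show "(\<integral>\<^sup>+t. indicator {p. p \<in> ?K \<and> p + x *\<^sub>R v \<in> ?K} (q + t *\<^sub>R v) \<partial>lborel)
      = ennreal (max 0 (chord ?K v q - x))" .
  qed
  finally show ?thesis ..
qed

text \<open>
  These are the two inequalities required for the squeeze by difference quotients, with \<open>\<lambda>x. - W x\<close> as
  primitive of \<open>c\<close>. They rest on the pointwise bounds of \<open>max 0 (h - x) - max 0 (h - y)\<close> by \<open>y - x\<close> times the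
  indicators of \<open>y < h\<close> and \<open>x < h\<close>.
\<close>

lemma long_chords_bounds:
  fixes l u v :: "real^'n"
  assumes v: "norm v = 1" and lu: "\<And>i. l $ i \<le> u $ i" and xy: "0 \<le> x" "x < y"
  defines "W \<equiv> \<lambda>x. \<Prod>i\<in>UNIV. max 0 (u $ i - l $ i - x * \<bar>v $ i\<bar>)"
    and "c \<equiv> \<lambda>x. emeasure (hyperplane_lborel v) {q. x < chord (cbox l u) v q}"
  shows "ennreal (y - x) * c y + ennreal (W y) \<le> ennreal (W x)"
    and "ennreal (W x) \<le> ennreal (y - x) * c x + ennreal (W y)"
proof -
  let ?h = "chord (cbox l u) v"
  let ?H = "hyperplane_lborel v"
  have [measurable]: "?h \<in> borel_measurable borel" by (rule chord_section_measurable) simp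
  have "ennreal (y - x) * c y + ennreal (W y)
      = (\<integral>\<^sup>+q. ennreal (y - x) * indicator {q. y < ?h q} q + ennreal (max 0 (?h q - y)) \<partial>?H)"
    unfolding c_def W_def using nn_integral_excess_chord[OF v lu, of y] xy
    by (subst nn_integral_add) (auto simp: nn_integral_cmult_indicator)
  also have "\<dots> \<le> (\<integral>\<^sup>+q. ennreal (max 0 (?h q - x)) \<partial>?H)"
  proof (rule nn_integral_mono)
    fix q
    show "ennreal (y - x) * indicator {q. y < ?h q} q + ennreal (max 0 (?h q - y)) \<le> ennreal (max 0 (?h q - x))"
    proof (cases "y < ?h q")
      case True
      then have "ennreal (y - x) + ennreal (max 0 (?h q - y)) = ennreal (max 0 (?h q - x))"
        using xy by (subst ennreal_plus[symmetric]) auto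
      with True show ?thesis by simp
    qed simp
  qed
  also have "\<dots> = ennreal (W x)"
    unfolding W_def by (rule nn_integral_excess_chord[OF v lu xy(1)])
  finally show "ennreal (y - x) * c y + ennreal (W y) \<le> ennreal (W x)" .
  have "ennreal (W x) = (\<integral>\<^sup>+q. ennreal (max 0 (?h q - x)) \<partial>?H)"
    unfolding W_def by (rule nn_integral_excess_chord[OF v lu xy(1), symmetric])
  also have "\<dots> \<le> (\<integral>\<^sup>+q. ennreal (y - x) * indicator {q. x < ?h q} q + ennreal (max 0 (?h q - y)) \<partial>?H)"
  proof (rule nn_integral_mono)
    fix q
    show "ennreal (max 0 (?h q - x)) \<le> ennreal (y - x) * indicator {q. x < ?h q} q + ennreal (max 0 (?h q - y))"
    proof (cases "x < ?h q")
      case True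
      have "ennreal (max 0 (?h q - x)) \<le> ennreal ((y - x) + max 0 (?h q - y))"
        using xy True by (intro ennreal_leI) auto
      also have "\<dots> = ennreal (y - x) + ennreal (max 0 (?h q - y))"
        using xy by (intro ennreal_plus) auto
      finally show ?thesis using True by simp
    qed simp
  qed
  also have "\<dots> = ennreal (y - x) * c x + ennreal (W y)"
    unfolding c_def W_def using nn_integral_excess_chord[OF v lu, of y] xy
    by (subst nn_integral_add) (auto simp: nn_integral_cmult_indicator)
  finally show "ennreal (W x) \<le> ennreal (y - x) * c x + ennreal (W y)" .
qed

definition meets_box :: "real^'n \<Rightarrow> ((real^'n) \<times> (real^'n)) set" where
  "meets_box a = {l \<in> directed_lines. points_of_line l \<inter> cbox 0 a \<noteq> {}}"

text \<open>
  A line meeting the box in \<open>y\<close> has base point \<open>y - (v \<bullet> y) v\<close>, so the lines in question are a continuous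
  image of a compact set of pairs \<open>(v, y)\<close>. In particular they form a Borel set.
\<close>

lemma compact_meets_box: "compact (meets_box (a :: real^'n))"
proof -
  have "meets_box a = (\<lambda>(v, y). (v, y - (v \<bullet> y) *\<^sub>R v)) ` (sphere 0 1 \<times> cbox 0 a)"
  proof (intro set_eqI iffI)
    fix l assume "l \<in> meets_box a"
    then obtain v q t where l: "l = (v, q)" "norm v = 1" "v \<bullet> q = 0" "q + t *\<^sub>R v \<in> cbox 0 a"
      by (auto simp: meets_box_def directed_lines_def points_of_line_def)
    then have "l = (\<lambda>(v, y). (v, y - (v \<bullet> y) *\<^sub>R v)) (v, q + t *\<^sub>R v)"
      by (simp add: inner_add_right dot_square_norm)
    then show "l \<in> (\<lambda>(v, y). (v, y - (v \<bullet> y) *\<^sub>R v)) ` (sphere 0 1 \<times> cbox 0 a)"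
      using l by (intro image_eqI) auto
  next
    fix l assume "l \<in> (\<lambda>(v, y). (v, y - (v \<bullet> y) *\<^sub>R v)) ` (sphere 0 1 \<times> cbox 0 a)"
    then obtain v y where l: "l = (v, y - (v \<bullet> y) *\<^sub>R v)" "norm v = 1" "y \<in> cbox 0 a" by auto
    have "y = (y - (v \<bullet> y) *\<^sub>R v) + (v \<bullet> y) *\<^sub>R v" by simp
    then have "y \<in> points_of_line l" unfolding points_of_line_def l(1) prod.case by (rule range_eqI)
    with l show "l \<in> meets_box a"
      by (auto simp: meets_box_def directed_lines_def inner_diff_right dot_square_norm)
  qed
  moreover have "compact (\<dots>)"
  proof (rule compact_continuous_image)
    show "continuous_on (sphere 0 1 \<times> cbox 0 a) (\<lambda>(v :: real^'n, y). (v, y - (v \<bullet> y) *\<^sub>R v))"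
      unfolding split_beta by (intro continuous_intros)
    show "compact (sphere (0 :: real^'n) 1 \<times> cbox 0 a)"
      by (intro compact_Times compact_sphere compact_cbox)
  qed
  ultimately show ?thesis by simp
qed

lemma chord_pos_imp_meets:
  assumes "0 < chord (cbox 0 a) v q" "norm v = 1" "v \<bullet> q = 0"
  shows "(v, q) \<in> meets_box a"
proof -
  have "{t. q + t *\<^sub>R v \<in> cbox 0 a} \<noteq> {}"
  proof
    assume empty: "{t. q + t *\<^sub>R v \<in> cbox 0 a} = {}"
    have "chord (cbox 0 a) v q = 0" unfolding chord_def empty by simp
    with assms(1) show False by simp
  qed
  then obtain t where t: "q + t *\<^sub>R v \<in> cbox 0 a" by auto
  then have "q + t *\<^sub>R v \<in> points_of_line (v, q) \<inter> cbox 0 a" by (auto simp: points_of_line_def)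
  then show ?thesis using assms(2,3) by (auto simp: meets_box_def directed_lines_def)
qed

text \<open>
  The base points of the lines of direction \<open>v\<close> that meet the box in a chord longer than \<open>x\<close>. For negative
  \<open>x\<close> these are all lines meeting the box, including those that only touch it.
\<close>

definition long_chords :: "real^'n \<Rightarrow> real \<Rightarrow> real^'n \<Rightarrow> (real^'n) set" where
  "long_chords a x v = {q. (v, q) \<in> meets_box a \<and> x < chord (cbox 0 a) v q}"

lemma long_chords_measurable[measurable]: "long_chords a x v \<in> sets borel"
proof -
  have "{q. (v, q) \<in> meets_box a} \<in> sets borel"
    by (intro line_section_measurable borel_closed compact_imp_closed compact_meets_box)
  moreover have "{q. x < chord (cbox 0 a) v q} \<in> sets borel"
    using chord_section_measurable[of "cbox 0 a" v] by measurable
  ultimately have "{q. (v, q) \<in> meets_box a} \<inter> {q. x < chord (cbox 0 a) v q} \<in> sets borel" by (rule sets.Int)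
  then show ?thesis by (simp add: long_chords_def Collect_conj_eq)
qed

lemma emeasure_long_chords_nonneg:
  fixes v :: "real^'n"
  assumes v: "norm v = 1" and "0 \<le> x"
  shows "emeasure (hyperplane_lborel v) (long_chords a x v)
    = emeasure (hyperplane_lborel v) {q. x < chord (cbox 0 a) v q}"
proof (rule emeasure_eq_AE)
  have m: "{q. x < chord (cbox 0 a) v q} \<in> sets borel"
    using chord_section_measurable[of "cbox 0 a" v] by measurable
  show "long_chords a x v \<in> sets (hyperplane_lborel v)" "{q. x < chord (cbox 0 a) v q} \<in> sets (hyperplane_lborel v)"
    using m long_chords_measurable by simp_all
  show "AE q in hyperplane_lborel v. q \<in> long_chords a x v \<longleftrightarrow> q \<in> {q. x < chord (cbox 0 a) v q}"
    using AE_hyperplane_lborel[OF v]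
    by eventually_elim (use chord_pos_imp_meets[of a v] v \<open>0 \<le> x\<close> in \<open>auto simp: long_chords_def\<close>)
qed

text \<open>
  Lines that touch the box in a single point contribute no volume, so bounding their measure needs another
  argument. A line meeting the box has a chord of length at least \<open>2 * e\<close> in the box enlarged by \<open>e\<close> on all
  sides, and long chords of the larger box are controlled by a difference quotient of its primitive.
\<close>

lemma emeasure_long_chords_le_shell:
  fixes a v :: "real^'n"
  assumes a: "\<And>i. 0 < a $ i" and v: "norm v = 1" and e: "0 < e"
  shows "emeasure (hyperplane_lborel v) (long_chords a x v)
    \<le> ennreal (((\<Prod>i\<in>UNIV. a $ i + 2 * e) - (\<Prod>i\<in>UNIV. max 0 (a $ i + 2 * e - e * \<bar>v $ i\<bar>))) / e)"
proof -
  \<comment> \<open>The box between l and u is the given one, enlarged by e on all sides.\<close>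
  define l :: "real^'n" where "l = (\<chi> i. - e)"
  define u where "u = (\<chi> i. a $ i + e)"
  have lu: "l $ i \<le> u $ i" for i using a[of i] e by (simp add: l_def u_def)
  define W where "W = (\<lambda>x. \<Prod>i\<in>UNIV. max 0 (u $ i - l $ i - x * \<bar>v $ i\<bar>))"
  have W: "W 0 = (\<Prod>i\<in>UNIV. a $ i + 2 * e)" "W e = (\<Prod>i\<in>UNIV. max 0 (a $ i + 2 * e - e * \<bar>v $ i\<bar>))"
  proof -
    have d: "u $ i - l $ i = a $ i + 2 * e" for i by (simp add: u_def l_def)
    have "max 0 (a $ i + 2 * e - 0 * \<bar>v $ i\<bar>) = a $ i + 2 * e" for i
      using a[of i] e by simp
    then show "W 0 = (\<Prod>i\<in>UNIV. a $ i + 2 * e)" by (simp only: W_def d)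
    show "W e = (\<Prod>i\<in>UNIV. max 0 (a $ i + 2 * e - e * \<bar>v $ i\<bar>))" by (simp only: W_def d)
  qed
  let ?c = "emeasure (hyperplane_lborel v) {q. e < chord (cbox l u) v q}"
  have "long_chords a x v \<subseteq> {q. e < chord (cbox l u) v q}"
  proof
    fix q assume "q \<in> long_chords a x v"
    then obtain t where t: "q + t *\<^sub>R v \<in> cbox 0 a"
      by (auto simp: long_chords_def meets_box_def points_of_line_def)
    have "{t - e..t + e} \<subseteq> {s. q + s *\<^sub>R v \<in> cbox l u}"
    proof
      fix s assume s: "s \<in> {t - e..t + e}"
      have "- e \<le> (s - t) * v $ i \<and> (s - t) * v $ i \<le> e" for i
      proof -
        have "\<bar>v $ i\<bar> \<le> 1" using component_le_norm_cart[of v i] v by simp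
        moreover have "\<bar>s - t\<bar> \<le> e" using s by auto
        ultimately have "\<bar>s - t\<bar> * \<bar>v $ i\<bar> \<le> e * 1" using e by (intro mult_mono) auto
        then have "\<bar>(s - t) * v $ i\<bar> \<le> e" by (simp add: abs_mult)
        then show ?thesis by linarith
      qed
      moreover have "(q + s *\<^sub>R v) $ i = (q + t *\<^sub>R v) $ i + (s - t) * v $ i" for i
        by (simp add: algebra_simps)
      moreover have "0 \<le> (q + t *\<^sub>R v) $ i \<and> (q + t *\<^sub>R v) $ i \<le> a $ i" for i
        using t by (auto simp: mem_box_cart)
      ultimately have "- e \<le> (q + s *\<^sub>R v) $ i \<and> (q + s *\<^sub>R v) $ i \<le> a $ i + e" for i
        by (smt (verit))
      then show "s \<in> {s. q + s *\<^sub>R v \<in> cbox l u}" by (auto simp: mem_box_cart l_def u_def)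
    qed
    moreover have cpt: "compact {s. q + s *\<^sub>R v \<in> cbox l u}"
      by (rule line_inter_compact_convex(1)[OF compact_cbox convex_box(1) v])
    moreover have "{s. q + s *\<^sub>R v \<in> cbox l u} \<in> fmeasurable lborel"
      using emeasure_compact_finite[OF cpt] borel_compact[OF cpt] by (simp add: fmeasurable_def)
    ultimately have "measure lborel {t - e..t + e} \<le> chord (cbox l u) v q"
      unfolding chord_def
      by (intro measure_mono_fmeasurable) auto
    with e show "q \<in> {q. e < chord (cbox l u) v q}" by simp
  qed
  then have "emeasure (hyperplane_lborel v) (long_chords a x v) \<le> ?c"
  proof (rule emeasure_mono)
    have "chord (cbox l u) v \<in> borel_measurable borel" by (rule chord_section_measurable) simp
    then show "{q. e < chord (cbox l u) v q} \<in> sets (hyperplane_lborel v)" by measurable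
  qed
  also have "?c \<le> ennreal ((W 0 - W e) / e)"
  proof -
    have "ennreal (e - 0) * ?c + ennreal (W e) \<le> ennreal (W 0)"
      unfolding W_def by (rule long_chords_bounds(1)[OF v lu]) (use e in auto)
    then have b: "ennreal e * ?c + ennreal (W e) \<le> ennreal (W 0)" by simp
    have "ennreal e * ?c \<le> ennreal e * ?c + ennreal (W e)" by simp
    also note b
    also have "ennreal (W 0) < \<top>" by simp
    finally have "ennreal e * ?c < \<top>" .
    then have "?c \<noteq> \<top>" using e by (auto simp: ennreal_mult_less_top)
    then obtain r where r: "?c = ennreal r" "0 \<le> r" by (cases ?c) auto
    have "0 \<le> W e" by (simp add: W_def prod_nonneg)
    with b r e have "e * r + W e \<le> W 0"
      by (simp add: ennreal_mult[symmetric] ennreal_plus[symmetric] W_def prod_nonneg del: ennreal_plus)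
    then have "r \<le> (W 0 - W e) / e" using e by (simp add: field_simps)
    with r show ?thesis by (simp add: ennreal_leI)
  qed
  finally show ?thesis unfolding W .
qed

text \<open>
  The quotient tends to the measure of the shadow of the box in the direction with components of absolute
  value \<open>w i\<close>, which is the sum over the faces of the area times the cosine.
\<close>

lemma shell_volume_tendsto:
  fixes a w :: "'n::finite \<Rightarrow> real"
  assumes a: "\<And>i. 0 < a i"
  shows "((\<lambda>e. ((\<Prod>i\<in>UNIV. a i + 2 * e) - (\<Prod>i\<in>UNIV. max 0 (a i + 2 * e - e * w i))) / e)
    \<longlongrightarrow> (\<Prod>i\<in>UNIV. a i) * (\<Sum>i\<in>UNIV. w i / a i)) (at_right 0)"
proof -
  have ne: "a i \<noteq> 0" for i using a[of i] by simp
  have D1: "((\<lambda>e. \<Prod>i\<in>UNIV. a i + 2 * e) has_real_derivative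
      (\<Prod>i\<in>UNIV. a i + 2 * 0) * (\<Sum>i\<in>UNIV. 2 / (a i + 2 * 0))) (at 0)"
    by (rule has_field_derivative_prod') (auto intro!: derivative_eq_intros simp: ne)
  have D2: "((\<lambda>e. \<Prod>i\<in>UNIV. a i + 2 * e - e * w i) has_real_derivative
      (\<Prod>i\<in>UNIV. a i + 2 * 0 - 0 * w i) * (\<Sum>i\<in>UNIV. (2 - w i) / (a i + 2 * 0 - 0 * w i))) (at 0)"
    by (rule has_field_derivative_prod') (auto intro!: derivative_eq_intros simp: ne)
  have sm: "(\<Sum>i\<in>UNIV. 2 / a i) - (\<Sum>i\<in>UNIV. (2 - w i) / a i) = (\<Sum>i\<in>UNIV. w i / a i)"
    by (simp add: sum_subtractf[symmetric] diff_divide_distrib)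
  have "((\<lambda>e. (\<Prod>i\<in>UNIV. a i + 2 * e) - (\<Prod>i\<in>UNIV. a i + 2 * e - e * w i)) has_real_derivative
      (\<Prod>i\<in>UNIV. a i) * (\<Sum>i\<in>UNIV. w i / a i)) (at 0)"
    using DERIV_diff[OF D1 D2] by (simp add: right_diff_distrib[symmetric] sm)
  then have "((\<lambda>e. ((\<Prod>i\<in>UNIV. a i + 2 * e) - (\<Prod>i\<in>UNIV. a i + 2 * e - e * w i)) / e)
      \<longlongrightarrow> (\<Prod>i\<in>UNIV. a i) * (\<Sum>i\<in>UNIV. w i / a i)) (at 0)"
    by (simp add: has_field_derivative_iff)
  then have lim: "((\<lambda>e. ((\<Prod>i\<in>UNIV. a i + 2 * e) - (\<Prod>i\<in>UNIV. a i + 2 * e - e * w i)) / e)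
      \<longlongrightarrow> (\<Prod>i\<in>UNIV. a i) * (\<Sum>i\<in>UNIV. w i / a i)) (at_right 0)"
    by (rule filterlim_mono[OF _ order_refl at_le]) auto
  have "\<forall>\<^sub>F e in at_right 0. \<forall>i. 0 < a i + 2 * e - e * w i"
  proof (rule eventually_all_finite)
    fix i
    have "((\<lambda>e. a i + 2 * e - e * w i) \<longlongrightarrow> a i + 2 * 0 - 0 * w i) (at_right 0)" by (intro tendsto_intros)
    then show "\<forall>\<^sub>F e in at_right 0. 0 < a i + 2 * e - e * w i" using a[of i] by (elim order_tendstoD(1)) simp
  qed
  then have "\<forall>\<^sub>F e in at_right 0. ((\<Prod>i\<in>UNIV. a i + 2 * e) - (\<Prod>i\<in>UNIV. a i + 2 * e - e * w i)) / e
      = ((\<Prod>i\<in>UNIV. a i + 2 * e) - (\<Prod>i\<in>UNIV. max 0 (a i + 2 * e - e * w i))) / e"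
    by eventually_elim (simp add: max_def less_imp_le)
  with lim show ?thesis by (rule Lim_transform_eventually)
qed

text \<open>
  The chords of a fixed direction obey the same law as the flights of a particle with that direction,
  because \<open>long_chords_bounds\<close> provides the same primitive up to the volume of the box.
\<close>

theorem long_chords_rate:
  fixes a v :: "real^'n"
  assumes a: "\<And>i. 0 < a $ i" and v: "norm v = 1" "\<And>i. v $ i \<noteq> 0"
    and ne: "\<And>i. x * (\<bar>v $ i\<bar> / a $ i) \<noteq> 1"
  shows "emeasure (hyperplane_lborel v) (long_chords a x v)
    = ennreal ((\<Prod>i\<in>UNIV. a $ i) * flight_rate (\<lambda>i. \<bar>v $ i\<bar> / a $ i) x)"
proof -
  define \<beta> where "\<beta> = (\<lambda>i. \<bar>v $ i\<bar> / a $ i)"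
  define V where "V = (\<Prod>i\<in>UNIV. a $ i)"
  have V: "0 < V" unfolding V_def using a by (intro prod_pos) auto
  have \<beta>: "0 < \<beta> i" for i using a v by (simp add: \<beta>_def)
  let ?H = "hyperplane_lborel v"
  define W where "W = (\<lambda>x. \<Prod>i\<in>UNIV. max 0 (a $ i - 0 $ i - x * \<bar>v $ i\<bar>))"
  have W: "W y = V * free_fraction \<beta> y" for y
  proof -
    have "max 0 (a $ i - 0 $ i - y * \<bar>v $ i\<bar>) = a $ i * max 0 (1 - y * \<beta> i)" for i
      using a[of i] by (auto simp: \<beta>_def max_def field_simps)
    then show ?thesis by (simp add: W_def V_def free_fraction_def prod.distrib)
  qed
  have fin: "emeasure ?H (long_chords a y v) \<noteq> \<top>" for y
    using emeasure_long_chords_le_shell[OF a v(1), of 1 y] by (auto simp: top_unique)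
  define c where "c = (\<lambda>y. measure ?H (long_chords a y v))"
  have c: "emeasure ?H (long_chords a y v) = ennreal (c y)" for y
    unfolding c_def by (rule emeasure_eq_ennreal_measure[OF fin])
  have c0: "0 \<le> c y" for y by (simp add: c_def)
  have W0: "0 \<le> W y" for y by (simp add: W_def prod_nonneg)
  have bounds: "(z - y) * c z + W z \<le> W y" "W y \<le> (z - y) * c y + W z" if "0 \<le> y" "y < z" for y z
  proof -
    have lu: "0 $ i \<le> a $ i" for i using a[of i] by simp
    have "ennreal (z - y) * ennreal (c z) + ennreal (W z) \<le> ennreal (W y)"
      using long_chords_bounds(1)[OF v(1) lu that] that emeasure_long_chords_nonneg[OF v(1), of z a]
      by (simp add: W_def c)
    then show "(z - y) * c z + W z \<le> W y"
      using that c0 W0 by (simp add: ennreal_mult[symmetric] ennreal_plus[symmetric] del: ennreal_plus)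
    have "ennreal (W y) \<le> ennreal (z - y) * ennreal (c y) + ennreal (W z)"
      using long_chords_bounds(2)[OF v(1) lu that] that emeasure_long_chords_nonneg[OF v(1), of y a]
      by (simp add: W_def c)
    then show "W y \<le> (z - y) * c y + W z"
      using that c0 W0 by (simp add: ennreal_mult[symmetric] ennreal_plus[symmetric] del: ennreal_plus)
  qed
  define u where "u = (\<lambda>e. (\<Prod>i\<in>UNIV. a $ i + 2 * e) - (\<Prod>i\<in>UNIV. max 0 (a $ i + 2 * e - e * \<bar>v $ i\<bar>)))"
  \<comment> \<open>The family is constant. Only the bound for the total, coming from the enlarged boxes, depends on e.\<close>
  have "((\<lambda>e::real. c x / V) \<longlongrightarrow> flight_rate \<beta> x) (at_right 0)"
  proof (rule flight_rate_limit[where G'="\<lambda>_. free_fraction \<beta>" and n="\<lambda>_. c (-1) / V" and u="\<lambda>e. u e / e / V"])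
    fix y z :: real assume yz: "0 \<le> y" "y < z"
    show "free_fraction \<beta> y - free_fraction \<beta> z \<le> (z - y) * (c y / V)"
      using bounds(2)[OF yz] V by (simp add: W field_simps)
    show "(z - y) * (c z / V) \<le> free_fraction \<beta> y - free_fraction \<beta> z"
      using bounds(1)[OF yz] V by (simp add: W field_simps)
  next
    have mono: "c z \<le> c y" if "long_chords a z v \<subseteq> long_chords a y v" for y z
    proof -
      have "ennreal (c z) \<le> ennreal (c y)" unfolding c[symmetric] using that by (intro emeasure_mono) auto
      then show ?thesis using c0 by simp
    qed
    show "c z / V \<le> c y / V" if "y \<le> z" for y z
      using V that by (intro divide_right_mono mono) (auto simp: long_chords_def)
    have nn: "0 \<le> chord (cbox 0 a) v q" for q by (simp add: chord_def)
    have "long_chords a y v \<subseteq> long_chords a (-1) v" for y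
      using nn by (auto simp: long_chords_def intro: less_le_trans[of _ 0])
    then show "c y / V \<le> c (-1) / V" for y using V by (intro divide_right_mono mono) auto
    show "c y / V = c (-1) / V" if "y < 0" for y
    proof -
      have "long_chords a y v = long_chords a (-1) v"
        using that nn by (auto simp: long_chords_def intro: less_le_trans[of _ 0])
      then show ?thesis by (simp add: c_def)
    qed
    show "\<forall>\<^sub>F e in at_right 0. c (- 1) / V \<le> u e / e / V"
    proof -
      have "\<forall>\<^sub>F e in at_right (0::real). 0 < e" by (rule eventually_at_right_less)
      then show ?thesis
      proof eventually_elim
        case (elim e)
        have "ennreal (c (-1)) \<le> ennreal (u e / e)"
          using emeasure_long_chords_le_shell[OF a v(1) elim, of "-1"] by (simp add: c u_def)
        moreover have "0 \<le> u e / e"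
        proof -
          have "(\<Prod>i\<in>UNIV. max 0 (a $ i + 2 * e - e * \<bar>v $ i\<bar>)) \<le> (\<Prod>i\<in>UNIV. a $ i + 2 * e)"
            using elim a by (intro prod_mono) (auto simp: less_imp_le add_nonneg_nonneg)
          then show ?thesis using elim by (simp add: u_def)
        qed
        ultimately have "c (-1) \<le> u e / e" by (simp only: ennreal_le_iff)
        then show ?case using V by (intro divide_right_mono) auto
      qed
    qed
    have "((\<lambda>e. u e / e / V) \<longlongrightarrow> V * (\<Sum>i\<in>UNIV. \<bar>v $ i\<bar> / a $ i) / V) (at_right 0)"
      unfolding u_def using V
      unfolding V_def by (intro tendsto_divide tendsto_const shell_volume_tendsto a less_imp_neq[symmetric])
    then show "((\<lambda>e. u e / e / V) \<longlongrightarrow> sum \<beta> UNIV) (at_right 0)" using V by (simp add: \<beta>_def)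
    show "x * \<beta> i \<noteq> 1" for i using ne by (simp add: \<beta>_def)
  qed (use \<beta> in auto)
  then have "c x / V = flight_rate \<beta> x"
    by (simp add: tendsto_const_iff)
  then have "c x = V * flight_rate \<beta> x" using V by (simp add: field_simps)
  then show ?thesis by (simp add: c V_def \<beta>_def)
qed

section \<open>Generic directions on the sphere\<close>

lemma emeasure_surface_measure:
  fixes A :: "(real^'n) set"
  assumes A: "A \<in> sets borel" "A \<subseteq> sphere 0 1"
  shows "emeasure surface_measure A
    = of_nat CARD('n) * emeasure lborel {x \<in> cball 0 1 - {0}. x /\<^sub>R norm x \<in> A}"
proof -
  let ?B = "cball 0 1 - {0} :: (real^'n) set"
  have B: "?B \<in> sets borel" by (intro sets.Diff borel_closed) auto
  have meas: "(\<lambda>x. x /\<^sub>R norm x) \<in> measurable (restrict_space lborel ?B) (restrict_space borel (sphere 0 1))"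
  proof (rule measurable_restrict_space2)
    show "(\<lambda>x. x /\<^sub>R norm x) \<in> space (restrict_space lborel ?B) \<rightarrow> sphere 0 1"
      by (auto simp: space_restrict_space)
    have "(\<lambda>x::real^'n. x /\<^sub>R norm x) \<in> borel_measurable lborel" by measurable
    then show "(\<lambda>x. x /\<^sub>R norm x) \<in> borel_measurable (restrict_space lborel ?B)"
      by (rule measurable_restrict_space1)
  qed
  have A': "A \<in> sets (restrict_space borel (sphere 0 1))"
    using A by (subst sets_restrict_space_iff) (auto intro: borel_closed)
  have eq: "(\<lambda>x. x /\<^sub>R norm x) -` A \<inter> space (restrict_space lborel ?B) = {x \<in> ?B. x /\<^sub>R norm x \<in> A}"
    by (auto simp: space_restrict_space)
  have "emeasure surface_measure A
      = of_nat CARD('n) * emeasure (restrict_space lborel ?B) {x \<in> ?B. x /\<^sub>R norm x \<in> A}"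
    unfolding surface_measure_def
    by (simp only: emeasure_scale_measure emeasure_distr[OF meas A'] eq)
  also have "emeasure (restrict_space lborel ?B) {x \<in> ?B. x /\<^sub>R norm x \<in> A} = emeasure lborel {x \<in> ?B. x /\<^sub>R norm x \<in> A}"
    using B by (intro emeasure_restrict_space) auto
  finally show ?thesis .
qed

lemma surface_measure_sphere:
  "emeasure surface_measure (sphere (0::real^'n) 1) \<noteq> 0"
  "emeasure surface_measure (sphere (0::real^'n) 1) \<noteq> \<top>"
proof -
  have eq: "{x \<in> cball 0 1 - {0::real^'n}. x /\<^sub>R norm x \<in> sphere 0 1} = cball 0 1 - {0}"
    by auto
  have ball: "emeasure lborel (cball 0 1 - {0::real^'n}) = emeasure lborel (cball (0::real^'n) 1)"
    by (rule emeasure_Diff_null_set) (auto intro: borel_closed)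
  have "emeasure surface_measure (sphere (0::real^'n) 1) = of_nat CARD('n) * emeasure lborel (cball (0::real^'n) 1)"
    by (simp only: emeasure_surface_measure[OF borel_closed[OF closed_sphere] order_refl] eq ball)
  also have "\<dots> = ennreal (CARD('n) * unit_ball_vol (real DIM(real^'n)))"
    by (simp add: emeasure_cball ennreal_of_nat_eq_real_of_nat ennreal_mult'[symmetric])
  finally have e: "emeasure surface_measure (sphere (0::real^'n) 1) = ennreal (CARD('n) * unit_ball_vol (real DIM(real^'n)))" .
  have pos: "0 < CARD('n) * unit_ball_vol (real DIM(real^'n))"
    by (intro mult_pos_pos unit_ball_vol_pos) auto
  show "emeasure surface_measure (sphere (0::real^'n) 1) \<noteq> 0"
    unfolding e using pos by (simp only: ennreal_eq_0_iff not_le)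
  show "emeasure surface_measure (sphere (0::real^'n) 1) \<noteq> \<top>" unfolding e by simp
qed

lemma sphere_in_sets_surface: "sphere 0 1 \<in> sets surface_measure"
  using sets.top[of surface_measure] by simp

lemma prob_space_uniform_direction: "prob_space (uniform_direction :: (real^'n) measure)"
  unfolding uniform_direction_def
  by (rule prob_space_uniform_measure) (use surface_measure_sphere in auto)

lemma sets_uniform_direction[simp]: "sets uniform_direction = sets (restrict_space borel (sphere 0 1))"
  by (simp add: uniform_direction_def)

lemma space_uniform_direction[simp]: "space uniform_direction = sphere 0 1"
  using sets_eq_imp_space_eq[OF sets_uniform_direction] by (simp add: space_restrict_space)

lemma borel_measurable_sphere:
  assumes "f \<in> borel_measurable borel"
  shows "f \<in> borel_measurable surface_measure" "f \<in> borel_measurable uniform_direction"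
proof -
  have f: "f \<in> borel_measurable (restrict_space borel (sphere 0 1))"
    using assms by (rule measurable_restrict_space1)
  then show "f \<in> borel_measurable surface_measure" "f \<in> borel_measurable uniform_direction"
    by (simp_all cong: measurable_cong_sets)
qed

lemma nn_integral_surface_measure:
  fixes f :: "real^'n \<Rightarrow> ennreal"
  assumes "f \<in> borel_measurable borel"
  shows "(\<integral>\<^sup>+v. f v \<partial>surface_measure) = emeasure surface_measure (sphere (0::real^'n) 1) * (\<integral>\<^sup>+v. f v \<partial>uniform_direction)"
proof -
  have "(\<integral>\<^sup>+v. f v \<partial>uniform_direction)
      = (\<integral>\<^sup>+v. f v * indicator (sphere 0 1) v \<partial>surface_measure) / emeasure surface_measure (sphere (0::real^'n) 1)"
    unfolding uniform_direction_def
    by (intro nn_integral_uniform_measure sphere_in_sets_surface borel_measurable_sphere(1) assms)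
  also have "(\<integral>\<^sup>+v. f v * indicator (sphere 0 1) v \<partial>surface_measure) = (\<integral>\<^sup>+v. f v \<partial>surface_measure)"
    by (rule nn_integral_cong) (simp add: indicator_def)
  finally show ?thesis
    using mult_divide_eq_ennreal[OF surface_measure_sphere[where 'n='n], of "\<integral>\<^sup>+v. f v \<partial>surface_measure"]
    by (simp add: ennreal_times_divide mult.commute)
qed

text \<open>
  The surface measure is defined by the volume of cones, so a property of directions holds almost everywhere
  as soon as it holds for the direction of almost every vector.
\<close>

lemma AE_surface_measure:
  fixes P :: "real^'n \<Rightarrow> bool"
  assumes P: "{v. \<not> P v} \<in> sets borel" and AE: "AE x in lborel. x \<noteq> 0 \<longrightarrow> P (x /\<^sub>R norm x)"
  shows "AE v in surface_measure. P v" "AE v in uniform_direction. P v"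
proof -
  let ?N = "{v. \<not> P v} \<inter> sphere 0 1"
  have N: "?N \<in> sets borel" using P borel_closed[OF closed_sphere] by (rule sets.Int)
  have "emeasure surface_measure ?N = of_nat CARD('n) * emeasure lborel {x \<in> cball 0 1 - {0}. x /\<^sub>R norm x \<in> ?N}"
    by (rule emeasure_surface_measure[OF N]) auto
  also have "emeasure lborel {x \<in> cball 0 1 - {0}. x /\<^sub>R norm x \<in> ?N} = 0"
  proof -
    have "AE x in lborel. \<not> (x \<in> cball 0 1 - {0} \<and> x /\<^sub>R norm x \<in> ?N)"
      using AE by eventually_elim auto
    from emeasure_eq_0_AE[OF this] show ?thesis by simp
  qed
  finally have "emeasure surface_measure ?N = 0" by simp
  moreover have "?N \<in> sets surface_measure"
    using N by (simp add: sets_restrict_space_iff borel_closed)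
  ultimately show AE1: "AE v in surface_measure. P v"
    by (intro AE_I[of _ _ ?N]) auto
  show "AE v in uniform_direction. P v"
    unfolding uniform_direction_def
    using AE1 surface_measure_sphere by (subst AE_uniform_measure) (auto simp: less_top elim: eventually_mono)
qed

text \<open>
  If a set meets every line parallel to \<open>e\<close> in finitely many points, averaging its translates by \<open>s e\<close> over
  \<open>s\<close> between 0 and 1 gives 0 pointwise, while all these translates have the same measure.
\<close>

lemma AE_lborel_by_lines:
  fixes e :: "'a::euclidean_space"
  assumes P: "{x. \<not> P x} \<in> sets borel" and lines: "\<And>y. finite {s. \<not> P (y + s *\<^sub>R e)}"
  shows "AE x in lborel. P x"
proof -
  let ?N = "{x. \<not> P x}"
  have [measurable]: "?N \<in> sets borel" by (rule P)
  have sh: "(\<integral>\<^sup>+y. indicator ?N (y + s *\<^sub>R e) \<partial>lborel) = emeasure lborel ?N" for s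
  proof -
    have "emeasure lborel ?N = (\<integral>\<^sup>+y. indicator ?N y \<partial>distr lborel borel ((+) (s *\<^sub>R e)))"
      by (simp add: lborel_distr_plus)
    also have "\<dots> = (\<integral>\<^sup>+y. indicator ?N (s *\<^sub>R e + y) \<partial>lborel)"
      by (rule nn_integral_distr) auto
    finally show ?thesis by (simp add: add.commute)
  qed
  have "emeasure lborel ?N = (\<integral>\<^sup>+s. indicator {0..1::real} s * (\<integral>\<^sup>+y. indicator ?N (y + s *\<^sub>R e) \<partial>lborel) \<partial>lborel)"
    by (simp add: sh nn_integral_multc)
  also have "\<dots> = (\<integral>\<^sup>+s. (\<integral>\<^sup>+y. indicator {0..1::real} s * indicator ?N (y + s *\<^sub>R e) \<partial>lborel) \<partial>lborel)"
    by (subst nn_integral_cmult) auto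
  also have "\<dots> = (\<integral>\<^sup>+y. (\<integral>\<^sup>+s. indicator {0..1::real} s * indicator ?N (y + s *\<^sub>R e) \<partial>lborel) \<partial>lborel)"
    by (rule lborel_pair.Fubini') measurable
  also have "\<dots> = (\<integral>\<^sup>+y. 0 \<partial>(lborel :: 'a measure))"
  proof (rule nn_integral_cong)
    fix y :: 'a
    have "{s. \<not> P (y + s *\<^sub>R e)} \<in> null_sets lborel" using lines by (rule finite_imp_null_set_lborel)
    then have "AE s in lborel. s \<notin> {s. \<not> P (y + s *\<^sub>R e)}" by (rule AE_not_in)
    then have "AE s in lborel. indicator {0..1::real} s * indicator ?N (y + s *\<^sub>R e) = (0::ennreal)"
      by eventually_elim auto
    then have "(\<integral>\<^sup>+s. indicator {0..1::real} s * indicator ?N (y + s *\<^sub>R e) \<partial>lborel) = (\<integral>\<^sup>+s. 0 \<partial>(lborel :: real measure))"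
      by (rule nn_integral_cong_AE)
    then show "(\<integral>\<^sup>+s. indicator {0..1::real} s * indicator ?N (y + s *\<^sub>R e) \<partial>lborel) = 0" by simp
  qed
  finally have "emeasure lborel ?N = 0" by simp
  then show ?thesis by (intro AE_I[of _ _ ?N]) auto
qed

definition crossing_rate :: "real^'n \<Rightarrow> real^'n \<Rightarrow> 'n \<Rightarrow> real" where
  "crossing_rate a v = (\<lambda>i. \<bar>v $ i\<bar> / a $ i)"

text \<open>
  Rational independence of the crossing rates is the hypothesis of Weyl's theorem for the phases of the walls.
\<close>

definition generic_direction :: "real^'n \<Rightarrow> real^'n \<Rightarrow> bool" where
  "generic_direction a v \<longleftrightarrow> (\<forall>i. v $ i \<noteq> 0) \<and>
     (\<forall>m::'n \<Rightarrow> int. (\<Sum>i\<in>UNIV. of_int (m i) * crossing_rate a v i) = 0 \<longrightarrow> m = (\<lambda>_. 0))"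

lemma finite_abs_shift_eq: "finite {s::real. \<bar>y + s\<bar> = c}"
proof -
  have "{s::real. \<bar>y + s\<bar> = c} \<subseteq> {c - y, - c - y}" by auto
  then show ?thesis by (rule finite_subset) auto
qed

lemma borel_measurable_component[measurable]: "(\<lambda>x::real^'n. x $ i) \<in> borel_measurable borel"
  by (intro borel_measurable_continuous_onI continuous_intros)

text \<open>
  There are only countably many relations, and each of them fixes the absolute value of some component when
  the other components are given.
\<close>

lemma AE_generic_direction:
  fixes a :: "real^'n"
  assumes a: "\<And>i. 0 < a $ i"
  shows "AE v in surface_measure. generic_direction a v" "AE v in uniform_direction. generic_direction a v"
proof -
  have meas[measurable]: "(\<lambda>v. crossing_rate a v i) \<in> borel_measurable borel" for i
    unfolding crossing_rate_def by measurable
  have ax: "(y + s *\<^sub>R axis k 1) $ i = (if i = k then y $ i + s else y $ i)" for y :: "real^'n" and s k i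
    by (simp add: axis_def)
  have comp: "AE x in lborel. (x :: real^'n) $ i \<noteq> 0" for i
  proof (rule AE_lborel_by_lines[where e="axis i 1"])
    show "{x :: real^'n. \<not> x $ i \<noteq> 0} \<in> sets borel" by measurable
    show "finite {s. \<not> (y + s *\<^sub>R axis i 1) $ i \<noteq> 0}" for y :: "real^'n"
      using finite_abs_shift_eq[of "y $ i" 0] by (simp add: ax)
  qed
  have indep: "AE x in lborel. (\<Sum>i\<in>UNIV. of_int (m i) * crossing_rate a x i) \<noteq> 0" if m: "m \<noteq> (\<lambda>_. 0)" for m :: "'n \<Rightarrow> int"
  proof -
    obtain k where k: "m k \<noteq> 0" using m by auto
    show ?thesis
    proof (rule AE_lborel_by_lines[where e="axis k 1"])
      show "{x. \<not> (\<Sum>i\<in>UNIV. of_int (m i) * crossing_rate a x i) \<noteq> 0} \<in> sets borel" by measurable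
      fix y :: "real^'n"
      define r where "r = (\<Sum>i\<in>UNIV - {k}. of_int (m i) * crossing_rate a y i)"
      have "(\<Sum>i\<in>UNIV. of_int (m i) * crossing_rate a (y + s *\<^sub>R axis k 1) i) = of_int (m k) * (\<bar>y $ k + s\<bar> / a $ k) + r" for s
      proof -
        have cr: "crossing_rate a (y + s *\<^sub>R axis k 1) i = (if i = k then \<bar>y $ k + s\<bar> / a $ k else crossing_rate a y i)" for i
          unfolding crossing_rate_def ax by auto
        show ?thesis
          unfolding r_def cr by (subst sum.remove[of _ k]) (auto intro!: sum.cong)
      qed
      moreover have "of_int (m k) * (\<bar>y $ k + s\<bar> / a $ k) + r = 0 \<longleftrightarrow> \<bar>y $ k + s\<bar> = - r * a $ k / of_int (m k)" for s
        using a[of k] k by (auto simp: field_simps)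
      ultimately show "finite {s. \<not> (\<Sum>i\<in>UNIV. of_int (m i) * crossing_rate a (y + s *\<^sub>R axis k 1) i) \<noteq> 0}"
        by (simp add: finite_abs_shift_eq)
    qed
  qed
  have "AE x in lborel. generic_direction a (x :: real^'n)"
  proof -
    have "AE x in lborel. \<forall>i. (x :: real^'n) $ i \<noteq> 0"
      unfolding AE_all_countable using comp by blast
    moreover have "AE x in lborel. \<forall>m::'n \<Rightarrow> int. (\<Sum>i\<in>UNIV. of_int (m i) * crossing_rate a x i) = 0 \<longrightarrow> m = (\<lambda>_. 0)"
      unfolding AE_all_countable
    proof
      fix m :: "'n \<Rightarrow> int"
      show "AE x in lborel. (\<Sum>i\<in>UNIV. of_int (m i) * crossing_rate a x i) = 0 \<longrightarrow> m = (\<lambda>_. 0)"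
      proof (cases "m = (\<lambda>_. 0)")
        case False
        from indep[OF this] show ?thesis by eventually_elim simp
      qed simp
    qed
    ultimately show ?thesis by eventually_elim (simp add: generic_direction_def)
  qed
  then have AE: "AE x in lborel. x \<noteq> 0 \<longrightarrow> generic_direction a (x /\<^sub>R norm x)"
  proof eventually_elim
    case (elim x)
    show ?case
    proof
      assume x: "x \<noteq> 0"
      have cr: "crossing_rate a (x /\<^sub>R norm x) i = crossing_rate a x i / norm x" for i
        by (simp add: crossing_rate_def abs_mult divide_inverse mult_ac)
      have "(\<Sum>i\<in>UNIV. of_int (m i) * crossing_rate a (x /\<^sub>R norm x) i) = (\<Sum>i\<in>UNIV. of_int (m i) * crossing_rate a x i) / norm x" for m :: "'n \<Rightarrow> int"
        by (simp add: cr sum_divide_distrib)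
      then show "generic_direction a (x /\<^sub>R norm x)" using elim x by (simp add: generic_direction_def)
    qed
  qed
  have "{v. \<not> generic_direction a v} \<in> sets borel"
    unfolding generic_direction_def by measurable
  from AE_surface_measure[OF this AE]
  show "AE v in surface_measure. generic_direction a v" "AE v in uniform_direction. generic_direction a v" .
qed

text \<open>
  The directions with \<open>x * crossing_rate a v j = 1\<close> lie on a quadratic cone about the \<open>j\<close>-th axis. Here
  dimension at least 2 is essential: in a box of dimension 1 all flights have the same length, and for that
  length the equation holds for both directions.
\<close>

lemma AE_crossing_rate_neq:
  fixes a :: "real^'n"
  assumes n: "CARD('n) \<ge> 2" and a: "\<And>i. 0 < a $ i"
  shows "AE v in surface_measure. \<forall>i. x * crossing_rate a v i \<noteq> 1"
    "AE v in uniform_direction. \<forall>i. x * crossing_rate a v i \<noteq> 1"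
proof -
  have AE: "AE y in lborel. (y :: real^'n) \<noteq> 0 \<longrightarrow> (\<forall>i. x * crossing_rate a (y /\<^sub>R norm y) i \<noteq> 1)"
  proof (cases "x = 0")
    case False
    have "AE y in lborel. (y :: real^'n) \<noteq> 0 \<longrightarrow> x * crossing_rate a (y /\<^sub>R norm y) j \<noteq> 1" for j
    proof -
      obtain k where k: "k \<noteq> j"
      proof -
        have "\<not> UNIV \<subseteq> {j}" using n card_mono[of "{j}" UNIV] by auto
        then show ?thesis using that by auto
      qed
      have ax: "(y + s *\<^sub>R axis k 1) $ j = y $ j" for y :: "real^'n" and s
        using k by (simp add: axis_def)
      have nrm: "(norm (y + s *\<^sub>R axis k 1))\<^sup>2 = (norm y)\<^sup>2 - (y $ k)\<^sup>2 + (y $ k + s)\<^sup>2" for y :: "real^'n" and s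
        unfolding power2_norm_eq_inner
        by (simp add: inner_add_left inner_add_right inner_axis inner_axis' axis_nth power2_eq_square algebra_simps)
      define c where "c = a $ j / x"
      have c: "c \<noteq> 0" using a[of j] False by (simp add: c_def)
      have "AE y in lborel. (y $ j)\<^sup>2 \<noteq> c\<^sup>2 * (norm (y :: real^'n))\<^sup>2"
      proof (rule AE_lborel_by_lines[where e="axis k 1"])
        show "{y :: real^'n. \<not> (y $ j)\<^sup>2 \<noteq> c\<^sup>2 * (norm y)\<^sup>2} \<in> sets borel" by measurable
        fix y :: "real^'n"
        define D where "D = (y $ j)\<^sup>2 / c\<^sup>2 - ((norm y)\<^sup>2 - (y $ k)\<^sup>2)"
        have "\<bar>y $ k + s\<bar> = sqrt D" if "(y $ j)\<^sup>2 = c\<^sup>2 * ((norm y)\<^sup>2 - (y $ k)\<^sup>2 + (y $ k + s)\<^sup>2)" for s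
        proof -
          have "(y $ j)\<^sup>2 / c\<^sup>2 = (norm y)\<^sup>2 - (y $ k)\<^sup>2 + (y $ k + s)\<^sup>2" using that c by (simp add: field_simps)
          then have "(y $ k + s)\<^sup>2 = D" by (simp add: D_def)
          then show ?thesis by (metis real_sqrt_abs)
        qed
        then have "{s. \<not> ((y + s *\<^sub>R axis k 1) $ j)\<^sup>2 \<noteq> c\<^sup>2 * (norm (y + s *\<^sub>R axis k 1))\<^sup>2} \<subseteq> {s. \<bar>y $ k + s\<bar> = sqrt D}"
          unfolding ax nrm by auto
        then show "finite {s. \<not> ((y + s *\<^sub>R axis k 1) $ j)\<^sup>2 \<noteq> c\<^sup>2 * (norm (y + s *\<^sub>R axis k 1))\<^sup>2}"
          using finite_abs_shift_eq by (rule finite_subset)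
      qed
      then show ?thesis
      proof eventually_elim
        case (elim y)
        show ?case
        proof (intro impI notI)
          assume y: "y \<noteq> 0" and e: "x * crossing_rate a (y /\<^sub>R norm y) j = 1"
          have "\<bar>y $ j\<bar> * x = norm y * a $ j"
            using e a[of j] y by (simp add: crossing_rate_def abs_mult field_simps)
          then have "\<bar>y $ j\<bar> = c * norm y" using False by (simp add: c_def field_simps)
          then have "(y $ j)\<^sup>2 = c\<^sup>2 * (norm y)\<^sup>2" by (metis power2_abs power_mult_distrib)
          with elim show False by simp
        qed
      qed
    qed
    then have "AE y in lborel. \<forall>j. (y :: real^'n) \<noteq> 0 \<longrightarrow> x * crossing_rate a (y /\<^sub>R norm y) j \<noteq> 1"
      unfolding AE_all_countable by blast
    then show ?thesis by eventually_elim blast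
  qed simp
  have "{v. \<not> (\<forall>i. x * crossing_rate a v i \<noteq> 1)} \<in> sets borel"
    unfolding crossing_rate_def by measurable
  from AE_surface_measure[OF this AE]
  show "AE v in surface_measure. \<forall>i. x * crossing_rate a v i \<noteq> 1"
    "AE v in uniform_direction. \<forall>i. x * crossing_rate a v i \<noteq> 1" .
qed

lemma flight_rate_measurable[measurable]:
  "(\<lambda>v. flight_rate (crossing_rate a v) x) \<in> borel_measurable borel"
  unfolding flight_rate_def crossing_rate_def by measurable

lemma crossing_rate_nonneg: "(\<And>i. 0 < a $ i) \<Longrightarrow> 0 \<le> crossing_rate a v i"
  by (simp add: crossing_rate_def less_imp_le)

lemma sum_crossing_rate_le:
  fixes a v :: "real^'n"
  assumes "\<And>i. 0 < a $ i" "norm v = 1"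
  shows "sum (crossing_rate a v) UNIV \<le> (\<Sum>i\<in>UNIV. 1 / a $ i)"
  unfolding crossing_rate_def
  using assms component_le_norm_cart[of v] by (intro sum_mono divide_right_mono) (auto simp: less_imp_le)

lemma flight_rate_crossing_bounds:
  fixes a v :: "real^'n"
  assumes "\<And>i. 0 < a $ i" "norm v = 1"
  shows "0 \<le> flight_rate (crossing_rate a v) x" "flight_rate (crossing_rate a v) x \<le> (\<Sum>i\<in>UNIV. 1 / a $ i)"
  using flight_rate_nonneg[of "crossing_rate a v"] flight_rate_le_sum[of "crossing_rate a v" x]
    crossing_rate_nonneg[of a v] sum_crossing_rate_le[OF assms] assms(1) by (auto intro: order_trans)

section \<open>The law of a random chord\<close>

definition mean_flight_rate :: "real^'n \<Rightarrow> real \<Rightarrow> real" where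
  "mean_flight_rate a x = (LINT v|uniform_direction. flight_rate (crossing_rate a v) x)"

lemma integrable_flight_rate:
  fixes a :: "real^'n"
  assumes "\<And>i. 0 < a $ i"
  shows "integrable uniform_direction (\<lambda>v. flight_rate (crossing_rate a v) x)"
proof -
  interpret prob_space "uniform_direction :: (real^'n) measure" by (rule prob_space_uniform_direction)
  show ?thesis
    by (rule integrable_const_bound[where B="\<Sum>i\<in>UNIV. 1 / a $ i"])
       (use flight_rate_crossing_bounds[OF assms] in \<open>auto intro!: AE_I2 borel_measurable_sphere\<close>)
qed

lemma mean_flight_rate_nonneg:
  fixes a :: "real^'n"
  assumes "\<And>i. 0 < a $ i"
  shows "0 \<le> mean_flight_rate a x"
  unfolding mean_flight_rate_def
  using flight_rate_crossing_bounds(1)[OF assms] by (intro integral_nonneg_AE AE_I2) auto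

text \<open>
  A positive lower bound that is uniform in the direction: the sum of the absolute values of the components
  of a unit vector is at least 1.
\<close>

lemma sum_crossing_rate_ge:
  fixes a v :: "real^'n"
  assumes a: "\<And>i. 0 < a $ i" and v: "norm v = 1"
  shows "1 / (\<Sum>i\<in>UNIV. a $ i) \<le> sum (crossing_rate a v) UNIV"
proof -
  let ?A = "\<Sum>i\<in>UNIV. a $ i"
  have A: "a $ i \<le> ?A" for i using a by (intro member_le_sum) (auto simp: less_imp_le)
  have "1 \<le> (\<Sum>i\<in>UNIV. \<bar>v $ i\<bar>)" using norm_le_l1_cart[of v] v by simp
  moreover have Apos: "0 < ?A" using a by (intro sum_pos) auto
  ultimately have "1 / ?A \<le> (\<Sum>i\<in>UNIV. \<bar>v $ i\<bar>) / ?A" by (intro divide_right_mono) auto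
  also have "\<dots> = (\<Sum>i\<in>UNIV. \<bar>v $ i\<bar> / ?A)" by (rule sum_divide_distrib)
  also have "\<dots> \<le> sum (crossing_rate a v) UNIV"
    unfolding crossing_rate_def using a A Apos by (intro sum_mono divide_left_mono) auto
  finally show ?thesis .
qed

lemma mean_flight_rate_pos:
  fixes a :: "real^'n"
  assumes a: "\<And>i. 0 < a $ i"
  shows "0 < mean_flight_rate a (-1)"
proof -
  interpret prob_space "uniform_direction :: (real^'n) measure" by (rule prob_space_uniform_direction)
  have "0 < 1 / (\<Sum>i\<in>UNIV. a $ i)" using a by (auto intro!: divide_pos_pos sum_pos)
  also have "\<dots> = (LINT v|(uniform_direction :: (real^'n) measure). 1 / (\<Sum>i\<in>UNIV. a $ i))"
    using prob_space by simp
  also have "\<dots> \<le> mean_flight_rate a (-1)"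
    unfolding mean_flight_rate_def
    by (rule integral_mono[OF _ integrable_flight_rate[OF a]])
       (use sum_crossing_rate_ge[OF a] in \<open>auto simp: flight_rate_neg\<close>)
  finally show ?thesis .
qed

lemma chord_length_eq: "chord_length a = (\<lambda>l. chord (cbox 0 a) (fst l) (snd l))"
  by (auto simp: chord_length_def chord_def fun_eq_iff)

lemma emeasure_line_measure_long_chords:
  fixes a :: "real^'n"
  assumes n: "CARD('n) \<ge> 2" and a: "\<And>i. 0 < a $ i"
  shows "emeasure line_measure {l \<in> meets_box a. x < chord_length a l}
    = emeasure surface_measure (sphere (0::real^'n) 1) * ennreal ((\<Prod>i\<in>UNIV. a $ i) * mean_flight_rate a x)"
proof -
  let ?E = "{l \<in> meets_box a. x < chord_length a l}"
  define V where "V = (\<Prod>i\<in>UNIV. a $ i)"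
  have V: "0 < V" unfolding V_def using a by (intro prod_pos) auto
  have mb: "meets_box a \<in> sets borel" by (intro borel_closed compact_imp_closed compact_meets_box)
  have [measurable]: "chord_length a \<in> borel_measurable borel"
    unfolding chord_length_eq by (rule chord_measurable) simp
  have E: "?E \<in> sets borel"
  proof -
    have "{l. x < chord_length a l} \<in> sets borel" by measurable
    then have "meets_box a \<inter> {l. x < chord_length a l} \<in> sets borel" using mb by (intro sets.Int)
    then show ?thesis by (simp add: Collect_conj_eq)
  qed
  have "emeasure line_measure ?E = (\<integral>\<^sup>+v. emeasure (hyperplane_lborel v) {q. (v, q) \<in> ?E} \<partial>surface_measure)"
    by (rule emeasure_line_measure[OF E]) (auto simp: meets_box_def)
  also have "\<dots> = (\<integral>\<^sup>+v. ennreal (V * flight_rate (crossing_rate a v) x) \<partial>surface_measure)"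
  proof (rule nn_integral_cong_AE)
    have "AE v in surface_measure. v \<in> sphere (0::real^'n) 1" by (rule AE_I2) simp
    with AE_generic_direction(1)[OF a] AE_crossing_rate_neq(1)[OF n a, where x=x]
    show "AE v in surface_measure. emeasure (hyperplane_lborel v) {q. (v, q) \<in> ?E} = ennreal (V * flight_rate (crossing_rate a v) x)"
    proof eventually_elim
      case (elim v)
      have "{q. (v, q) \<in> ?E} = long_chords a x v"
        by (auto simp: long_chords_def chord_length_eq)
      then show ?case
        using long_chords_rate[OF a, of v x] elim by (simp add: V_def generic_direction_def crossing_rate_def)
    qed
  qed
  also have "\<dots> = emeasure surface_measure (sphere (0::real^'n) 1) * (\<integral>\<^sup>+v. ennreal (V * flight_rate (crossing_rate a v) x) \<partial>uniform_direction)"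
    by (rule nn_integral_surface_measure) measurable
  also have "(\<integral>\<^sup>+v. ennreal (V * flight_rate (crossing_rate a v) x) \<partial>uniform_direction) = ennreal (V * mean_flight_rate a x)"
  proof -
    have "(\<integral>\<^sup>+v. ennreal (V * flight_rate (crossing_rate a v) x) \<partial>uniform_direction)
        = ennreal (LINT v|uniform_direction. V * flight_rate (crossing_rate a v) x)"
      using integrable_flight_rate[OF a, of x] V flight_rate_crossing_bounds(1)[OF a]
      by (intro nn_integral_eq_integral AE_I2) auto
    then show ?thesis by (simp add: mean_flight_rate_def)
  qed
  finally show ?thesis by (simp add: V_def)
qed

text \<open>
  The measure of the lines with a chord longer than \<open>x\<close> is the mean flight rate times the surface area of the
  sphere and the volume of the box. Both factors cancel when the measure is normalized.
\<close>

theorem cdf_chord_law: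
  fixes a :: "real^'n"
  assumes n: "CARD('n) \<ge> 2" and a: "\<And>i. 0 < a $ i"
  shows "cdf (chord_law a) x = 1 - mean_flight_rate a x / mean_flight_rate a (-1)"
proof -
  define V where "V = (\<Prod>i\<in>UNIV. a $ i)"
  have V: "0 < V" unfolding V_def using a by (intro prod_pos) auto
  obtain s where s: "emeasure surface_measure (sphere (0::real^'n) 1) = ennreal s" "0 < s"
    using surface_measure_sphere[where 'n='n] by (cases "emeasure surface_measure (sphere (0::real^'n) 1)") (auto simp: ennreal_eq_0_iff not_le)
  have m: "emeasure line_measure {l \<in> meets_box a. y < chord_length a l} = ennreal (s * (V * mean_flight_rate a y))" for y
    using emeasure_line_measure_long_chords[OF n a, of y] s V mean_flight_rate_nonneg[OF a, of y]
    by (simp add: V_def ennreal_mult)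
  have cl[measurable]: "chord_length a \<in> borel_measurable borel"
    unfolding chord_length_eq by (rule chord_measurable) simp
  have nn: "0 \<le> chord_length a l" for l by (simp add: chord_length_eq chord_def)
  have all: "{l \<in> meets_box a. -1 < chord_length a l} = meets_box a" using nn by (auto intro: less_le_trans[of _ 0])
  have M: "emeasure line_measure (meets_box a) = ennreal (s * (V * mean_flight_rate a (-1)))" using m[of "-1"] by (simp add: all)
  have mb: "meets_box a \<in> sets borel" by (intro borel_closed compact_imp_closed compact_meets_box)
  have sub: "meets_box a \<subseteq> directed_lines" by (auto simp: meets_box_def)
  have long: "{l \<in> meets_box a. x < chord_length a l} \<in> sets line_measure"
  proof -
    have "{l. x < chord_length a l} \<in> sets borel" by measurable
    then have "meets_box a \<inter> {l. x < chord_length a l} \<in> sets borel"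
      using mb by (intro sets.Int)
    then show "{l \<in> meets_box a. x < chord_length a l} \<in> sets line_measure"
      using sub by (auto simp: sets_line_measure Collect_conj_eq)
  qed
  have rl: "random_line a = uniform_measure line_measure (meets_box a)"
    by (simp add: random_line_def meets_box_def)
  have clm: "chord_length a \<in> borel_measurable (random_line a)"
  proof -
    have "chord_length a \<in> borel_measurable (restrict_space borel directed_lines)"
      by (rule measurable_restrict_space1[OF cl])
    moreover have "sets (random_line a) = sets (restrict_space borel (directed_lines :: ((real^'n) \<times> (real^'n)) set))"
      by (simp add: rl sets_line_measure sets_directed_lines)
    ultimately show ?thesis by (simp cong: measurable_cong_sets)
  qed
  have mbl: "meets_box a \<in> sets line_measure" using mb sub by (simp add: sets_line_measure)
  have "cdf (chord_law a) x = measure (random_line a) (chord_length a -` {..x} \<inter> space (random_line a))"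
    unfolding cdf_def chord_law_def by (rule measure_distr[OF clm]) simp
  also have "\<dots> = measure line_measure (meets_box a \<inter> (chord_length a -` {..x} \<inter> space (random_line a))) / measure line_measure (meets_box a)"
    unfolding rl
  proof (rule measure_uniform_measure)
    show "emeasure line_measure (meets_box a) \<noteq> 0"
      unfolding M using s V mean_flight_rate_pos[OF a] by (simp add: ennreal_eq_0_iff not_le)
    show "emeasure line_measure (meets_box a) \<noteq> \<infinity>" unfolding M by simp
    show "chord_length a -` {..x} \<inter> space (uniform_measure line_measure (meets_box a)) \<in> sets line_measure"
      using measurable_sets[OF clm, of "{..x}"] by (simp add: rl)
  qed
  also have "meets_box a \<inter> (chord_length a -` {..x} \<inter> space (random_line a)) = meets_box a - {l \<in> meets_box a. x < chord_length a l}"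
    using sub by (auto simp: rl)
  also have "measure line_measure (meets_box a - {l \<in> meets_box a. x < chord_length a l})
      = measure line_measure (meets_box a) - measure line_measure {l \<in> meets_box a. x < chord_length a l}"
    by (rule measure_Diff[OF _ mbl long]) (auto simp: M)
  also have "\<dots> / measure line_measure (meets_box a) = 1 - mean_flight_rate a x / mean_flight_rate a (-1)"
  proof -
    have "measure line_measure (meets_box a) = s * (V * mean_flight_rate a (-1))"
      using M s V mean_flight_rate_nonneg[OF a, of "-1"] by (simp add: measure_def)
    moreover have "measure line_measure {l \<in> meets_box a. x < chord_length a l} = s * (V * mean_flight_rate a x)"
      using m[of x] s V mean_flight_rate_nonneg[OF a, of x] by (simp add: measure_def)
    ultimately show ?thesis using s V mean_flight_rate_pos[OF a] by (simp add: diff_divide_distrib)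
  qed
  finally show ?thesis .
qed

section \<open>Quotients of sums of independent variables\<close>

lemma (in prob_space) integrable_PiM_component:
  fixes X :: "'a \<Rightarrow> real"
  assumes X: "integrable M X" and i: "i \<in> I"
  shows "integrable (PiM I (\<lambda>_. M)) (\<lambda>\<omega>. X (\<omega> i))"
    and "(LINT \<omega>|PiM I (\<lambda>_. M). X (\<omega> i)) = (LINT s|M. X s)"
proof -
  have d: "distr (PiM I (\<lambda>_. M)) M (\<lambda>\<omega>. \<omega> i) = M"
    using distr_PiM_component[of I "\<lambda>_. M" i] prob_space_axioms i by auto
  have m: "(\<lambda>\<omega>. \<omega> i) \<in> measurable (PiM I (\<lambda>_. M)) M" using i by (rule measurable_component_singleton)
  show "integrable (PiM I (\<lambda>_. M)) (\<lambda>\<omega>. X (\<omega> i))"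
    using X integrable_distr_eq[OF m, of X] by (simp add: d borel_measurable_integrable)
  show "(LINT \<omega>|PiM I (\<lambda>_. M). X (\<omega> i)) = (LINT s|M. X s)"
    using integral_distr[OF m, of X] X by (simp add: d borel_measurable_integrable)
qed

lemma (in prob_space) integral_PiM_uncorrelated:
  fixes X :: "'a \<Rightarrow> real"
  assumes X: "integrable M X" "(LINT s|M. X s) = 0" and ij: "i < (n::nat)" "j < n" "i \<noteq> j"
  shows "(LINT \<omega>|PiM {..<n} (\<lambda>_. M). X (\<omega> i) * X (\<omega> j)) = 0"
proof -
  interpret product_sigma_finite "\<lambda>_::nat. M" by standard
  define f where "f = (\<lambda>k. if k \<in> {i, j} then X else (\<lambda>_. 1))"
  have "(\<Prod>k<n. f k (\<omega> k)) = X (\<omega> i) * X (\<omega> j)" for \<omega>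
  proof -
    have "(\<Prod>k<n. f k (\<omega> k)) = (\<Prod>k\<in>{i, j}. f k (\<omega> k))"
      using ij by (intro prod.mono_neutral_right) (auto simp: f_def)
    then show ?thesis using ij by (simp add: f_def)
  qed
  moreover have "(LINT \<omega>|PiM {..<n} (\<lambda>_. M). (\<Prod>k<n. f k (\<omega> k))) = (\<Prod>k<n. LINT s|M. f k s)"
    by (rule product_integral_prod) (use X in \<open>auto simp: f_def\<close>)
  moreover have "(\<Prod>k<n. LINT s|M. f k s) = 0"
    using ij X by (intro prod_zero bexI[of _ i]) (auto simp: f_def)
  ultimately show ?thesis by simp
qed

text \<open>
  The variables \<open>X (\<omega> i)\<close> are uncorrelated, so the second moment of their sum is at most \<open>n * B\<^sup>2\<close>.
\<close>

lemma (in prob_space) mean_abs_sum_le: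
  fixes X :: "'a \<Rightarrow> real"
  assumes Xm[measurable]: "X \<in> borel_measurable M" and bound: "AE s in M. \<bar>X s\<bar> \<le> B"
    and mean: "(LINT s|M. X s) = 0" and n: "0 < (n::nat)"
  shows "integrable (PiM {..<n} (\<lambda>_. M)) (\<lambda>\<omega>. \<bar>\<Sum>i<n. X (\<omega> i)\<bar>)"
    and "(LINT \<omega>|PiM {..<n} (\<lambda>_. M). \<bar>\<Sum>i<n. X (\<omega> i)\<bar>) \<le> sqrt n * (B\<^sup>2 + 1) / 2"
proof -
  let ?P = "PiM {..<n} (\<lambda>_. M)"
  interpret P: prob_space ?P by (rule prob_space_PiM) (rule prob_space_axioms)
  have Xi: "integrable M X"
    by (rule integrable_const_bound[where B=B]) (use bound in auto)
  have comp[measurable]: "(\<lambda>\<omega>. X (\<omega> i)) \<in> borel_measurable ?P" if "i < n" for i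
    by (rule measurable_compose[OF _ Xm], rule measurable_component_singleton) (use that in auto)
  have AEb: "AE \<omega> in ?P. \<bar>X (\<omega> i)\<bar> \<le> B" if "i < n" for i
    using that bound by (intro AE_PiM_component) (auto intro: prob_space_axioms)
  have int2: "integrable ?P (\<lambda>\<omega>. X (\<omega> i) * X (\<omega> j))" if "i < n" "j < n" for i j
  proof (rule P.integrable_const_bound[where B="B * B"])
    show "AE \<omega> in ?P. norm (X (\<omega> i) * X (\<omega> j)) \<le> B * B"
      using AEb[OF that(1)] AEb[OF that(2)]
    proof eventually_elim
      case (elim \<omega>)
      then have "0 \<le> B" by linarith
      with elim show ?case unfolding real_norm_def abs_mult by (intro mult_mono) auto
    qed
  qed (use that in measurable)
  show int1: "integrable ?P (\<lambda>\<omega>. \<bar>\<Sum>i<n. X (\<omega> i)\<bar>)"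
    using Xi by (intro integrable_abs Bochner_Integration.integrable_sum integrable_PiM_component(1)) auto
  have sq: "(\<Sum>i<n. X (\<omega> i))\<^sup>2 = (\<Sum>i<n. \<Sum>j<n. X (\<omega> i) * X (\<omega> j))" for \<omega>
    by (simp add: power2_eq_square sum_product)
  have int_sq: "integrable ?P (\<lambda>\<omega>. (\<Sum>i<n. X (\<omega> i))\<^sup>2)"
    unfolding sq using int2 by (intro Bochner_Integration.integrable_sum) auto
  have "(LINT \<omega>|?P. (\<Sum>i<n. X (\<omega> i))\<^sup>2) = (\<Sum>i<n. \<Sum>j<n. LINT \<omega>|?P. X (\<omega> i) * X (\<omega> j))"
  proof -
    have "(LINT \<omega>|?P. (\<Sum>i<n. \<Sum>j<n. X (\<omega> i) * X (\<omega> j))) = (\<Sum>i<n. (LINT \<omega>|?P. (\<Sum>j<n. X (\<omega> i) * X (\<omega> j))))"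
      using int2 by (intro Bochner_Integration.integral_sum Bochner_Integration.integrable_sum) auto
    also have "\<dots> = (\<Sum>i<n. \<Sum>j<n. LINT \<omega>|?P. X (\<omega> i) * X (\<omega> j))"
      using int2 by (intro sum.cong refl Bochner_Integration.integral_sum) auto
    finally show ?thesis unfolding sq .
  qed
  also have "\<dots> \<le> (\<Sum>i<n. \<Sum>j<n. if j = i then B\<^sup>2 else 0)"
  proof (intro sum_mono)
    fix i j assume ij: "i \<in> {..<n}" "j \<in> {..<n}"
    show "(LINT \<omega>|?P. X (\<omega> i) * X (\<omega> j)) \<le> (if j = i then B\<^sup>2 else 0)"
    proof (cases "j = i")
      case True
      have "(LINT \<omega>|?P. X (\<omega> i) * X (\<omega> i)) \<le> (LINT \<omega>|?P. B\<^sup>2)"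
      proof (rule integral_mono_AE)
        show "AE \<omega> in ?P. X (\<omega> i) * X (\<omega> i) \<le> B\<^sup>2"
          using AEb[of i] ij
          by (auto elim!: eventually_mono simp: power2_eq_square[symmetric] abs_le_square_iff[symmetric])
      qed (use int2 ij in auto)
      then show ?thesis using True P.prob_space by simp
    next
      case False
      then show ?thesis using integral_PiM_uncorrelated[OF Xi mean, of i n j] ij by simp
    qed
  qed
  also have "\<dots> = n * B\<^sup>2" by (simp add: sum.delta)
  finally have S2: "(LINT \<omega>|?P. (\<Sum>i<n. X (\<omega> i))\<^sup>2) \<le> n * B\<^sup>2" .
  \<comment> \<open>The square root balances the two terms in \<open>\<bar>S\<bar> \<le> (S\<^sup>2 / c + c) / 2\<close>.\<close>
  define c where "c = sqrt n"
  have c: "0 < c" "c * c = n" using n by (auto simp: c_def)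
  have "(LINT \<omega>|?P. \<bar>\<Sum>i<n. X (\<omega> i)\<bar>) \<le> (LINT \<omega>|?P. ((\<Sum>i<n. X (\<omega> i))\<^sup>2 / c + c) / 2)"
  proof (rule integral_mono[OF int1])
    show "integrable ?P (\<lambda>\<omega>. ((\<Sum>i<n. X (\<omega> i))\<^sup>2 / c + c) / 2)" using int_sq by auto
    fix \<omega>
    define S where "S = \<bar>\<Sum>i<n. X (\<omega> i)\<bar>"
    have "0 \<le> (S - c)\<^sup>2" by simp
    then have "2 * S * c \<le> S\<^sup>2 + c * c" by (simp add: power2_eq_square algebra_simps)
    then have "2 * S \<le> S\<^sup>2 / c + c" using c by (simp add: field_simps)
    then show "\<bar>\<Sum>i<n. X (\<omega> i)\<bar> \<le> ((\<Sum>i<n. X (\<omega> i))\<^sup>2 / c + c) / 2" by (simp add: S_def)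
  qed
  also have "\<dots> = ((LINT \<omega>|?P. (\<Sum>i<n. X (\<omega> i))\<^sup>2) / c + c) / 2"
    using int_sq P.prob_space by simp
  also have "\<dots> \<le> (n * B\<^sup>2 / c + c) / 2"
    using S2 c by (intro divide_right_mono add_right_mono) auto
  also have "\<dots> = sqrt n * (B\<^sup>2 + 1) / 2"
    using c by (simp add: c_def[symmetric] field_simps) (metis mult.assoc)
  finally show "(LINT \<omega>|?P. \<bar>\<Sum>i<n. X (\<omega> i)\<bar>) \<le> sqrt n * (B\<^sup>2 + 1) / 2" .
qed

text \<open>
  The weak law for a quotient of sums, in the mean. Where the denominator is 0 the variable \<open>r\<close> may take any
  value between 0 and 1; such \<open>\<omega>\<close> are rare because the mean of \<open>N\<close> is positive.
\<close>

theorem (in prob_space) law_of_large_numbers_ratio: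
  fixes C N :: "'a \<Rightarrow> real" and r :: "nat \<Rightarrow> (nat \<Rightarrow> 'a) \<Rightarrow> real"
  assumes Cm[measurable]: "C \<in> borel_measurable M" and Nm[measurable]: "N \<in> borel_measurable M"
    and CN: "\<And>s. s \<in> space M \<Longrightarrow> 0 \<le> C s \<and> C s \<le> N s"
    and bound: "AE s in M. N s \<le> B" and pos: "0 < (LINT s|M. N s)"
    and rm: "\<And>n. r n \<in> borel_measurable (PiM {..<n} (\<lambda>_. M))"
    and r01: "\<And>n \<omega>. \<omega> \<in> space (PiM {..<n} (\<lambda>_. M)) \<Longrightarrow> 0 \<le> r n \<omega> \<and> r n \<omega> \<le> 1"
    and req: "\<And>n \<omega>. \<omega> \<in> space (PiM {..<n} (\<lambda>_. M)) \<Longrightarrow> (\<Sum>i<n. N (\<omega> i)) \<noteq> 0 \<Longrightarrow>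
      r n \<omega> = (\<Sum>i<n. C (\<omega> i)) / (\<Sum>i<n. N (\<omega> i))"
  shows "(\<lambda>n. LINT \<omega>|PiM {..<n} (\<lambda>_. M). r n \<omega>) \<longlonglongrightarrow> (LINT s|M. C s) / (LINT s|M. N s)"
proof -
  define \<beta> where "\<beta> = (LINT s|M. N s)"
  \<comment> \<open>The variables X and Y below are centred, and the error of the quotient is bounded by their sums.\<close>
  define \<gamma> where "\<gamma> = (LINT s|M. C s) / \<beta>"
  have \<beta>: "0 < \<beta>" using pos by (simp add: \<beta>_def)
  have bC: "AE s in M. \<bar>C s\<bar> \<le> B" and bN: "AE s in M. \<bar>N s\<bar> \<le> B"
    using bound AE_space by (eventually_elim, use CN in force)+
  have iC: "integrable M C" and iN: "integrable M N"
    by (rule integrable_const_bound[where B=B]; use bC bN in simp)+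
  have "(LINT s|M. C s) \<le> \<beta>" unfolding \<beta>_def using CN iC iN by (intro integral_mono) auto
  moreover have "0 \<le> (LINT s|M. C s)" using CN by (intro integral_nonneg_AE AE_I2) auto
  ultimately have \<gamma>: "0 \<le> \<gamma>" "\<gamma> \<le> 1" using \<beta> by (auto simp: \<gamma>_def)
  define X where "X = (\<lambda>s. C s - \<gamma> * N s)"
  define Y where "Y = (\<lambda>s. N s - \<beta>)"
  have [measurable]: "X \<in> borel_measurable M" "Y \<in> borel_measurable M"
    unfolding X_def Y_def by measurable
  have "(LINT s|M. X s) = 0" using iC iN \<beta> by (simp add: X_def \<gamma>_def \<beta>_def[symmetric])
  have "(LINT s|M. Y s) = 0" using iN prob_space by (simp add: Y_def \<beta>_def)
  define D where "D = B + B + \<beta>"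
  have bX: "AE s in M. \<bar>X s\<bar> \<le> D"
    using bC bN
  proof eventually_elim
    case (elim s)
    have "\<bar>\<gamma> * N s\<bar> \<le> 1 * B" unfolding abs_mult using \<gamma> elim by (intro mult_mono) auto
    then show ?case using elim \<beta> by (simp add: X_def D_def)
  qed
  have bY: "AE s in M. \<bar>Y s\<bar> \<le> D"
    using bC bN by eventually_elim (use \<beta> in \<open>simp add: Y_def D_def\<close>)
  define K where "K = (D\<^sup>2 + 1) / 2"
  have est: "\<bar>(LINT \<omega>|PiM {..<n} (\<lambda>_. M). r n \<omega>) - \<gamma>\<bar> \<le> 4 / \<beta> * K / sqrt n" if n: "0 < n" for n
  proof -
    let ?P = "PiM {..<n} (\<lambda>_. M)"
    interpret P: prob_space ?P by (rule prob_space_PiM) (rule prob_space_axioms)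
    note SX = mean_abs_sum_le[OF \<open>X \<in> borel_measurable M\<close> bX \<open>(LINT s|M. X s) = 0\<close> n]
    note SY = mean_abs_sum_le[OF \<open>Y \<in> borel_measurable M\<close> bY \<open>(LINT s|M. Y s) = 0\<close> n]
    have ir: "integrable ?P (r n)"
      by (rule P.integrable_const_bound[where B=1]) (use r01[of _ n] rm in \<open>auto intro!: AE_I2\<close>)
    have pt: "\<bar>r n \<omega> - \<gamma>\<bar> \<le> 2 / (\<beta> * n) * (\<bar>\<Sum>i<n. X (\<omega> i)\<bar> + \<bar>\<Sum>i<n. Y (\<omega> i)\<bar>)" if \<omega>: "\<omega> \<in> space ?P" for \<omega>
    proof -
      define p where "p = (\<Sum>i<n. C (\<omega> i))"
      define q where "q = (\<Sum>i<n. N (\<omega> i))"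
      have X: "(\<Sum>i<n. X (\<omega> i)) = p - \<gamma> * q" by (simp add: X_def p_def q_def sum_subtractf sum_distrib_left)
      have Y: "(\<Sum>i<n. Y (\<omega> i)) = q - n * \<beta>" by (simp add: Y_def q_def sum_subtractf)
      have bn: "0 < \<beta> * n" using \<beta> n by simp
      show ?thesis
      proof (cases "q \<ge> \<beta> * n / 2")
        case True
        with bn have q: "0 < q" by linarith
        have "r n \<omega> = p / q" using req[OF \<omega>] q by (simp add: p_def q_def)
        then have "r n \<omega> - \<gamma> = (p - \<gamma> * q) / q" using q by (simp add: diff_divide_distrib)
        then have "\<bar>r n \<omega> - \<gamma>\<bar> = \<bar>p - \<gamma> * q\<bar> / q" using q by (simp only: abs_divide abs_of_pos)
        also have "\<dots> \<le> \<bar>p - \<gamma> * q\<bar> / (\<beta> * n / 2)" using True bn q by (intro divide_left_mono mult_pos_pos) auto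
        also have "\<dots> = 2 / (\<beta> * n) * \<bar>\<Sum>i<n. X (\<omega> i)\<bar>" by (simp add: X)
        also have "\<dots> \<le> 2 / (\<beta> * n) * (\<bar>\<Sum>i<n. X (\<omega> i)\<bar> + \<bar>\<Sum>i<n. Y (\<omega> i)\<bar>)"
          using bn by (intro mult_left_mono) auto
        finally show ?thesis .
      next
        case False
        then have "\<beta> * n / 2 \<le> n * \<beta> - q" using mult.commute[of \<beta> "real n"] by linarith
        also have "\<dots> \<le> \<bar>\<Sum>i<n. Y (\<omega> i)\<bar>" unfolding Y by linarith
        finally have "\<beta> * n / 2 \<le> \<bar>\<Sum>i<n. Y (\<omega> i)\<bar>" .
        then have "1 \<le> 2 / (\<beta> * n) * \<bar>\<Sum>i<n. Y (\<omega> i)\<bar>" using bn by (simp add: field_simps)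
        also have "\<dots> \<le> 2 / (\<beta> * n) * (\<bar>\<Sum>i<n. X (\<omega> i)\<bar> + \<bar>\<Sum>i<n. Y (\<omega> i)\<bar>)"
          using bn by (intro mult_left_mono) auto
        finally show ?thesis using r01[OF \<omega>] \<gamma> by linarith
      qed
    qed
    have "\<bar>(LINT \<omega>|?P. r n \<omega>) - \<gamma>\<bar> = \<bar>LINT \<omega>|?P. r n \<omega> - \<gamma>\<bar>"
      using ir P.prob_space by simp
    also have "\<dots> \<le> (LINT \<omega>|?P. \<bar>r n \<omega> - \<gamma>\<bar>)" by (rule integral_abs_bound)
    also have "\<dots> \<le> (LINT \<omega>|?P. 2 / (\<beta> * n) * (\<bar>\<Sum>i<n. X (\<omega> i)\<bar> + \<bar>\<Sum>i<n. Y (\<omega> i)\<bar>))"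
      using ir SX(1) SY(1) pt by (intro integral_mono) auto
    also have "\<dots> = 2 / (\<beta> * n) * ((LINT \<omega>|?P. \<bar>\<Sum>i<n. X (\<omega> i)\<bar>) + (LINT \<omega>|?P. \<bar>\<Sum>i<n. Y (\<omega> i)\<bar>))"
      using SX(1) SY(1) by simp
    also have "\<dots> \<le> 2 / (\<beta> * n) * (sqrt n * K + sqrt n * K)"
      using SX(2) SY(2) \<beta> n by (intro mult_left_mono add_mono) (auto simp: K_def)
    also have "\<dots> = 4 / \<beta> * K * (sqrt n / n)" by (simp add: field_simps)
    also have "sqrt n / n = 1 / sqrt n" using n by (simp add: real_div_sqrt field_simps)
    finally show ?thesis by simp
  qed
  have "(\<lambda>n. (LINT \<omega>|PiM {..<n} (\<lambda>_. M). r n \<omega>) - \<gamma>) \<longlonglongrightarrow> 0"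
  proof (rule Lim_null_comparison)
    show "\<forall>\<^sub>F n in sequentially. norm ((LINT \<omega>|PiM {..<n} (\<lambda>_. M). r n \<omega>) - \<gamma>) \<le> 4 / \<beta> * K / sqrt n"
      using eventually_gt_at_top[of 0] by eventually_elim (use est in simp)
    show "(\<lambda>n. 4 / \<beta> * K / sqrt (real n)) \<longlonglongrightarrow> 0" by real_asymp
  qed
  then show ?thesis by (simp add: LIM_zero_iff \<gamma>_def \<beta>_def)
qed

text \<open>
  In the applications \<open>W x s\<close> is, up to a factor with mean 1, the conditional probability of exceeding \<open>x\<close> given
  \<open>s\<close>, so \<open>L\<close> is a mixture. Its distribution function is right-continuous by dominated convergence.
\<close>

theorem (in prob_space) real_distribution_of_survival:
  fixes W :: "real \<Rightarrow> 'a \<Rightarrow> real"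
  assumes Wm: "\<And>x. W x \<in> borel_measurable M"
    and bound: "AE s in M. \<forall>x. 0 \<le> W x s \<and> W x s \<le> B"
    and anti: "\<And>x y s. s \<in> space M \<Longrightarrow> x \<le> y \<Longrightarrow> W y s \<le> W x s"
    and rc: "\<And>x s. s \<in> space M \<Longrightarrow> ((\<lambda>y. W y s) \<longlongrightarrow> W x s) (at_right x)"
    and neg: "\<And>x. x < 0 \<Longrightarrow> (LINT s|M. W x s) = 1"
    and large: "\<And>x. b \<le> x \<Longrightarrow> (LINT s|M. W x s) = 0"
  shows "\<exists>L. real_distribution L \<and> (\<forall>x. cdf L x = 1 - (LINT s|M. W x s))"
proof -
  define F where "F x = 1 - (LINT s|M. W x s)" for x
  have int: "integrable M (W x)" for x
    by (rule integrable_const_bound[where B=B]) (use bound Wm in \<open>auto elim: eventually_mono\<close>)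
  have mono: "F x \<le> F y" if "x \<le> y" for x y
    unfolding F_def using anti that int by (intro diff_left_mono integral_mono) auto
  have right: "continuous (at_right x) F" for x
    unfolding continuous_within
  proof (rule tendsto_at_right_sequentially[where b="x + 1"])
    fix S :: "nat \<Rightarrow> real" assume S: "\<And>n. x < S n" "S \<longlonglongrightarrow> x"
    have "filterlim S (at_right x) sequentially"
      using S by (auto simp: filterlim_at intro!: always_eventually)
    have "(\<lambda>n. LINT s|M. W (S n) s) \<longlonglongrightarrow> (LINT s|M. W x s)"
    proof (rule integral_dominated_convergence[where w="\<lambda>_. B"])
      show "AE s in M. (\<lambda>n. W (S n) s) \<longlonglongrightarrow> W x s"
        using rc filterlim_compose[OF _ \<open>filterlim S (at_right x) sequentially\<close>] by (intro AE_I2) blast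
      show "AE s in M. norm (W (S n) s) \<le> B" for n
        using bound by eventually_elim auto
    qed (use Wm in auto)
    then show "(\<lambda>n. F (S n)) \<longlonglongrightarrow> F x" unfolding F_def by (intro tendsto_diff tendsto_const)
  qed simp
  have bot: "(F \<longlongrightarrow> 0) at_bot"
    by (rule tendsto_eventually) (use neg in \<open>auto simp: F_def eventually_at_bot_dense intro!: exI[of _ 0]\<close>)
  have top: "(F \<longlongrightarrow> 1) at_top"
    by (rule tendsto_eventually) (use large in \<open>auto simp: F_def eventually_at_top_linorder intro!: exI[of _ b]\<close>)
  show ?thesis
    using real_distribution_interval_measure[OF mono right bot top] cdf_interval_measure[OF mono right bot]
    by (auto simp: F_def intro!: exI[of _ "interval_measure F"])
qed

section \<open>The law of the random bounce length\<close>

lemma measure_pick_uniformly_atMost: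
  "measure (pick_uniformly B) {..x} =
    1 - (if B = {#} then of_bool (x < 0) else real (size (filter_mset (\<lambda>g. x < g) B)) / real (size B))"
proof -
  define p where "p = (if B = {#} then return_pmf 0 else pmf_of_multiset B)"
  have "measure (pick_uniformly B) {..x} = measure (measure_pmf p) {..x}"
    unfolding pick_uniformly_def p_def[symmetric] by (subst measure_distr) auto
  also have "\<dots> = 1 - (if B = {#} then of_bool (x < 0) else real (size (filter_mset (\<lambda>g. x < g) B)) / real (size B))"
  proof (cases "B = {#}")
    case True
    then show ?thesis by (simp add: p_def measure_return_pmf not_less indicator_def)
  next
    case False
    have "measure (measure_pmf p) {..x} = measure (measure_pmf p) ({..x} \<inter> set_pmf p)"
      by (rule measure_Int_set_pmf[symmetric])
    also have "{..x} \<inter> set_pmf p = set_mset (filter_mset (\<lambda>g. g \<le> x) B)"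
      using False by (auto simp: p_def)
    also have "measure (measure_pmf p) \<dots> = (\<Sum>y\<in>set_mset (filter_mset (\<lambda>g. g \<le> x) B). pmf p y)"
      by (rule measure_measure_pmf_finite) simp
    also have "\<dots> = (\<Sum>y\<in>set_mset (filter_mset (\<lambda>g. g \<le> x) B). real (count (filter_mset (\<lambda>g. g \<le> x) B) y)) / real (size B)"
      unfolding sum_divide_distrib using False by (intro sum.cong) (auto simp: p_def)
    also have "(\<Sum>y\<in>set_mset (filter_mset (\<lambda>g. g \<le> x) B). real (count (filter_mset (\<lambda>g. g \<le> x) B) y))
        = real (size (filter_mset (\<lambda>g. g \<le> x) B))"
      by (simp add: size_multiset_overloaded_eq del: set_mset_filter)
    also have "real (size (filter_mset (\<lambda>g. g \<le> x) B)) = real (size B) - real (size (filter_mset (\<lambda>g. x < g) B))"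
    proof -
      have "size B = size (filter_mset (\<lambda>g. g \<le> x) B) + size (filter_mset (\<lambda>g. \<not> g \<le> x) B)"
        by (metis multiset_partition size_union)
      then show ?thesis by (simp add: not_le)
    qed
    finally show ?thesis using False by (simp add: diff_divide_distrib)
  qed
  finally show ?thesis .
qed

lemma prob_space_pick_uniformly: "prob_space (pick_uniformly B)"
  unfolding pick_uniformly_def by (rule prob_space.prob_space_distr) (auto intro: measure_pmf.prob_space_axioms)

lemma sets_pick_uniformly: "sets (pick_uniformly B) = sets borel"
  by (simp add: pick_uniformly_def)

lemma borel_measurable_vec:
  fixes f :: "'a \<Rightarrow> real^'n"
  assumes "\<And>i. (\<lambda>x. f x $ i) \<in> borel_measurable M"
  shows "f \<in> borel_measurable M"
  unfolding borel_measurable_euclidean_space[of f]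
  using assms by (auto simp: Basis_vec_def inner_axis)

locale billiard =
  fixes a :: "real^'n" and P :: "((real^'n) \<times> (real^'n)) measure"
  assumes a: "\<And>i. 0 < a $ i"
    and sets_P: "sets P = sets (restrict_space borel (cbox 0 a) \<Otimes>\<^sub>M restrict_space borel (sphere 0 1))"
begin

lemma space_P: "space P = cbox 0 a \<times> sphere 0 1"
  using sets_eq_imp_space_eq[OF sets_P] by (simp add: space_pair_measure space_restrict_space)

lemma fst_measurable[measurable]: "fst \<in> borel_measurable P" and snd_measurable[measurable]: "snd \<in> borel_measurable P"
proof -
  have "fst \<in> measurable (restrict_space borel (cbox 0 a) \<Otimes>\<^sub>M restrict_space borel (sphere 0 1)) (restrict_space borel (cbox 0 a))"
    "snd \<in> measurable (restrict_space borel (cbox 0 a) \<Otimes>\<^sub>M restrict_space borel (sphere (0::real^'n) 1)) (restrict_space borel (sphere 0 1))"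
    by measurable
  then have "fst \<in> measurable P (restrict_space borel (cbox 0 a))" "snd \<in> measurable P (restrict_space borel (sphere 0 1))"
    by (simp_all cong: measurable_cong_sets add: measurable_cong_sets[OF sets_P refl])
  then show "fst \<in> borel_measurable P" "snd \<in> borel_measurable P"
    by (auto simp: measurable_restrict_space2_iff)
qed

lemma measurable_P:
  assumes "f \<in> borel_measurable M" "g \<in> borel_measurable M"
    and "\<And>s. s \<in> space M \<Longrightarrow> f s \<in> cbox 0 a" "\<And>s. s \<in> space M \<Longrightarrow> norm (g s) = 1"
  shows "(\<lambda>s. (f s, g s)) \<in> measurable M P"
proof -
  have "(\<lambda>s. (f s, g s)) \<in> measurable M (restrict_space borel (cbox 0 a) \<Otimes>\<^sub>M restrict_space borel (sphere 0 1))"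
    using assms by (intro measurable_Pair measurable_restrict_space2) auto
  then show ?thesis by (simp cong: measurable_cong_sets add: measurable_cong_sets[OF refl sets_P])
qed

lemma exit_time_measurable[measurable]: "exit_time a \<in> borel_measurable P"
proof -
  have "{s \<in> space P. c \<le> exit_time a s} \<in> sets P" for c
  proof (cases "0 \<le> c")
    case True
    have "{s \<in> space P. c \<le> exit_time a s} = {s \<in> space P. fst s + c *\<^sub>R snd s \<in> cbox 0 a}"
    proof -
      have "c \<le> exit_time a s \<longleftrightarrow> fst s + c *\<^sub>R snd s \<in> cbox 0 a" if "s \<in> space P" for s
      proof -
        have "fst s \<in> cbox 0 a" "snd s \<noteq> 0" using that by (auto simp: space_P)
        from exit_time_ge_iff[OF this True] show ?thesis by simp
      qed
      then show ?thesis by auto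
    qed
    also have "\<dots> \<in> sets P"
    proof -
      have "(\<lambda>s. fst s + c *\<^sub>R snd s) \<in> borel_measurable P" by measurable
      from measurable_sets[OF this, of "cbox 0 a"] show ?thesis
        by (simp add: vimage_def Int_def conj_commute)
    qed
    finally show ?thesis .
  next
    case False
    then have "c \<le> exit_time a s" if "s \<in> space P" for s
      using exit_time_nonneg[of "fst s" a "snd s"] that by (force simp: space_P)
    then have "{s \<in> space P. c \<le> exit_time a s} = space P" by auto
    then show ?thesis by simp
  qed
  then show ?thesis by (simp add: borel_measurable_iff_ge)
qed

lemma bounce_measurable: "bounce a \<in> measurable P P"
proof -
  define y where "y s = fst s + exit_time a s *\<^sub>R snd s" for s
  define w where "w s = reflect a (y s) (snd s)" for s
  have b: "bounce a = (\<lambda>s. (y s, w s))"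
    by (auto simp: bounce_def y_def w_def Let_def fun_eq_iff)
  have y[measurable]: "y \<in> borel_measurable P" unfolding y_def by measurable
  have comp: "(\<lambda>s. f s $ i) \<in> borel_measurable P" if "f \<in> borel_measurable P" for f :: "_ \<Rightarrow> real^'n" and i
  proof -
    have "(\<lambda>x::real^'n. x $ i) \<in> borel_measurable borel"
      by (intro borel_measurable_continuous_onI continuous_intros)
    from measurable_compose[OF that this] show ?thesis .
  qed
  have w: "w \<in> borel_measurable P"
  proof (rule borel_measurable_vec)
    fix i
    note [measurable] = comp[OF y] comp[OF snd_measurable]
    show "(\<lambda>s. w s $ i) \<in> borel_measurable P"
      unfolding w_def reflect_def vec_lambda_beta by measurable
  qed
  show ?thesis unfolding b
  proof (rule measurable_P[OF y w])
    fix s assume s: "s \<in> space P"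
    then have s': "fst s \<in> cbox 0 a" "norm (snd s) = 1" "snd s \<noteq> 0" by (auto simp: space_P)
    show "y s \<in> cbox 0 a" using bounce_stays(1)[OF s'(1,3)] by (simp add: b)
    have "\<bar>w s $ i\<bar> = \<bar>snd s $ i\<bar>" for i using bounce_stays(2)[OF s'(1,3)] by (simp add: b)
    then have "norm (w s) = norm (snd s)" by (simp add: norm_vec_def L2_set_def)
    then show "norm (w s) = 1" using s' by simp
  qed
qed

lemma funpow_bounce_measurable: "(bounce a ^^ k) \<in> measurable P P"
proof (induction k)
  case (Suc k)
  from measurable_comp[OF Suc bounce_measurable] show ?case by (simp add: comp_def)
qed simp

lemma flight_measurable[measurable]: "(\<lambda>s. flight a s k) \<in> borel_measurable P"
  unfolding flight_def by (rule measurable_compose[OF funpow_bounce_measurable exit_time_measurable])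

lemma bounce_time_measurable[measurable]: "(\<lambda>s. bounce_time a s k) \<in> borel_measurable P"
  unfolding bounce_time_def by measurable

lemma long_flights_measurable[measurable]: "(\<lambda>s. real (long_flights a R x s)) \<in> borel_measurable P"
proof -
  define A where "A s = {k. bounce_time a s (Suc k) \<le> R}" for s
  \<comment> \<open>If all bounce times stay below R, the multiset of flights is empty by the convention for infinite sets; the first condition makes S empty as well.\<close>
  define S where "S s = {k. (\<exists>m. \<forall>j. bounce_time a s (Suc j) \<le> R \<longrightarrow> j \<le> m) \<and>
    bounce_time a s (Suc k) \<le> R \<and> x < flight a s (Suc k)}" for s
  have fin: "finite (A s) \<longleftrightarrow> (\<exists>m. \<forall>j. bounce_time a s (Suc j) \<le> R \<longrightarrow> j \<le> m)" for s
    unfolding A_def finite_nat_set_iff_bounded_le by auto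
  have "long_flights a R x s = card (S s)" for s
  proof (cases "finite (A s)")
    case True
    then show ?thesis
      using fin[of s] by (simp add: long_flights_def bounce_lengths_def S_def filter_mset_image_mset A_def[symmetric])
        (auto simp: A_def intro!: arg_cong[where f=card])
  next
    case False
    then show ?thesis
      using fin[of s] by (simp add: long_flights_def bounce_lengths_def S_def A_def[symmetric])
  qed
  moreover have "(\<lambda>s. card (S s)) \<in> measurable P (count_space UNIV)"
    by (rule measurable_card) (simp add: S_def)
  ultimately show ?thesis by simp
qed

lemma long_flights_le_total: "long_flights a R x s \<le> size (bounce_lengths a R s)"
  by (simp add: long_flights_def)

lemma long_flights_neg:
  assumes s: "s \<in> space P" and "x < 0"
  shows "long_flights a R x s = size (bounce_lengths a R s)"
proof -
  have "0 \<le> flight a s k" for k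
    using flight_nonneg[of "fst s" a "snd s"] s by (force simp: space_P)
  then have "filter_mset (\<lambda>g. x < g) (bounce_lengths a R s) = bounce_lengths a R s"
    using \<open>x < 0\<close> unfolding filter_mset_eq_conv by (auto simp: bounce_lengths_def intro: less_le_trans)
  then show ?thesis by (simp add: long_flights_def)
qed

lemma long_flights_antimono: "x \<le> y \<Longrightarrow> long_flights a R y s \<le> long_flights a R x s"
  unfolding long_flights_def by (intro size_mset_mono filter_mset_mono_strong) auto

lemma long_flights_eq_0:
  assumes s: "s \<in> space P" and "R \<le> x"
  shows "long_flights a R x s = 0"
proof -
  have nn: "0 \<le> flight a s k" for k
    using flight_nonneg[of "fst s" a "snd s"] s by (force simp: space_P)
  have "\<not> x < flight a s (Suc k)" if "bounce_time a s (Suc k) \<le> R" for k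
  proof -
    have "flight a s (Suc k) \<le> bounce_time a s (Suc k)"
      unfolding bounce_time_def using nn by (intro member_le_sum) auto
    with that \<open>R \<le> x\<close> show ?thesis by linarith
  qed
  then have none: "{k \<in> {k. bounce_time a s (Suc k) \<le> R}. x < flight a s (Suc k)} = {}" by auto
  have "filter_mset (\<lambda>g. x < g) (bounce_lengths a R s) = {#}"
    by (cases "finite {k. bounce_time a s (Suc k) \<le> R}")
      (simp_all only: bounce_lengths_def filter_mset_image_mset filter_mset_mset_set none
        mset_set.infinite mset_set.empty image_mset_empty filter_empty_mset not_False_eq_True)
  then show ?thesis by (simp add: long_flights_def)
qed

lemma long_flights_right_continuous:
  "((\<lambda>y. real (long_flights a R y s)) \<longlongrightarrow> real (long_flights a R x s)) (at_right x)"
proof -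
  have "\<forall>\<^sub>F y in at_right x. size (filter_mset (\<lambda>g. y < g) B) = size (filter_mset (\<lambda>g. x < g) B)" for B
  proof (induction B)
    case (add g B)
    have "\<forall>\<^sub>F y in at_right x. y < g \<longleftrightarrow> x < g"
    proof (cases "x < g")
      case True
      then have "\<forall>\<^sub>F y in at_right x. y < g" by (intro eventually_at_rightI[of x g]) auto
      with True show ?thesis by simp
    next
      case False
      have "\<forall>\<^sub>F y in at_right x. x < y" by (rule eventually_at_right_less)
      then show ?thesis by eventually_elim (use False in auto)
    qed
    with add show ?case by eventually_elim simp
  qed simp
  then have "\<forall>\<^sub>F y in at_right x. real (long_flights a R y s) = real (long_flights a R x s)"
    unfolding long_flights_def by (auto elim: eventually_mono)
  then show ?thesis by (rule tendsto_eventually)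
qed

text \<open>
  The conditional probability, given the initial states \<open>\<omega>\<close> of all particles, that the picked flight is
  longer than \<open>x\<close>. With the threshold \<open>-1\<close> all flights are counted. If there is none, the picked value is 0.
\<close>

definition pooled_ratio :: "nat \<Rightarrow> real \<Rightarrow> real \<Rightarrow> (nat \<Rightarrow> (real^'n) \<times> (real^'n)) \<Rightarrow> real" where
  "pooled_ratio M R x \<omega> =
     (if (\<Sum>i<M. real (long_flights a R (-1) (\<omega> i))) = 0 then of_bool (x < 0)
      else (\<Sum>i<M. real (long_flights a R x (\<omega> i))) / (\<Sum>i<M. real (long_flights a R (-1) (\<omega> i))))"

lemma pooled_ratio_measurable: "pooled_ratio M R x \<in> borel_measurable (PiM {..<M} (\<lambda>_. P))"
proof -
  have [measurable]: "(\<lambda>\<omega>. real (long_flights a R y (\<omega> i))) \<in> borel_measurable (PiM {..<M} (\<lambda>_. P))" if "i \<in> {..<M}" for i y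
    by (rule measurable_compose[OF measurable_component_singleton[OF that] long_flights_measurable])
  show ?thesis unfolding pooled_ratio_def by measurable
qed

lemma pooled_ratio_bounds:
  assumes "\<omega> \<in> space (PiM {..<M} (\<lambda>_. P))"
  shows "0 \<le> pooled_ratio M R x \<omega> \<and> pooled_ratio M R x \<omega> \<le> 1"
proof -
  have "long_flights a R x (\<omega> i) \<le> long_flights a R (-1) (\<omega> i)" if "i < M" for i
  proof -
    have "\<omega> i \<in> space P" using assms that by (auto simp: space_PiM)
    then show ?thesis
      using long_flights_le_total[of R x "\<omega> i"] long_flights_neg[of "\<omega> i" "-1" R] by simp
  qed
  then have "(\<Sum>i<M. real (long_flights a R x (\<omega> i))) \<le> (\<Sum>i<M. real (long_flights a R (-1) (\<omega> i)))"
    by (intro sum_mono) auto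
  moreover have "0 \<le> (\<Sum>i<M. real (long_flights a R x (\<omega> i)))" by (intro sum_nonneg) auto
  ultimately show ?thesis
    by (auto simp: pooled_ratio_def divide_le_eq_1)
qed

lemma measure_pick_pooled:
  assumes "\<omega> \<in> space (PiM {..<M} (\<lambda>_. P))"
  shows "measure (pick_uniformly (\<Sum>i<M. bounce_lengths a R (\<omega> i))) {..x} = 1 - pooled_ratio M R x \<omega>"
proof -
  have N: "size (bounce_lengths a R (\<omega> i)) = long_flights a R (-1) (\<omega> i)" if "i < M" for i
  proof -
    have "\<omega> i \<in> space P" using assms that by (auto simp: space_PiM)
    then show ?thesis using long_flights_neg[of "\<omega> i" "-1" R] by simp
  qed
  have fs: "size (filter_mset Q (\<Sum>i\<in>I. B i)) = (\<Sum>i\<in>I. size (filter_mset Q (B i)))" for Q and B :: "nat \<Rightarrow> real multiset" and I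
    by (induction I rule: infinite_finite_induct) auto
  have e: "(\<Sum>i<M. bounce_lengths a R (\<omega> i)) = {#} \<longleftrightarrow> (\<Sum>i<M. real (long_flights a R (-1) (\<omega> i))) = 0"
  proof -
    have "(\<Sum>i<M. bounce_lengths a R (\<omega> i)) = {#} \<longleftrightarrow> size (\<Sum>i<M. bounce_lengths a R (\<omega> i)) = 0"
      by (simp only: size_eq_0_iff_empty)
    also have "size (\<Sum>i<M. bounce_lengths a R (\<omega> i)) = (\<Sum>i<M. long_flights a R (-1) (\<omega> i))"
      using N by simp
    finally show ?thesis by (simp only: of_nat_sum[symmetric] of_nat_eq_0_iff)
  qed
  show ?thesis
    unfolding measure_pick_uniformly_atMost pooled_ratio_def e using N by (simp add: fs long_flights_def[symmetric])
qed

text \<open>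
  Half-lines generate the Borel sets, and on them the kernel is given by \<open>pooled_ratio\<close>.
\<close>

lemma pick_pooled_measurable:
  fixes M :: nat
  shows
  "(\<lambda>\<omega>. pick_uniformly (\<Sum>i<M. bounce_lengths a R (\<omega> i))) \<in> measurable (PiM {..<M} (\<lambda>_. P)) (subprob_algebra borel)"
proof (rule measurable_subprob_algebra_generated[where \<Omega>=UNIV and G="range atMost"])
  show "sets borel = sigma_sets UNIV (range (atMost :: real \<Rightarrow> real set))"
    by (simp add: borel_eq_atMost)
  show "Int_stable (range (atMost :: real \<Rightarrow> real set))"
    by (auto simp: Int_stable_def)
  show "subprob_space (pick_uniformly B)" for B
    by (rule prob_space_imp_subprob_space[OF prob_space_pick_uniformly])
  fix A :: "real set" assume "A \<in> range atMost"
  then obtain x where A: "A = {..x}" by auto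
  have "(\<lambda>\<omega>. ennreal (1 - pooled_ratio M R x \<omega>)) \<in> borel_measurable (PiM {..<M} (\<lambda>_. P))"
    using pooled_ratio_measurable by measurable
  then show "(\<lambda>\<omega>. emeasure (pick_uniformly (\<Sum>i<M. bounce_lengths a R (\<omega> i))) A) \<in> borel_measurable (PiM {..<M} (\<lambda>_. P))"
  proof (subst measurable_cong)
    fix \<omega> assume \<omega>: "\<omega> \<in> space (PiM {..<M} (\<lambda>_. P))"
    interpret prob_space "pick_uniformly (\<Sum>i<M. bounce_lengths a R (\<omega> i))" by (rule prob_space_pick_uniformly)
    show "emeasure (pick_uniformly (\<Sum>i<M. bounce_lengths a R (\<omega> i))) A = ennreal (1 - pooled_ratio M R x \<omega>)"
      unfolding A emeasure_eq_measure measure_pick_pooled[OF \<omega>] ..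
  qed
next
  have "emeasure (pick_uniformly B) UNIV = 1" for B
    using prob_space.emeasure_space_1[OF prob_space_pick_uniformly[of B]] sets_eq_imp_space_eq[OF sets_pick_uniformly[of B]] by simp
  then show "(\<lambda>\<omega>. emeasure (pick_uniformly (\<Sum>i<M. bounce_lengths a R (\<omega> i))) UNIV) \<in> borel_measurable (PiM {..<M} (\<lambda>_. P))"
    by simp
qed (auto simp: sets_pick_uniformly)

lemma cdf_pooled:
  assumes "prob_space P"
  shows "cdf (bind (PiM {..<M} (\<lambda>_. P)) (\<lambda>\<omega>. pick_uniformly (\<Sum>i<M. bounce_lengths a R (\<omega> i)))) x
    = 1 - (LINT \<omega>|PiM {..<M} (\<lambda>_. P). pooled_ratio M R x \<omega>)"
proof -
  let ?Q = "PiM {..<M} (\<lambda>_. P)"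
  interpret Q: prob_space ?Q by (rule prob_space_PiM) (rule assms)
  have "cdf (bind ?Q (\<lambda>\<omega>. pick_uniformly (\<Sum>i<M. bounce_lengths a R (\<omega> i)))) x
      = (LINT \<omega>|?Q. measure (pick_uniformly (\<Sum>i<M. bounce_lengths a R (\<omega> i))) {..x})"
    unfolding cdf_def by (rule Q.measure_bind[OF pick_pooled_measurable]) simp
  also have "\<dots> = (LINT \<omega>|?Q. 1 - pooled_ratio M R x \<omega>)"
    by (rule Bochner_Integration.integral_cong[OF refl]) (rule measure_pick_pooled)
  also have "\<dots> = 1 - (LINT \<omega>|?Q. pooled_ratio M R x \<omega>)"
  proof -
    have "integrable ?Q (pooled_ratio M R x)"
      by (rule Q.integrable_const_bound[where B=1]) (use pooled_ratio_bounds[of _ M R x] pooled_ratio_measurable in \<open>auto intro!: AE_I2\<close>)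
    then show ?thesis using Q.prob_space by simp
  qed
  finally show ?thesis .
qed

end

section \<open>The two iterated limits\<close>

locale random_billiard =
  fixes a :: "real^'n" and \<mu> :: "(real^'n) measure"
  assumes dim: "CARD('n) \<ge> 2" and sides: "\<And>i. 0 < a $ i"
    and prob_\<mu>: "prob_space \<mu>" and sets_\<mu>: "sets \<mu> = sets (restrict_space borel (cbox 0 a))"
begin

abbreviation start :: "((real^'n) \<times> (real^'n)) measure" where
  "start \<equiv> \<mu> \<Otimes>\<^sub>M uniform_direction"

sublocale billiard a start
  by unfold_locales (auto intro!: sides sets_pair_measure_cong simp: sets_\<mu>)

sublocale start: prob_space start
proof -
  interpret \<mu>: prob_space \<mu> by (rule prob_\<mu>)
  interpret U: prob_space "uniform_direction :: (real^'n) measure" by (rule prob_space_uniform_direction)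
  interpret pair_prob_space \<mu> "uniform_direction :: (real^'n) measure" ..
  show "prob_space start" by (rule prob_space_axioms)
qed

lemma distr_snd_start: "distr start uniform_direction snd = uniform_direction"
proof (rule measure_eqI)
  interpret \<mu>: prob_space \<mu> by (rule prob_\<mu>)
  interpret U: prob_space "uniform_direction :: (real^'n) measure" by (rule prob_space_uniform_direction)
  fix A assume "A \<in> sets (distr start uniform_direction snd)"
  then have A: "A \<in> sets uniform_direction" by simp
  have "snd -` A \<inter> space start = space \<mu> \<times> A"
    using sets.sets_into_space[OF A] by (auto simp: space_pair_measure)
  then have "emeasure (distr start uniform_direction snd) A = emeasure start (space \<mu> \<times> A)"
    using A by (simp add: emeasure_distr)
  also have "\<dots> = emeasure uniform_direction A"
    using A by (simp add: U.emeasure_pair_measure_Times \<mu>.emeasure_space_1)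
  finally show "emeasure (distr start uniform_direction snd) A = emeasure uniform_direction A" .
qed simp

lemma AE_start_direction:
  fixes Q :: "real^'n \<Rightarrow> bool"
  assumes "AE v in uniform_direction. Q v"
  shows "AE s in start. Q (snd s)"
proof -
  have "AE v in distr start uniform_direction snd. Q v"
    unfolding distr_snd_start by (rule assms)
  from AE_distrD[OF measurable_snd this] show ?thesis .
qed

definition rate :: "real \<Rightarrow> (real^'n) \<times> (real^'n) \<Rightarrow> real" where
  "rate x s = flight_rate (crossing_rate a (snd s)) x"

lemma rate_measurable[measurable]: "rate x \<in> borel_measurable start"
  unfolding rate_def by (rule measurable_compose[OF snd_measurable flight_rate_measurable])

lemma rate_properties:
  assumes s: "s \<in> space start"
  shows "0 \<le> rate x s" "rate x s \<le> (\<Sum>i\<in>UNIV. 1 / a $ i)" "0 < rate (-1) s"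
    "y \<le> x \<Longrightarrow> rate x s \<le> rate y s" "x < 0 \<Longrightarrow> rate x s = rate (-1) s"
    "((\<lambda>y. rate y s) \<longlongrightarrow> rate x s) (at_right x)" "CARD('n) * (\<Sum>i\<in>UNIV. a $ i) \<le> x \<Longrightarrow> rate x s = 0"
proof -
  have v: "norm (snd s) = 1" using s by (auto simp: space_P)
  have nn: "0 \<le> crossing_rate a (snd s) i" for i by (rule crossing_rate_nonneg[OF sides])
  have A: "0 < (\<Sum>i\<in>UNIV. a $ i)" using sides by (intro sum_pos) auto
  show "0 \<le> rate x s" "rate x s \<le> (\<Sum>i\<in>UNIV. 1 / a $ i)"
    unfolding rate_def by (rule flight_rate_crossing_bounds[OF sides v])+
  have ge: "1 / (\<Sum>i\<in>UNIV. a $ i) \<le> sum (crossing_rate a (snd s)) UNIV" by (rule sum_crossing_rate_ge[OF sides v])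
  moreover have "0 < 1 / (\<Sum>i\<in>UNIV. a $ i)" using A by simp
  ultimately show "0 < rate (-1) s" by (simp add: rate_def flight_rate_neg del: zero_less_divide_1_iff)
  show "rate x s \<le> rate y s" if "y \<le> x" unfolding rate_def by (rule flight_rate_antimono[OF nn that])
  show "rate x s = rate (-1) s" if "x < 0" using that by (simp add: rate_def flight_rate_neg)
  show "((\<lambda>y. rate y s) \<longlongrightarrow> rate x s) (at_right x)"
    unfolding rate_def by (rule flight_rate_right_continuous[OF nn])
  show "rate x s = 0" if x: "CARD('n) * (\<Sum>i\<in>UNIV. a $ i) \<le> x"
  proof -
    have "\<exists>i. 1 / (CARD('n) * (\<Sum>i\<in>UNIV. a $ i)) \<le> crossing_rate a (snd s) i"
    proof (rule ccontr)
      assume "\<nexists>i. 1 / (CARD('n) * (\<Sum>i\<in>UNIV. a $ i)) \<le> crossing_rate a (snd s) i"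
      then have "sum (crossing_rate a (snd s)) UNIV < (\<Sum>i::'n\<in>UNIV. 1 / (CARD('n) * (\<Sum>i\<in>UNIV. a $ i)))"
        by (intro sum_strict_mono) (auto simp: not_le)
      also have "\<dots> = 1 / (\<Sum>i\<in>UNIV. a $ i)" by simp
      finally show False using ge by simp
    qed
    then obtain i where i: "1 / (CARD('n) * (\<Sum>i\<in>UNIV. a $ i)) \<le> crossing_rate a (snd s) i" by blast
    have D: "0 < CARD('n) * (\<Sum>i\<in>UNIV. a $ i)" using A by simp
    have "1 \<le> crossing_rate a (snd s) i * (CARD('n) * (\<Sum>i\<in>UNIV. a $ i))"
      using i D by (simp only: pos_divide_le_eq)
    also have "\<dots> \<le> crossing_rate a (snd s) i * x" using x nn by (intro mult_left_mono) auto
    also have "\<dots> = x * crossing_rate a (snd s) i" by (rule mult.commute)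
    finally have "1 \<le> x * crossing_rate a (snd s) i" .
    then show ?thesis using x D unfolding rate_def by (intro flight_rate_eq_0) auto
  qed
qed

lemma integral_rate: "(LINT s|start. rate x s) = mean_flight_rate a x"
proof -
  have "(LINT s|start. rate x s) = (LINT v|distr start uniform_direction snd. flight_rate (crossing_rate a v) x)"
    unfolding rate_def by (rule integral_distr[symmetric]) (auto intro!: borel_measurable_sphere)
  then show ?thesis by (simp add: distr_snd_start mean_flight_rate_def)
qed

text \<open>
  Position and direction are independent, so conditions on the direction that hold almost everywhere on the
  sphere hold almost surely for the initial state, whatever \<open>\<mu>\<close> is.
\<close>

lemma AE_long_flights_rate:
  "AE s in start. ((\<lambda>R. real (long_flights a R x s) / R) \<longlongrightarrow> rate x s) at_top"
  using AE_start_direction[OF AE_generic_direction(2)[OF sides]]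
    AE_start_direction[OF AE_crossing_rate_neq(2)[OF dim sides, where x=x]] AE_space
proof eventually_elim
  case (elim s)
  then show ?case
    using long_flights_rate[OF sides, of "fst s" "snd s" x]
    by (auto simp: space_P rate_def generic_direction_def crossing_rate_def)
qed

lemma AE_long_flights_le:
  "AE s in start. \<forall>R\<ge>0. \<forall>x. real (long_flights a R x s) \<le> R * (\<Sum>i\<in>UNIV. 1 / a $ i) + CARD('n)"
  using AE_start_direction[OF AE_generic_direction(2)[OF sides]] AE_space
proof eventually_elim
  case (elim s)
  show ?case
  proof (intro allI impI)
    fix R x :: real assume R: "0 \<le> R"
    have v: "norm (snd s) = 1" using elim by (auto simp: space_P)
    have "real (long_flights a R x s) \<le> real (size (bounce_lengths a R s))"
      using long_flights_le_total by simp
    also have "\<dots> \<le> R * sum (crossing_rate a (snd s)) UNIV + CARD('n)"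
      using size_bounce_lengths_le[OF sides _ _ R, of "fst s" "snd s"] elim
      by (auto simp: space_P generic_direction_def crossing_rate_def)
    also have "\<dots> \<le> R * (\<Sum>i\<in>UNIV. 1 / a $ i) + CARD('n)"
      using sum_crossing_rate_le[OF sides v] R by (intro add_right_mono mult_left_mono) auto
    finally show "real (long_flights a R x s) \<le> R * (\<Sum>i\<in>UNIV. 1 / a $ i) + CARD('n)" .
  qed
qed

lemma cdf_bounce_law: "cdf (bounce_law a \<mu> M R) x = 1 - (LINT \<omega>|PiM {..<M} (\<lambda>_. start). pooled_ratio M R x \<omega>)"
  unfolding bounce_law_def by (rule cdf_pooled[OF start.prob_space_axioms])

text \<open>
  The limit of \<open>pooled_ratio\<close> for \<open>R \<rightarrow> \<infinity>\<close>.
\<close>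

definition rate_ratio :: "nat \<Rightarrow> real \<Rightarrow> (nat \<Rightarrow> (real^'n) \<times> (real^'n)) \<Rightarrow> real" where
  "rate_ratio M x \<omega> = (\<Sum>i<M. rate x (\<omega> i)) / (\<Sum>i<M. rate (-1) (\<omega> i))"

lemma rate_ratio_measurable: "rate_ratio M x \<in> borel_measurable (PiM {..<M} (\<lambda>_. start))"
proof -
  have [measurable]: "(\<lambda>\<omega>. rate y (\<omega> i)) \<in> borel_measurable (PiM {..<M} (\<lambda>_. start))" if "i \<in> {..<M}" for i y
    by (rule measurable_compose[OF measurable_component_singleton[OF that] rate_measurable])
  show ?thesis unfolding rate_ratio_def by measurable
qed

lemma sum_rate_pos:
  fixes M :: nat
  assumes "\<omega> \<in> space (PiM {..<M} (\<lambda>_. start))" "0 < M"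
  shows "0 < (\<Sum>i<M. rate (-1) (\<omega> i))"
  using assms by (intro sum_pos rate_properties(3)) (auto simp: space_PiM)

lemma rate_ratio_bounds:
  assumes \<omega>: "\<omega> \<in> space (PiM {..<M} (\<lambda>_. start))"
  shows "0 \<le> rate_ratio M x \<omega> \<and> rate_ratio M x \<omega> \<le> 1"
proof (cases "M = 0")
  case False
  have sp: "\<omega> i \<in> space start" if "i < M" for i using \<omega> that by (auto simp: space_PiM)
  have "rate x (\<omega> i) \<le> rate (-1) (\<omega> i)" if "i < M" for i
    using rate_properties(4)[OF sp[OF that], of "min x (-1)" x] rate_properties(5)[OF sp[OF that], of "min x (-1)"] by simp
  then have "(\<Sum>i<M. rate x (\<omega> i)) \<le> (\<Sum>i<M. rate (-1) (\<omega> i))" by (intro sum_mono) auto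
  moreover have "0 \<le> (\<Sum>i<M. rate x (\<omega> i))" using rate_properties(1)[OF sp] by (intro sum_nonneg) auto
  ultimately show ?thesis using sum_rate_pos[OF \<omega>] False by (simp add: rate_ratio_def)
qed (simp add: rate_ratio_def)

lemma pooled_ratio_tendsto:
  assumes M: "0 < M"
  shows "((\<lambda>R. LINT \<omega>|PiM {..<M} (\<lambda>_. start). pooled_ratio M R x \<omega>)
    \<longlongrightarrow> (LINT \<omega>|PiM {..<M} (\<lambda>_. start). rate_ratio M x \<omega>)) at_top"
proof -
  let ?Q = "PiM {..<M} (\<lambda>_. start)"
  interpret Q: prob_space ?Q by (rule prob_space_PiM) (rule start.prob_space_axioms)
  show ?thesis
  proof (rule integral_dominated_convergence_at_top[where w="\<lambda>_. 1"])
    have AE: "AE \<omega> in ?Q. \<forall>i\<in>{..<M}. ((\<lambda>R. real (long_flights a R y (\<omega> i)) / R) \<longlongrightarrow> rate y (\<omega> i)) at_top" for y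
      using AE_long_flights_rate[of y]
      by (intro AE_finite_allI AE_PiM_component) (auto intro: start.prob_space_axioms)
    show "AE \<omega> in ?Q. ((\<lambda>R. pooled_ratio M R x \<omega>) \<longlongrightarrow> rate_ratio M x \<omega>) at_top"
      using AE[of x] AE[of "-1"] AE_space
    proof eventually_elim
      case (elim \<omega>)
      define p where "p R = (\<Sum>i<M. real (long_flights a R x (\<omega> i)))" for R
      define q where "q R = (\<Sum>i<M. real (long_flights a R (-1) (\<omega> i)))" for R
      have p: "((\<lambda>R. p R / R) \<longlongrightarrow> (\<Sum>i<M. rate x (\<omega> i))) at_top"
        unfolding p_def sum_divide_distrib using elim by (intro tendsto_sum) auto
      have q: "((\<lambda>R. q R / R) \<longlongrightarrow> (\<Sum>i<M. rate (-1) (\<omega> i))) at_top"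
        unfolding q_def sum_divide_distrib using elim by (intro tendsto_sum) auto
      have pos: "0 < (\<Sum>i<M. rate (-1) (\<omega> i))" using sum_rate_pos[OF _ M] elim by blast
      have lim: "((\<lambda>R. (p R / R) / (q R / R)) \<longlongrightarrow> rate_ratio M x \<omega>) at_top"
        unfolding rate_ratio_def by (rule tendsto_divide[OF p q]) (use pos in simp)
      have "\<forall>\<^sub>F R in at_top. 0 < q R / R" by (rule order_tendstoD(1)[OF q pos])
      then have "\<forall>\<^sub>F R in at_top. (p R / R) / (q R / R) = pooled_ratio M R x \<omega>"
        using eventually_gt_at_top[of "0::real"]
      proof eventually_elim
        case (elim R)
        then have "q R \<noteq> 0" by auto
        then have "pooled_ratio M R x \<omega> = p R / q R" by (simp add: pooled_ratio_def p_def q_def)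
        then show ?case using elim by simp
      qed
      with lim show ?case by (rule Lim_transform_eventually)
    qed
    show "\<forall>\<^sub>F R in at_top. AE \<omega> in ?Q. norm (pooled_ratio M R x \<omega>) \<le> 1"
      using pooled_ratio_bounds by (intro always_eventually allI AE_I2) auto
  qed (auto intro: rate_ratio_measurable pooled_ratio_measurable)
qed

lemma limit_law_long_time:
  assumes M: "0 < M"
  shows "\<exists>L. real_distribution L \<and> (\<forall>x. cdf L x = 1 - (LINT \<omega>|PiM {..<M} (\<lambda>_. start). rate_ratio M x \<omega>))"
proof -
  let ?Q = "PiM {..<M} (\<lambda>_. start)"
  interpret Q: prob_space ?Q by (rule prob_space_PiM) (rule start.prob_space_axioms)
  have sp: "\<omega> i \<in> space start" if "\<omega> \<in> space ?Q" "i < M" for \<omega> i using that by (auto simp: space_PiM)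
  show ?thesis
  proof (rule Q.real_distribution_of_survival[where B=1 and b="CARD('n) * (\<Sum>i\<in>UNIV. a $ i)"])
    show "rate_ratio M x \<in> borel_measurable ?Q" for x by (rule rate_ratio_measurable)
    show "AE \<omega> in ?Q. \<forall>x. 0 \<le> rate_ratio M x \<omega> \<and> rate_ratio M x \<omega> \<le> 1"
      using rate_ratio_bounds by (intro AE_I2) auto
    fix x y :: real
    show "rate_ratio M y \<omega> \<le> rate_ratio M x \<omega>" if "\<omega> \<in> space ?Q" "x \<le> y" for \<omega>
      unfolding rate_ratio_def using that sum_rate_pos[OF that(1) M] sp[OF that(1)]
      by (intro divide_right_mono sum_mono rate_properties(4)) auto
    show "((\<lambda>y. rate_ratio M y \<omega>) \<longlongrightarrow> rate_ratio M x \<omega>) (at_right x)" if "\<omega> \<in> space ?Q" for \<omega>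
      unfolding rate_ratio_def using that sum_rate_pos[OF that M] sp[OF that]
      by (intro tendsto_divide tendsto_sum tendsto_const rate_properties(6)) auto
    show "(LINT \<omega>|?Q. rate_ratio M x \<omega>) = 1" if "x < 0"
    proof -
      have "rate_ratio M x \<omega> = 1" if \<omega>: "\<omega> \<in> space ?Q" for \<omega>
      proof -
        have "(\<Sum>i<M. rate x (\<omega> i)) = (\<Sum>i<M. rate (-1) (\<omega> i))"
          using sp[OF \<omega>] \<open>x < 0\<close> by (intro sum.cong rate_properties(5)) auto
        then show ?thesis using sum_rate_pos[OF \<omega> M] by (simp add: rate_ratio_def)
      qed
      then have "(LINT \<omega>|?Q. rate_ratio M x \<omega>) = (LINT \<omega>|?Q. 1)" by (intro Bochner_Integration.integral_cong) auto
      then show ?thesis using Q.prob_space by simp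
    qed
    show "(LINT \<omega>|?Q. rate_ratio M x \<omega>) = 0" if "CARD('n) * (\<Sum>i\<in>UNIV. a $ i) \<le> x"
    proof -
      have "rate_ratio M x \<omega> = 0" if \<omega>: "\<omega> \<in> space ?Q" for \<omega>
        using rate_properties(7)[OF sp[OF \<omega>] \<open>_ \<le> x\<close>] by (simp add: rate_ratio_def)
      then have "(LINT \<omega>|?Q. rate_ratio M x \<omega>) = (LINT \<omega>|?Q. 0)" by (intro Bochner_Integration.integral_cong) auto
      then show ?thesis by simp
    qed
  qed
qed

lemma rate_ratio_tendsto:
  "(\<lambda>M. LINT \<omega>|PiM {..<M} (\<lambda>_. start). rate_ratio M x \<omega>) \<longlonglongrightarrow> mean_flight_rate a x / mean_flight_rate a (-1)"
proof -
  have "(\<lambda>M. LINT \<omega>|PiM {..<M} (\<lambda>_. start). rate_ratio M x \<omega>) \<longlonglongrightarrow> (LINT s|start. rate x s) / (LINT s|start. rate (-1) s)"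
  proof (rule start.law_of_large_numbers_ratio[where B="\<Sum>i\<in>UNIV. 1 / a $ i"])
    show "0 \<le> rate x s \<and> rate x s \<le> rate (-1) s" if "s \<in> space start" for s
      using rate_properties(1)[OF that, of x] rate_properties(4)[OF that, of "min x (-1)" x] rate_properties(5)[OF that, of "min x (-1)"] by simp
    show "AE s in start. rate (-1) s \<le> (\<Sum>i\<in>UNIV. 1 / a $ i)" using rate_properties(2) by (intro AE_I2) auto
    show "0 < (LINT s|start. rate (-1) s)" using mean_flight_rate_pos[OF sides] by (simp add: integral_rate)
  qed (auto intro: rate_ratio_measurable simp: rate_ratio_bounds, simp add: rate_ratio_def)
  then show ?thesis by (simp add: integral_rate)
qed

definition mean_flight_count :: "real \<Rightarrow> real \<Rightarrow> real" where
  "mean_flight_count R x = (LINT s|start. real (long_flights a R x s))"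

text \<open>
  If almost surely no flight is completed within distance \<open>R\<close>, the value 0 is picked, and the limit law is
  concentrated at 0. This happens for small \<open>R\<close> only, since the mean count eventually grows linearly in \<open>R\<close>.
\<close>

lemma limit_law_many_particles:
  assumes R: "0 < R"
  shows "\<exists>L. real_distribution L
    \<and> (\<forall>x. (\<lambda>M. LINT \<omega>|PiM {..<M} (\<lambda>_. start). pooled_ratio M R x \<omega>) \<longlonglongrightarrow> 1 - cdf L x)
    \<and> (0 < mean_flight_count R (-1) \<longrightarrow> (\<forall>x. cdf L x = 1 - mean_flight_count R x / mean_flight_count R (-1)))"
proof -
  define B where "B = R * (\<Sum>i\<in>UNIV. 1 / a $ i) + CARD('n)"
  have bound: "AE s in start. \<forall>x. real (long_flights a R x s) \<le> B"
    using AE_long_flights_le by eventually_elim (use R in \<open>simp add: B_def\<close>)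
  have le: "real (long_flights a R x s) \<le> real (long_flights a R (-1) s)" if "s \<in> space start" for s x
    using long_flights_le_total[of R x s] long_flights_neg[OF that, of "-1" R] by simp
  have int: "integrable start (\<lambda>s. real (long_flights a R x s))" for x
    by (rule start.integrable_const_bound[where B=B]) (use bound in \<open>auto elim: eventually_mono\<close>)
  have nonneg: "0 \<le> mean_flight_count R (-1)" unfolding mean_flight_count_def by (intro integral_nonneg_AE) auto
  show ?thesis
  proof (cases "0 < mean_flight_count R (-1)")
    case True
    have "\<exists>L. real_distribution L \<and> (\<forall>x. cdf L x = 1 - (LINT s|start. real (long_flights a R x s) / mean_flight_count R (-1)))"
    proof (rule start.real_distribution_of_survival[where B="B / mean_flight_count R (-1)" and b=R])
      show "AE s in start. \<forall>x. 0 \<le> real (long_flights a R x s) / mean_flight_count R (-1) \<and>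
          real (long_flights a R x s) / mean_flight_count R (-1) \<le> B / mean_flight_count R (-1)"
        using bound by eventually_elim (use True in \<open>auto intro: divide_right_mono\<close>)
      fix x y :: real and s :: "(real^'n) \<times> (real^'n)"
      show "real (long_flights a R y s) / mean_flight_count R (-1) \<le> real (long_flights a R x s) / mean_flight_count R (-1)" if "x \<le> y"
        using long_flights_antimono[OF that, of R s] True by (intro divide_right_mono) auto
      show "((\<lambda>y. real (long_flights a R y s) / mean_flight_count R (-1)) \<longlongrightarrow> real (long_flights a R x s) / mean_flight_count R (-1)) (at_right x)"
        using True by (intro tendsto_divide long_flights_right_continuous tendsto_const) auto
      show "(LINT s|start. real (long_flights a R x s) / mean_flight_count R (-1)) = 1" if "x < 0"
      proof -
        have "(LINT s|start. real (long_flights a R x s)) = mean_flight_count R (-1)"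
          unfolding mean_flight_count_def using long_flights_neg \<open>x < 0\<close> by (intro Bochner_Integration.integral_cong) auto
        then show ?thesis using True by simp
      qed
      show "(LINT s|start. real (long_flights a R x s) / mean_flight_count R (-1)) = 0" if "R \<le> x"
      proof -
        have "(LINT s|start. real (long_flights a R x s) / mean_flight_count R (-1)) = (LINT s|start. 0)"
          using long_flights_eq_0 \<open>R \<le> x\<close> by (intro Bochner_Integration.integral_cong) auto
        then show ?thesis by simp
      qed
    qed measurable
    then obtain L where L: "real_distribution L" "\<And>x. cdf L x = 1 - mean_flight_count R x / mean_flight_count R (-1)"
      by (auto simp: mean_flight_count_def)
    have "(\<lambda>M. LINT \<omega>|PiM {..<M} (\<lambda>_. start). pooled_ratio M R x \<omega>) \<longlonglongrightarrow> mean_flight_count R x / mean_flight_count R (-1)" for x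
      unfolding mean_flight_count_def
    proof (rule start.law_of_large_numbers_ratio[where B=B])
      show "AE s in start. real (long_flights a R (-1) s) \<le> B" using bound by eventually_elim auto
      show "0 < (LINT s|start. real (long_flights a R (-1) s))" using True by (simp add: mean_flight_count_def)
    qed (use le in \<open>auto intro: pooled_ratio_measurable simp: pooled_ratio_bounds\<close>, simp add: pooled_ratio_def)
    with L show ?thesis by (intro exI[of _ L]) auto
  next
    case False
    then have "mean_flight_count R (-1) = 0" using nonneg by simp
    then have "AE s in start. real (long_flights a R (-1) s) = 0"
      unfolding mean_flight_count_def using integral_nonneg_eq_0_iff_AE[OF int[of "-1"]] by auto
    then have AE0: "AE \<omega> in PiM {..<M} (\<lambda>_. start). \<forall>i\<in>{..<M}. real (long_flights a R (-1) (\<omega> i)) = 0" for M :: nat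
      by (intro AE_finite_allI AE_PiM_component) (auto intro: start.prob_space_axioms)
    have eq: "(LINT \<omega>|PiM {..<M} (\<lambda>_. start). pooled_ratio M R x \<omega>) = of_bool (x < 0)" for M x
    proof -
      let ?Q = "PiM {..<M} (\<lambda>_. start)"
      interpret Q: prob_space ?Q by (rule prob_space_PiM) (rule start.prob_space_axioms)
      have "(LINT \<omega>|?Q. pooled_ratio M R x \<omega>) = (LINT \<omega>|?Q. of_bool (x < 0))"
      proof (rule integral_cong_AE)
        show "AE \<omega> in ?Q. pooled_ratio M R x \<omega> = of_bool (x < 0)"
          using AE0[of M] by eventually_elim (simp add: pooled_ratio_def)
      qed (auto intro: pooled_ratio_measurable)
      then show ?thesis using Q.prob_space by simp
    qed
    interpret ret: prob_space "return borel (0::real)" by (rule prob_space_return) simp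
    have "real_distribution (return borel 0)" by unfold_locales simp_all
    moreover have "cdf (return borel 0) x = 1 - of_bool (x < 0)" for x :: real
      by (simp add: cdf_def measure_return not_less indicator_def)
    ultimately show ?thesis using False by (intro exI[of _ "return borel 0"]) (simp add: eq)
  qed
qed

lemma mean_flight_count_tendsto: "((\<lambda>R. mean_flight_count R x / R) \<longlongrightarrow> mean_flight_rate a x) at_top"
proof -
  define K where "K = (\<Sum>i\<in>UNIV. 1 / a $ i) + CARD('n)"
  have "((\<lambda>R. LINT s|start. real (long_flights a R x s) / R) \<longlongrightarrow> (LINT s|start. rate x s)) at_top"
  proof (rule integral_dominated_convergence_at_top[where w="\<lambda>_. K"])
    show "\<forall>\<^sub>F R in at_top. AE s in start. norm (real (long_flights a R x s) / R) \<le> K"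
      using eventually_ge_at_top[of "1::real"]
    proof eventually_elim
      case (elim R)
      show ?case using AE_long_flights_le
      proof eventually_elim
        case (elim s)
        then have "real (long_flights a R x s) \<le> R * (\<Sum>i\<in>UNIV. 1 / a $ i) + CARD('n)" using \<open>1 \<le> R\<close> by simp
        also have "\<dots> \<le> R * (\<Sum>i\<in>UNIV. 1 / a $ i) + R * CARD('n)" using \<open>1 \<le> R\<close> by simp
        also have "\<dots> = K * R" by (simp add: K_def algebra_simps)
        finally show ?case using \<open>1 \<le> R\<close> by (simp add: divide_le_eq)
      qed
    qed
  qed (use AE_long_flights_rate in auto)
  then show ?thesis by (simp add: mean_flight_count_def integral_rate)
qed

theorem converges_long_time_first:
  "\<exists>L. (\<forall>M>0. real_distribution (L M) \<and> converges_in_distribution (\<lambda>R. bounce_law a \<mu> M R) (L M) at_top) \<and>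
     converges_in_distribution L (chord_law a) sequentially"
proof -
  obtain L where L: "\<And>M. 0 < M \<Longrightarrow> real_distribution (L M) \<and>
      (\<forall>x. cdf (L M) x = 1 - (LINT \<omega>|PiM {..<M} (\<lambda>_. start). rate_ratio M x \<omega>))"
    using limit_law_long_time by metis
  have "((\<lambda>R. cdf (bounce_law a \<mu> M R) x) \<longlongrightarrow> cdf (L M) x) at_top" if "0 < M" for M x
    using L[OF that] pooled_ratio_tendsto[OF that, of x]
    by (simp add: cdf_bounce_law) (intro tendsto_diff tendsto_const)
  moreover have "(\<lambda>M. cdf (L M) x) \<longlonglongrightarrow> cdf (chord_law a) x" for x
  proof -
    have "(\<lambda>M. 1 - (LINT \<omega>|PiM {..<M} (\<lambda>_. start). rate_ratio M x \<omega>)) \<longlonglongrightarrow> cdf (chord_law a) x"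
      unfolding cdf_chord_law[OF dim sides] by (intro tendsto_diff tendsto_const rate_ratio_tendsto)
    moreover have "\<forall>\<^sub>F M in sequentially. 1 - (LINT \<omega>|PiM {..<M} (\<lambda>_. start). rate_ratio M x \<omega>) = cdf (L M) x"
      using eventually_gt_at_top[of 0] by eventually_elim (use L in simp)
    ultimately show ?thesis by (rule Lim_transform_eventually)
  qed
  ultimately show ?thesis using L by (auto simp: converges_in_distribution_def intro!: exI[of _ L])
qed

theorem converges_many_particles_first:
  "\<exists>L. (\<forall>R>0. real_distribution (L R) \<and> converges_in_distribution (\<lambda>M. bounce_law a \<mu> M R) (L R) sequentially) \<and>
     converges_in_distribution L (chord_law a) at_top"
proof -
  have "\<forall>R\<in>{0<..}. \<exists>L. real_distribution L
    \<and> (\<forall>x. (\<lambda>M. LINT \<omega>|PiM {..<M} (\<lambda>_. start). pooled_ratio M R x \<omega>) \<longlonglongrightarrow> 1 - cdf L x)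
    \<and> (0 < mean_flight_count R (-1) \<longrightarrow> (\<forall>x. cdf L x = 1 - mean_flight_count R x / mean_flight_count R (-1)))"
    using limit_law_many_particles by blast
  from bchoice[OF this] obtain L where L: "\<And>R. 0 < R \<Longrightarrow> real_distribution (L R)
    \<and> (\<forall>x. (\<lambda>M. LINT \<omega>|PiM {..<M} (\<lambda>_. start). pooled_ratio M R x \<omega>) \<longlonglongrightarrow> 1 - cdf (L R) x)
    \<and> (0 < mean_flight_count R (-1) \<longrightarrow> (\<forall>x. cdf (L R) x = 1 - mean_flight_count R x / mean_flight_count R (-1)))"
    by auto
  have "(\<lambda>M. cdf (bounce_law a \<mu> M R) x) \<longlonglongrightarrow> cdf (L R) x" if "0 < R" for R x
  proof -
    have "(\<lambda>M. 1 - (LINT \<omega>|PiM {..<M} (\<lambda>_. start). pooled_ratio M R x \<omega>)) \<longlonglongrightarrow> 1 - (1 - cdf (L R) x)"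
      using L[OF that] by (intro tendsto_diff tendsto_const) auto
    then show ?thesis by (simp add: cdf_bounce_law)
  qed
  moreover have "((\<lambda>R. cdf (L R) x) \<longlongrightarrow> cdf (chord_law a) x) at_top" for x
  proof -
    have pos: "0 < mean_flight_rate a (-1)" by (rule mean_flight_rate_pos[OF sides])
    have "((\<lambda>R. 1 - (mean_flight_count R x / R) / (mean_flight_count R (-1) / R)) \<longlongrightarrow> cdf (chord_law a) x) at_top"
      unfolding cdf_chord_law[OF dim sides]
      using pos by (intro tendsto_diff tendsto_const tendsto_divide mean_flight_count_tendsto) auto
    moreover have "\<forall>\<^sub>F R in at_top. 0 < mean_flight_count R (-1) / R"
      by (rule order_tendstoD(1)[OF mean_flight_count_tendsto pos])
    then have "\<forall>\<^sub>F R in at_top. 1 - (mean_flight_count R x / R) / (mean_flight_count R (-1) / R) = cdf (L R) x"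
      using eventually_gt_at_top[of "0::real"]
    proof eventually_elim
      case (elim R)
      then have "0 < mean_flight_count R (-1)" by (simp add: zero_less_divide_iff)
      with L[OF elim(2)] elim show ?case by simp
    qed
    ultimately show ?thesis by (rule Lim_transform_eventually)
  qed
  ultimately show ?thesis using L by (auto simp: converges_in_distribution_def intro!: exI[of _ L])
qed

end

theorem theorem1:
  fixes a :: "real^'n" and \<mu> :: "(real^'n) measure"
  assumes "CARD('n) \<ge> 2"
    and "\<And>i. 0 < a $ i"
    and "prob_space \<mu>"
    and "sets \<mu> = sets (restrict_space borel (cbox 0 a))"
  shows "(\<exists>L :: nat \<Rightarrow> real measure.
            (\<forall>M>0. real_distribution (L M) \<and>
               converges_in_distribution (\<lambda>R. bounce_law a \<mu> M R) (L M) at_top) \<and>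
            converges_in_distribution L (chord_law a) sequentially) \<and>
         (\<exists>L :: real \<Rightarrow> real measure.
            (\<forall>R>0. real_distribution (L R) \<and>
               converges_in_distribution (\<lambda>M. bounce_law a \<mu> M R) (L R) sequentially) \<and>
            converges_in_distribution L (chord_law a) at_top)"
proof -
  interpret random_billiard a \<mu> using assms by (rule random_billiard.intro)
  show ?thesis using converges_long_time_first converges_many_particles_first by (rule conjI)
qed

end
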